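(* Let $M$ be an Abelian group. There exists a group $G\in\mathcal{A}_0$ such that $M\cong\mathrm{Mult}\,G$ if and only if $M\in\mathcal{A}_0$ and for any $\tau\in T(M)$ the rank of $\mathrm{Reg}_\tau M$ satisfies $r(\mathrm{Reg}_\tau M)=k_\tau^3$ for some $k_\tau\in\mathbb{N}$.
   Context: All groups are additively written Abelian groups; $\mathbb{N}$ is the set of positive integers; $r(\cdot)$ denotes rank. A multiplication on a group $G$ is a homomorphism $G\otimes G\to G$; $\mathrm{Mult}\,G=\mathrm{Hom}(G\otimes G,G)$ is the additive group of all multiplications on $G$. A torsion-free group $G$ of finite rank is almost completely decomposable (ACD) if it contains a completely decomposable subgroup (a direct sum of rank-1 groups) of finite index. Its regulator $\mathrm{Reg}\,G$ is the intersection of all its completely decomposable subgroups of least index; it is a completely decomposable, fully invariant subgroup of finite index. For a type $\tau$, $\mathrm{Reg}_\tau G$ denotes the sum of the rank-1 direct summands of type $\tau$ in a given decomposition of $\mathrm{Reg}\,G$ into rank-1 summands, and $T(G)=\{\tau\mid \mathrm{Reg}_\tau G\neq0\}$ is the set of critical types. $G$ is block-rigid if the types in $T(G)$ are pairwise incomparable (then the $\mathrm{Reg}_\tau G$ are uniquely determined). $G$ is of ring type if all types in $T(G)$ are idempotent. $\mathcal{A}_0$ is the class of block-rigid ACD groups of ring type with cyclic quotient $G/\mathrm{Reg}\,G$. *)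

theory Defs
  imports
    "HOL-Algebra.Algebra"
    "HOL-Library.Extended_Nat"
begin

text \<open>
  Abelian groups are commutative groups in the sense of \<open>comm_group\<close>, hence written
  multiplicatively: the integer multiple \<open>n x\<close> is \<open>x [^] n\<close> and finite sums are \<open>finprod\<close>.
  A subgroup \<open>H\<close> of \<open>G\<close>, regarded as a group, is \<open>G\<lparr>carrier := H\<rparr>\<close>.
\<close>

section \<open>Tensor products and the group of multiplications\<close>

definition tensor_relations ::
  "('a, 'm) monoid_scheme \<Rightarrow> ('b, 'n) monoid_scheme \<Rightarrow> (('a \<times> 'b) \<Rightarrow>\<^sub>0 int) set" where
  "tensor_relations G H =
     {frag_of (x \<otimes>\<^bsub>G\<^esub> x', y) - frag_of (x, y) - frag_of (x', y) | x x' y.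
        x \<in> carrier G \<and> x' \<in> carrier G \<and> y \<in> carrier H} \<union>
     {frag_of (x, y \<otimes>\<^bsub>H\<^esub> y') - frag_of (x, y) - frag_of (x, y') | x y y'.
        x \<in> carrier G \<and> y \<in> carrier H \<and> y' \<in> carrier H}"

definition tensor_product ::
  "('a, 'm) monoid_scheme \<Rightarrow> ('b, 'n) monoid_scheme \<Rightarrow> (('a \<times> 'b) \<Rightarrow>\<^sub>0 int) set monoid" where
  "tensor_product G H =
     (let F = free_Abelian_group (carrier G \<times> carrier H)
      in F Mod generate F (tensor_relations G H))"

text \<open>
  Homomorphisms are required to be \<open>extensional\<close> so that each one is represented by exactly one
  HOL function.
\<close>

definition hom_group ::
  "('a, 'm) monoid_scheme \<Rightarrow> ('b, 'n) monoid_scheme \<Rightarrow> ('a \<Rightarrow> 'b) monoid" where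
  "hom_group A B =
     \<lparr>carrier = hom A B \<inter> extensional (carrier A),
      monoid.mult = (\<lambda>f g. \<lambda>x\<in>carrier A. f x \<otimes>\<^bsub>B\<^esub> g x),
      one = (\<lambda>x\<in>carrier A. \<one>\<^bsub>B\<^esub>)\<rparr>"

definition Mult_group ::
  "('a, 'm) monoid_scheme \<Rightarrow> ((('a \<times> 'a) \<Rightarrow>\<^sub>0 int) set \<Rightarrow> 'a) monoid" where
  "Mult_group G = hom_group (tensor_product G G) G"


section \<open>Rank\<close>

definition torsion_free :: "('a, 'm) monoid_scheme \<Rightarrow> bool" where
  "torsion_free G \<longleftrightarrow>
     (\<forall>x\<in>carrier G. \<forall>n::nat. n > 0 \<longrightarrow> x [^]\<^bsub>G\<^esub> n = \<one>\<^bsub>G\<^esub> \<longrightarrow> x = \<one>\<^bsub>G\<^esub>)"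

definition independent_set :: "('a, 'm) monoid_scheme \<Rightarrow> 'a set \<Rightarrow> bool" where
  "independent_set G S \<longleftrightarrow>
     S \<subseteq> carrier G \<and>
     (\<forall>F (c :: 'a \<Rightarrow> int). finite F \<and> F \<subseteq> S \<and> (\<Otimes>\<^bsub>G\<^esub>x\<in>F. x [^]\<^bsub>G\<^esub> c x) = \<one>\<^bsub>G\<^esub>
        \<longrightarrow> (\<forall>x\<in>F. c x = 0))"

text \<open>
  The rank is used for torsion-free groups only.  It is \<open>\<infinity>\<close> exactly if there
  are arbitrarily large finite independent sets.
\<close>

definition group_rank :: "('a, 'm) monoid_scheme \<Rightarrow> enat" where
  "group_rank G = (SUP S\<in>{S. finite S \<and> independent_set G S}. enat (card S))"


section \<open>Types\<close>

definition characteristics :: "(nat \<Rightarrow> enat) set" where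
  "characteristics = {\<chi>. \<forall>p. \<not> Factorial_Ring.prime p \<longrightarrow> \<chi> p = 0}"

definition height :: "('a, 'm) monoid_scheme \<Rightarrow> nat \<Rightarrow> 'a \<Rightarrow> enat" where
  "height G p x = (SUP n\<in>{n::nat. \<exists>y\<in>carrier G. y [^]\<^bsub>G\<^esub> (p ^ n) = x}. enat n)"

definition characteristic :: "('a, 'm) monoid_scheme \<Rightarrow> 'a \<Rightarrow> nat \<Rightarrow> enat" where
  "characteristic G x = (\<lambda>p. if Factorial_Ring.prime p then height G p x else 0)"

definition char_equiv :: "((nat \<Rightarrow> enat) \<times> (nat \<Rightarrow> enat)) set" where
  "char_equiv =
     {(\<chi>, \<psi>). \<chi> \<in> characteristics \<and> \<psi> \<in> characteristics \<and>
        finite {p. \<chi> p \<noteq> \<psi> p} \<and> (\<forall>p. \<chi> p \<noteq> \<psi> p \<longrightarrow> \<chi> p \<noteq> \<infinity> \<and> \<psi> p \<noteq> \<infinity>)}"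

lemma equiv_char_equiv: "equiv characteristics char_equiv"
proof (rule equivI)
  show "char_equiv \<subseteq> characteristics \<times> characteristics"
    by (auto simp: char_equiv_def)
  show "refl_on characteristics char_equiv"
    by (auto simp: char_equiv_def refl_on_def)
  show "sym char_equiv"
    by (auto simp: char_equiv_def sym_def eq_commute)
  show "trans char_equiv"
  proof (rule transI)
    fix \<chi> \<psi> \<phi>
    assume 1: "(\<chi>, \<psi>) \<in> char_equiv" and 2: "(\<psi>, \<phi>) \<in> char_equiv"
    have "{p. \<chi> p \<noteq> \<phi> p} \<subseteq> {p. \<chi> p \<noteq> \<psi> p} \<union> {p. \<psi> p \<noteq> \<phi> p}"
      by auto
    then have "finite {p. \<chi> p \<noteq> \<phi> p}"
      using 1 2 by (auto simp: char_equiv_def intro: finite_subset)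
    moreover have "\<chi> p \<noteq> \<infinity> \<and> \<phi> p \<noteq> \<infinity>" if "\<chi> p \<noteq> \<phi> p" for p
      using 1 2 that by (auto simp: char_equiv_def) metis+
    ultimately show "(\<chi>, \<phi>) \<in> char_equiv"
      using 1 2 by (simp add: char_equiv_def)
  qed
qed

text \<open>A type is an element of \<open>characteristics // char_equiv\<close>.\<close>

type_synonym group_type = "(nat \<Rightarrow> enat) set"

definition type_le :: "group_type \<Rightarrow> group_type \<Rightarrow> bool" where
  "type_le \<sigma> \<tau> \<longleftrightarrow> (\<exists>\<chi>\<in>\<sigma>. \<exists>\<psi>\<in>\<tau>. \<forall>p. \<chi> p \<le> \<psi> p)"

definition idempotent_type :: "group_type \<Rightarrow> bool" where
  "idempotent_type \<tau> \<longleftrightarrow> (\<exists>\<chi>\<in>\<tau>. \<forall>p. \<chi> p = 0 \<or> \<chi> p = \<infinity>)"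

text \<open>
  In a torsion-free group of rank 1 all nontrivial elements have equivalent characteristics;
  the following description is meant for these groups only.
\<close>

definition rank1_type :: "('a, 'm) monoid_scheme \<Rightarrow> group_type" where
  "rank1_type A =
     (THE \<tau>. \<exists>x\<in>carrier A. x \<noteq> \<one>\<^bsub>A\<^esub> \<and> \<tau> = char_equiv `` {characteristic A x})"


section \<open>Almost completely decomposable groups\<close>

text \<open>
  \<open>\<D>\<close> is a decomposition of the subgroup \<open>C\<close> of \<open>G\<close> into a direct sum of rank-1 groups:
  each element of \<open>C\<close> is uniquely a sum of elements taken one from each member of \<open>\<D>\<close>.
  The members are nonzero and independent, hence pairwise distinct, so a set of summands suffices.
  Only groups \<open>G\<close> of finite rank are considered, hence \<open>\<D>\<close> is finite.
\<close>

definition rank1_decomposition ::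
  "('a, 'm) monoid_scheme \<Rightarrow> 'a set \<Rightarrow> 'a set set \<Rightarrow> bool" where
  "rank1_decomposition G C \<D> \<longleftrightarrow>
     finite \<D> \<and>
     (\<forall>A\<in>\<D>. subgroup A G \<and> group_rank (G\<lparr>carrier := A\<rparr>) = 1) \<and>
     bij_betw (\<lambda>x. \<Otimes>\<^bsub>G\<^esub>A\<in>\<D>. x A) (\<Pi>\<^sub>E A\<in>\<D>. A) C"

definition completely_decomposable_in :: "('a, 'm) monoid_scheme \<Rightarrow> 'a set \<Rightarrow> bool" where
  "completely_decomposable_in G C \<longleftrightarrow> subgroup C G \<and> (\<exists>\<D>. rank1_decomposition G C \<D>)"

definition cd_finite_index :: "('a, 'm) monoid_scheme \<Rightarrow> 'a set set" where
  "cd_finite_index G = {C. completely_decomposable_in G C \<and> finite (rcosets\<^bsub>G\<^esub> C)}"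

definition almost_completely_decomposable :: "('a, 'm) monoid_scheme \<Rightarrow> bool" where
  "almost_completely_decomposable G \<longleftrightarrow>
     comm_group G \<and> torsion_free G \<and> group_rank G \<noteq> \<infinity> \<and> cd_finite_index G \<noteq> {}"

definition Reg :: "('a, 'm) monoid_scheme \<Rightarrow> 'a set" where
  "Reg G = \<Inter>{C \<in> cd_finite_index G.
      \<forall>C'\<in>cd_finite_index G. card (rcosets\<^bsub>G\<^esub> C) \<le> card (rcosets\<^bsub>G\<^esub> C')}"

text \<open>
  \<open>\<D>\<close> below is the given decomposition of \<open>Reg G\<close> into rank-1 summands.  The set of critical
  types does not depend on \<open>\<D>\<close>, and neither do the groups \<open>Reg_part G \<D> \<tau>\<close> if \<open>G\<close> is block-rigid.
\<close>

definition Reg_part ::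
  "('a, 'm) monoid_scheme \<Rightarrow> 'a set set \<Rightarrow> group_type \<Rightarrow> 'a set" where
  "Reg_part G \<D> \<tau> = generate G (\<Union>{A \<in> \<D>. rank1_type (G\<lparr>carrier := A\<rparr>) = \<tau>})"

definition critical_types :: "('a, 'm) monoid_scheme \<Rightarrow> 'a set set \<Rightarrow> group_type set" where
  "critical_types G \<D> = {\<tau>. Reg_part G \<D> \<tau> \<noteq> {\<one>\<^bsub>G\<^esub>}}"

definition block_rigid :: "('a, 'm) monoid_scheme \<Rightarrow> bool" where
  "block_rigid G \<longleftrightarrow>
     (\<exists>\<D>. rank1_decomposition G (Reg G) \<D> \<and>
        (\<forall>\<sigma>\<in>critical_types G \<D>. \<forall>\<tau>\<in>critical_types G \<D>. type_le \<sigma> \<tau> \<longrightarrow> \<sigma> = \<tau>))"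

definition of_ring_type :: "('a, 'm) monoid_scheme \<Rightarrow> bool" where
  "of_ring_type G \<longleftrightarrow>
     (\<exists>\<D>. rank1_decomposition G (Reg G) \<D> \<and> (\<forall>\<tau>\<in>critical_types G \<D>. idempotent_type \<tau>))"

definition class_A0 :: "('a, 'm) monoid_scheme \<Rightarrow> bool" where
  "class_A0 G \<longleftrightarrow>
     almost_completely_decomposable G \<and> block_rigid G \<and> of_ring_type G \<and>
     cyclic_group (G Mod Reg G)"

end

theory Submission
  imports Defs "HOL-Library.Function_Algebras"
begin

text \<open>
  If the characteristic of a generator of a rank-1 group has only the values \<open>0\<close> and \<open>\<infinity>\<close>, the
  group is the ring \<open>Zs S\<close> of rationals whose denominators have all prime factors in some set
  \<open>S\<close> of primes.  Hence \<open>G \<in> \<A>\<^sub>0\<close> is, in coordinates, \<open>L + \<int> d\<close> with \<open>L\<close> a direct sum of such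
  rings, grouped into blocks according to their pairwise incomparable \<open>S\<close>.  Euclid's algorithm
  inside a block and rescaling make \<open>d\<close> live on one coordinate of each block, with value
  \<open>s / w\<close> in lowest terms, and make the blocks pure in \<open>G\<close>; then \<open>L\<close> is the regulator.

  A multiplication vanishes on pairs from different blocks and maps a block into itself.  In the
  basis \<open>e\<^sub>i \<otimes> e\<^sub>j \<mapsto> w\<^sub>i w\<^sub>j e\<^sub>l\<close> the multiplications form again a group \<open>L' + \<int> d'\<close> with blocks of
  cubed size and the same \<open>w\<close>, where \<open>s\<close> is replaced by an inverse \<open>c\<close> of \<open>s\<close> modulo \<open>w\<close>.  This
  gives one direction; for the other one, \<open>M\<close> with values \<open>c / w\<close> is realized by \<open>G\<close> with
  values \<open>s / w\<close>.
\<close>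

section \<open>Torsion-free groups and heights\<close>

text \<open>Why the inverse \<open>c\<close> of \<open>s\<close> appears: with coordinate
  \<open>b\<close> at the diagonal triple of a block, a multiplication sends the square of
  \<open>d\<close> to \<open>(s / w)^2 * w^2 * b = s^2 * b\<close> there, and this has to agree with
  \<open>t * s / w\<close> modulo integral terms, for one integer \<open>t\<close> common to all
  blocks. Since \<open>c * s = 1 + k * w\<close>, the condition becomes that \<open>b\<close> agrees
  with \<open>t * c / w\<close>. So the admissible coordinates again form a lattice extended by a
  single vector. The weights \<open>w i * w j\<close> are forced as well: the product of
  \<open>d\<close> with a basis element lies in a block, a pure block has no denominators, and so
  the denominators of \<open>d\<close> must be absorbed by the coefficients. Purity thus serves
  twice, for the regulator and for the products. Both uses rest on one fact: a pure block is the set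
  of all elements infinitely divisible by the primes of its \<open>S\<close>. Any rank-1 subgroup of
  that type lies in this set, which bounds all completely decomposable subgroups of finite index at
  once, and a bilinear map preserves such divisibility in each argument.\<close>

locale tf_group = comm_group G for G (structure) +
  assumes tf: "torsion_free G"
begin

lemma nat_pow_eq_one: "x \<in> carrier G \<Longrightarrow> n > 0 \<Longrightarrow> x [^] (n::nat) = \<one> \<Longrightarrow> x = \<one>"
  using tf unfolding torsion_free_def by blast

lemma int_pow_eq_one:
  assumes "x \<in> carrier G" "k \<noteq> 0" "x [^] (k::int) = \<one>"
  shows "x = \<one>"
proof (cases "k > 0")
  case True
  then show ?thesis
    using assms nat_pow_eq_one[of x "nat k"] int_pow_int[of G x "nat k"] by simp
next
  case False
  then have "x [^] (-k) = \<one>" using assms by (simp add: int_pow_neg)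
  then show ?thesis
    using assms False nat_pow_eq_one[of x "nat (-k)"] int_pow_int[of G x "nat (-k)"] by simp
qed

lemma int_pow_cancel:
  assumes "x \<in> carrier G" "y \<in> carrier G" "k \<noteq> 0" "x [^] (k::int) = y [^] k"
  shows "x = y"
proof -
  have "(x \<otimes> inv y) [^] k = x [^] k \<otimes> inv (y [^] k)"
    using assms(1,2) by (simp add: int_pow_distrib int_pow_inv)
  also have "\<dots> = \<one>"
    using assms(2) unfolding assms(4) by simp
  finally have "(x \<otimes> inv y) [^] k = \<one>" .
  then have "x \<otimes> inv y = \<one>"
    using int_pow_eq_one[OF _ assms(3)] assms(1,2) by auto
  then show ?thesis
    using assms(1,2) inv_equality[of x "inv y"] by simp
qed

lemma int_pow_eqD:
  assumes "a \<in> carrier G" "a \<noteq> \<one>" "a [^] (m::int) = a [^] (n::int)"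
  shows "m = n"
proof -
  have "a [^] (m - n) = \<one>" using assms by (simp add: int_pow_diff)
  then show ?thesis using int_pow_eq_one[of a "m - n"] assms by auto
qed

lemma tf_subgroup:
  assumes "subgroup H G" shows "tf_group (G\<lparr>carrier := H\<rparr>)"
proof -
  interpret H: group "G\<lparr>carrier := H\<rparr>"
    using subgroup.subgroup_is_group[OF assms is_group] .
  interpret H: comm_group "G\<lparr>carrier := H\<rparr>"
    using subgroup.subset[OF assms] by (intro H.group_comm_groupI) (auto intro: m_comm)
  show ?thesis
    using tf subgroup.subset[OF assms]
    by unfold_locales
      (auto simp: torsion_free_def nat_pow_consistent[symmetric])
qed

text \<open>The exponents \<open>n\<close> for which \<open>x\<close> has a \<open>p^n\<close>-th
  root are closed downwards, so a supremum of at least \<open>n\<close> means that \<open>n\<close>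
  itself is among them.\<close>

lemma height_ge_iff:
  assumes x: "x \<in> carrier G"
  shows "enat n \<le> height G p x \<longleftrightarrow> (\<exists>y\<in>carrier G. y [^] (p ^ n) = x)"
proof -
  let ?S = "{n::nat. \<exists>y\<in>carrier G. y [^] (p ^ n) = x}"
  have down: "m \<in> ?S" if n: "n \<in> ?S" and "m \<le> n" for m n
  proof -
    obtain y where y: "y \<in> carrier G" "y [^] (p ^ n) = x" using n by auto
    have "p ^ (n - m) * p ^ m = p ^ n"
      using that by (metis le_add_diff_inverse2 power_add)
    then have "(y [^] (p ^ (n - m))) [^] (p ^ m) = x"
      using y by (simp add: nat_pow_pow)
    then show ?thesis using y by blast
  qed
  have "0 \<in> ?S" using x by (auto intro!: bexI[of _ x])
  show ?thesis
  proof
    assume le: "enat n \<le> height G p x"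
    show "\<exists>y\<in>carrier G. y [^] (p ^ n) = x"
    proof (rule ccontr)
      assume "\<not> ?thesis"
      then have "n \<notin> ?S" by simp
      then have lt: "m < n" if "m \<in> ?S" for m
        using down[OF that] by (meson not_le)
      then have "n > 0" using \<open>0 \<in> ?S\<close> by blast
      have "height G p x \<le> enat (n - 1)"
        unfolding height_def
      proof (rule SUP_least)
        fix m assume "m \<in> ?S"
        then show "enat m \<le> enat (n - 1)" using lt by fastforce
      qed
      then have "enat n \<le> enat (n - 1)" using le by (rule order_trans[rotated])
      then show False using \<open>n > 0\<close> by simp
    qed
  next
    assume "\<exists>y\<in>carrier G. y [^] (p ^ n) = x"
    then show "enat n \<le> height G p x"
      unfolding height_def by (intro SUP_upper) simp
  qed
qed

lemma height_eq_infinity_iff: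
  assumes x: "x \<in> carrier G"
  shows "height G p x = \<infinity> \<longleftrightarrow> (\<forall>n. \<exists>y\<in>carrier G. y [^] (p ^ n) = x)"
proof
  assume "height G p x = \<infinity>"
  then show "\<forall>n. \<exists>y\<in>carrier G. y [^] (p ^ n) = x" using height_ge_iff[OF x, of _ p] by simp
next
  assume *: "\<forall>n. \<exists>y\<in>carrier G. y [^] (p ^ n) = x"
  then have ge: "enat n \<le> height G p x" for n using height_ge_iff[OF x, of _ p] by simp
  show "height G p x = \<infinity>"
  proof (cases "height G p x")
    case (enat k)
    then show ?thesis using ge[of "Suc k"] by simp
  qed
qed

lemma height_le:
  assumes x: "x \<in> carrier G"
    and H: "tf_group H" and y: "y \<in> carrier H"
    and "\<And>n z. z \<in> carrier G \<Longrightarrow> z [^] (p ^ n) = x \<Longrightarrow> \<exists>w\<in>carrier H. w [^]\<^bsub>H\<^esub> (p ^ n) = y"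
  shows "height G p x \<le> height H p y"
  unfolding height_def[of G]
proof (rule SUP_least)
  fix n assume "n \<in> {n. \<exists>y\<in>carrier G. y [^] (p ^ n) = x}"
  then have "\<exists>w\<in>carrier H. w [^]\<^bsub>H\<^esub> (p ^ n) = y" using assms by blast
  then show "enat n \<le> height H p y" using tf_group.height_ge_iff[OF H y] by blast
qed

lemma height_hom_le:
  assumes x: "x \<in> carrier G" and H: "tf_group H" and f: "f \<in> hom G H"
  shows "height G p x \<le> height H p (f x)"
proof (rule height_le[OF x H])
  interpret H: tf_group H by fact
  show "f x \<in> carrier H" using f x by (auto simp: hom_def)
  fix n z assume "z \<in> carrier G" "z [^] (p ^ n) = x"
  then show "\<exists>w\<in>carrier H. w [^]\<^bsub>H\<^esub> (p ^ n) = f x"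
    using f by (intro bexI[of _ "f z"]) (auto simp: hom_nat_pow[OF f _ is_group H.is_group, symmetric] hom_in_carrier)
qed

text \<open>Bezout: if \<open>u * k + v * n = 1\<close>, then
  \<open>y [^] u \<otimes> x [^] v\<close> is the wanted root.\<close>

lemma coprime_root:
  assumes "x \<in> carrier G" "y \<in> carrier G" "coprime k n" "y [^] (n::nat) = x [^] (k::nat)"
  shows "\<exists>z\<in>carrier G. z [^] n = x"
proof -
  have "coprime (int k) (int n)" using assms by simp
  then obtain u v where uv: "u * int k + v * int n = 1"
    using bezout_int[of "int k" "int n"] by (auto simp: coprime_iff_gcd_eq_1)
  have yn: "y [^] int n = x [^] int k" using assms by (simp add: int_pow_int)
  have "(y [^] u \<otimes> x [^] v) [^] int n = (y [^] int n) [^] u \<otimes> (x [^] v) [^] int n"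
    using assms by (simp add: int_pow_distrib int_pow_pow mult.commute)
  also have "\<dots> = x [^] (u * int k + v * int n)"
    using assms unfolding yn by (simp add: int_pow_pow int_pow_mult mult.commute)
  also have "\<dots> = x" using assms uv by simp
  finally show ?thesis using assms by (intro bexI[of _ "y [^] u \<otimes> x [^] v"]) (auto simp: int_pow_int)
qed

lemma coprime_roots_mult:
  assumes "x \<in> carrier G" "coprime m n"
    "\<exists>y\<in>carrier G. y [^] (m::nat) = x" "\<exists>y\<in>carrier G. y [^] (n::nat) = x"
  shows "\<exists>z\<in>carrier G. z [^] (m * n) = x"
proof -
  obtain y z where y: "y \<in> carrier G" "y [^] m = x" and z: "z \<in> carrier G" "z [^] n = x"
    using assms by blast
  obtain w where w: "w \<in> carrier G" "w [^] m = z"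
    using coprime_root[of z y n m] assms y z by (auto simp: coprime_commute)
  then have "w [^] (m * n) = x" using z by (simp add: nat_pow_pow[symmetric])
  then show ?thesis using w by blast
qed

lemma prod_prime_roots:
  assumes "x \<in> carrier G" "finite P" "\<And>p. p \<in> P \<Longrightarrow> Factorial_Ring.prime (p::nat)"
    "\<And>p. p \<in> P \<Longrightarrow> \<exists>y\<in>carrier G. y [^] (p ^ h p) = x"
  shows "\<exists>y\<in>carrier G. y [^] (\<Prod>p\<in>P. p ^ h p) = x"
  using assms(2-)
proof (induction P)
  case empty
  then show ?case using assms(1) by (auto intro!: bexI[of _ x])
next
  case (insert p P)
  have "coprime (p ^ h p) (\<Prod>p\<in>P. p ^ h p)"
    using insert by (intro prod_coprime_right) (metis coprime_power_left_iff coprime_power_right_iff insertCI primes_coprime)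
  then show ?case
    using coprime_roots_mult[of x "p ^ h p" "\<Prod>p\<in>P. p ^ h p"] insert assms(1) by simp
qed

lemma height_pow_coprime:
  assumes "x \<in> carrier G" "coprime k p"
  shows "height G p (x [^] (k::nat)) = height G p x"
proof (rule antisym)
  show "height G p (x [^] k) \<le> height G p x"
    using assms coprime_root[of x _ k "p ^ _"]
    by (intro height_le tf_group_axioms) auto
  show "height G p x \<le> height G p (x [^] k)"
  proof (intro height_le tf_group_axioms)
    fix n z assume "z \<in> carrier G" "z [^] (p ^ n) = x"
    then show "\<exists>w\<in>carrier G. w [^] (p ^ n) = x [^] k"
      by (intro bexI[of _ "z [^] k"]) (auto simp: nat_pow_pow mult.commute)
  qed (use assms in auto)
qed

text \<open>The \<open>p\<close>-part of \<open>k\<close> is cancelled because the group is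
  torsion-free, the rest by \<open>coprime_root\<close>. Passing from \<open>x [^] k\<close> back to
  \<open>x\<close> therefore costs a bounded amount of height, and infinite height survives.\<close>

lemma root_pow_prime:
  assumes x: "x \<in> carrier G" and p: "Factorial_Ring.prime (p::nat)" and k: "k > 0"
    and y: "y \<in> carrier G" "y [^] (p ^ (n + multiplicity p k)) = x [^] (k::nat)"
  shows "\<exists>z\<in>carrier G. z [^] (p ^ n) = x"
proof -
  let ?v = "multiplicity p k"
  obtain k' where k': "k = p ^ ?v * k'" "\<not> p dvd k'"
    using multiplicity_decompose'[of k p] k p by (metis not_prime_unit neq0_conv)
  have "(y [^] (p ^ n)) [^] int (p ^ ?v) = (x [^] k') [^] int (p ^ ?v)"
    unfolding int_pow_int using y x k'(1) by (metis nat_pow_pow power_add mult.commute)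
  then have "y [^] (p ^ n) = x [^] k'"
    by (rule int_pow_cancel[rotated 3]) (use x y p in \<open>auto simp: prime_gt_0_nat\<close>)
  moreover have "coprime k' (p ^ n)"
    using prime_imp_coprime[OF p k'(2)] by (simp add: coprime_commute)
  ultimately show ?thesis using coprime_root x y by blast
qed

lemma characteristic_in: "characteristic H x \<in> characteristics"
  by (simp add: characteristic_def characteristics_def)

text \<open>Only the finitely many prime divisors of \<open>k\<close> can see a difference, and by
  \<open>root_pow_prime\<close> they see it only between finite heights.\<close>

lemma characteristic_pow_equiv:
  assumes x: "x \<in> carrier G" and k: "k > 0"
  shows "(characteristic G (x [^] (k::nat)), characteristic G x) \<in> char_equiv"
proof -
  have "characteristic G (x [^] k) p = characteristic G x p" if "\<not> (p dvd k)" for p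
    using that height_pow_coprime[OF x, of k p] prime_imp_coprime[of p k]
    by (auto simp: characteristic_def coprime_commute)
  then have "{p. characteristic G (x [^] k) p \<noteq> characteristic G x p} \<subseteq> {p. p dvd k}" by blast
  then have 1: "finite {p. characteristic G (x [^] k) p \<noteq> characteristic G x p}"
    using k by (auto intro: finite_subset)
  have inf: "height G p (x [^] k) = \<infinity> \<longleftrightarrow> height G p x = \<infinity>" if p: "Factorial_Ring.prime p" for p
  proof
    assume "height G p (x [^] k) = \<infinity>"
    then show "height G p x = \<infinity>"
      using root_pow_prime[OF x p k] x by (auto simp: height_eq_infinity_iff)
  next
    assume "height G p x = \<infinity>"
    moreover have "height G p x \<le> height G p (x [^] k)"
    proof (intro height_le tf_group_axioms)
      fix n z assume "z \<in> carrier G" "z [^] (p ^ n) = x"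
      then show "\<exists>w\<in>carrier G. w [^] (p ^ n) = x [^] k"
        by (intro bexI[of _ "z [^] k"]) (auto simp: nat_pow_pow mult.commute)
    qed (use x in auto)
    ultimately show "height G p (x [^] k) = \<infinity>" by auto
  qed
  have "characteristic G (x [^] k) p \<noteq> \<infinity> \<and> characteristic G x p \<noteq> \<infinity>"
    if "characteristic G (x [^] k) p \<noteq> characteristic G x p" for p
    using that inf[of p] by (auto simp: characteristic_def simp del: not_infinity_eq split: if_splits)
  then show ?thesis
    using 1 characteristic_in[of G] unfolding char_equiv_def by (simp only: mem_Collect_eq case_prod_conv) simp
qed

lemma characteristic_inv: 
  assumes "x \<in> carrier G" shows "characteristic G (inv x) = characteristic G x"
proof -
  have "height G p (inv x) \<le> height G p x" if "x \<in> carrier G" for p x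
  proof (intro height_le tf_group_axioms)
    fix n z assume "z \<in> carrier G" "z [^] (p ^ n) = inv x"
    then show "\<exists>w\<in>carrier G. w [^] (p ^ n) = x"
      using that by (intro bexI[of _ "inv z"]) (auto simp: nat_pow_inv)
  qed (use that in auto)
  from this[of x] this[of "inv x"] assms show ?thesis
    by (auto simp: characteristic_def fun_eq_iff intro!: antisym)
qed

lemma characteristic_int_pow_equiv:
  assumes x: "x \<in> carrier G" and k: "k \<noteq> 0"
  shows "(characteristic G (x [^] (k::int)), characteristic G x) \<in> char_equiv"
proof (cases "k > 0")
  case True
  then show ?thesis
    using characteristic_pow_equiv[OF x, of "nat k"] int_pow_int[of G x "nat k"] by simp
next
  case False
  have "x [^] k = inv (x [^] (nat (-k)))"
    using int_pow_neg_int[OF x, of "nat (-k)"] False by simp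
  then show ?thesis
    using characteristic_pow_equiv[OF x, of "nat (-k)"] False k x by (simp add: characteristic_inv)
qed

end

section \<open>Groups of rank one and their types\<close>

text \<open>Where \<open>\<psi>\<close> differs from \<open>\<chi>\<close>, the upper bound
  \<open>\<chi>'\<close> differs from \<open>\<chi>\<close> as well, so both bounds are finite
  there.\<close>

lemma char_equiv_sandwich:
  assumes "(\<chi>, \<chi>') \<in> char_equiv" "\<psi> \<in> characteristics"
    and le: "\<And>p. \<chi> p \<le> \<psi> p" "\<And>p. \<psi> p \<le> \<chi>' p"
  shows "(\<chi>, \<psi>) \<in> char_equiv"
proof -
  have neq: "\<chi> p \<noteq> \<chi>' p" if "\<chi> p \<noteq> \<psi> p" for p
    using le[of p] that by auto
  have "finite {p. \<chi> p \<noteq> \<psi> p}"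
    by (rule finite_subset[of _ "{p. \<chi> p \<noteq> \<chi>' p}"]) (use neq assms(1) in \<open>auto simp: char_equiv_def\<close>)
  moreover have "\<chi> p \<noteq> \<infinity> \<and> \<psi> p \<noteq> \<infinity>" if "\<chi> p \<noteq> \<psi> p" for p
  proof -
    have "\<chi> p \<noteq> \<infinity>" "\<chi>' p \<noteq> \<infinity>"
      using neq[OF that] assms(1) by (auto simp: char_equiv_def)
    then show ?thesis using le[of p] by (metis enat_ord_simps(5))
  qed
  ultimately show ?thesis using assms by (auto simp: char_equiv_def)
qed

text \<open>This is the empty set if \<open>S\<close> contains a number that is not prime.\<close>

definition itype :: "nat set \<Rightarrow> group_type" where
  "itype S = char_equiv `` {\<lambda>p. if p \<in> S then \<infinity> else 0}"

text \<open>Equivalent characteristics differ only at finite values, so the set of infinite places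
  is an invariant of the type.\<close>

lemma mem_itype_infinity: 
  assumes "\<chi> \<in> itype S" shows "\<chi> p = \<infinity> \<longleftrightarrow> p \<in> S"
proof -
  have *: "(\<lambda>p. if p \<in> S then \<infinity> else 0, \<chi>) \<in> char_equiv" using assms by (simp add: itype_def)
  then have "(if p \<in> S then \<infinity> else 0) \<noteq> \<chi> p \<longrightarrow> (if p \<in> S then \<infinity> else 0) \<noteq> (\<infinity>::enat) \<and> \<chi> p \<noteq> \<infinity>"
    unfolding char_equiv_def by blast
  then show ?thesis by (metis enat_0_iff(1) i0_ne_infinity)
qed

lemma itype_self:
  assumes "\<And>p. p \<in> S \<Longrightarrow> Factorial_Ring.prime p"
  shows "(\<lambda>p. if p \<in> S then \<infinity> else 0) \<in> itype S"
  using assms by (auto simp: itype_def char_equiv_def characteristics_def)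

lemma type_le_itype_iff:
  assumes "\<And>p. p \<in> S \<Longrightarrow> Factorial_Ring.prime p" "\<And>p. p \<in> S' \<Longrightarrow> Factorial_Ring.prime p"
  shows "type_le (itype S) (itype S') \<longleftrightarrow> S \<subseteq> S'"
proof
  assume "type_le (itype S) (itype S')"
  then obtain \<chi> \<psi> where "\<chi> \<in> itype S" "\<psi> \<in> itype S'" "\<And>p. \<chi> p \<le> \<psi> p"
    by (auto simp: type_le_def)
  then show "S \<subseteq> S'"
    using mem_itype_infinity by (metis enat_ord_simps(5) subsetI)
next
  assume "S \<subseteq> S'"
  then show "type_le (itype S) (itype S')"
    unfolding type_le_def
    by (intro bexI[OF _ itype_self] bexI[OF _ itype_self]) (use assms in auto)
qed

lemma itype_inj:
  assumes "\<And>p. p \<in> S \<Longrightarrow> Factorial_Ring.prime p" "itype S = itype S'"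
  shows "S = S'"
  using mem_itype_infinity[of "\<lambda>p. if p \<in> S then \<infinity> else 0"] itype_self[of S] assms by blast

lemma idempotent_itype:
  assumes "\<And>p. p \<in> S \<Longrightarrow> Factorial_Ring.prime p"
  shows "idempotent_type (itype S)"
  unfolding idempotent_type_def by (rule bexI[OF _ itype_self]) (use assms in auto)

locale rank1_group = tf_group +
  assumes rank1: "group_rank G = 1"
begin

lemma nontrivial: "\<exists>x\<in>carrier G. x \<noteq> \<one>"
proof -
  have "\<exists>S. finite S \<and> independent_set G S \<and> card S > 0"
  proof (rule ccontr)
    assume "\<not> ?thesis"
    then have "group_rank G \<le> 0"
      unfolding group_rank_def by (intro SUP_least) (auto simp: zero_enat_def)
    then show False using rank1 by simp
  qed
  then obtain S x where S: "independent_set G S" "x \<in> S" by (auto simp: card_gt_0_iff)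
  have "x \<in> carrier G" using S by (auto simp: independent_set_def)
  moreover have "x \<noteq> \<one>"
  proof
    assume "x = \<one>"
    then have "(\<Otimes>y\<in>{x}. y [^] (1::int)) = \<one>" by simp
    moreover have "\<forall>F (c :: 'a \<Rightarrow> int). finite F \<and> F \<subseteq> S \<and> (\<Otimes>y\<in>F. y [^] c y) = \<one>
        \<longrightarrow> (\<forall>y\<in>F. c y = 0)"
      using S(1) unfolding independent_set_def by (elim conjE)
    ultimately show False using S(2) by (elim allE[of _ "{x}"] allE[of _ "\<lambda>_. 1"]) simp
  qed
  ultimately show ?thesis by blast
qed

lemma dependent:
  assumes "x \<in> carrier G" "y \<in> carrier G"
  shows "\<exists>(m::int) (n::int). (m \<noteq> 0 \<or> n \<noteq> 0) \<and> x [^] m = y [^] n"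
proof (cases "x = y")
  case True
  then show ?thesis by (intro exI[of _ 1]) auto
next
  case False
  have "\<not> independent_set G {x, y}"
  proof
    assume "independent_set G {x, y}"
    then have "enat (card {x, y}) \<le> group_rank G"
      unfolding group_rank_def by (intro SUP_upper) auto
    then show False using rank1 False by (simp add: one_enat_def)
  qed
  have "\<exists>F (c :: 'a \<Rightarrow> int). (F \<subseteq> {x, y} \<and> (\<Otimes>x\<in>F. x [^] c x) = \<one>) \<and> \<not> (\<forall>z\<in>F. c z = 0)"
  proof (rule ccontr)
    assume neg: "\<not> ?thesis"
    have "independent_set G {x, y}"
      unfolding independent_set_def
    proof (intro conjI allI impI)
      fix F and c :: "'a \<Rightarrow> int"
      assume F: "finite F \<and> F \<subseteq> {x, y} \<and> (\<Otimes>x\<in>F. x [^] c x) = \<one>"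
      show "\<forall>z\<in>F. c z = 0"
      proof (rule ccontr)
        assume "\<not> (\<forall>z\<in>F. c z = 0)"
        with F show False
          by - (rule notE[OF neg], rule exI[of _ F], rule exI[of _ c], simp)
      qed
    qed (use assms in simp)
    with \<open>\<not> independent_set G {x, y}\<close> show False by contradiction
  qed
  then obtain F and c :: "'a \<Rightarrow> int" where F: "F \<subseteq> {x, y}" "(\<Otimes>x\<in>F. x [^] c x) = \<one>"
    and nz: "\<not> (\<forall>z\<in>F. c z = 0)"
    by blast
  \<comment> \<open>The relation found may involve only one of the two elements; the missing
    coefficient becomes 0.\<close>
  define c' where "c' = (\<lambda>x. if x \<in> F then c x else 0)"
  have "(\<Otimes>u\<in>{x, y}. u [^] c' u) = (\<Otimes>u\<in>F. u [^] c u)"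
    by (rule finprod_mono_neutral_cong_right) (use F assms in \<open>auto simp: c'_def\<close>)
  then have "x [^] c' x \<otimes> y [^] c' y = \<one>" using F False assms by simp
  then have "x [^] c' x = y [^] (- c' y)"
    using assms inv_equality[of "x [^] c' x" "y [^] c' y"] by (simp add: int_pow_neg)
  moreover have "c' x \<noteq> 0 \<or> - c' y \<noteq> 0" using F nz by (auto simp: c'_def split: if_splits)
  ultimately show ?thesis by blast
qed

lemma dependent_nz:
  assumes "x \<in> carrier G" "y \<in> carrier G" "x \<noteq> \<one>"
  shows "\<exists>(m::int) (n::int). n \<noteq> 0 \<and> x [^] m = y [^] n"
proof -
  obtain m n :: int where mn: "m \<noteq> 0 \<or> n \<noteq> 0" "x [^] m = y [^] n"
    using dependent[OF assms(1,2)] by blast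
  have "n \<noteq> 0" using mn int_pow_eq_one[of x m] assms by auto
  then show ?thesis using mn(2) by (intro exI[of _ m] exI[of _ n] conjI)
qed

lemma characteristic_equiv:
  assumes "x \<in> carrier G" "y \<in> carrier G" "x \<noteq> \<one>" "y \<noteq> \<one>"
  shows "(characteristic G x, characteristic G y) \<in> char_equiv"
proof -
  obtain m n :: int where mn: "n \<noteq> 0" "x [^] m = y [^] n" using dependent_nz[of x y] assms by auto
  have "m \<noteq> 0" using mn int_pow_eq_one[of y n] assms by auto
  have sym: "sym char_equiv" and trans: "trans char_equiv"
    using equiv_char_equiv by (auto simp: equiv_def)
  have "(characteristic G (x [^] m), characteristic G x) \<in> char_equiv"
    using characteristic_int_pow_equiv assms \<open>m \<noteq> 0\<close> by simp
  moreover have "(characteristic G (y [^] n), characteristic G y) \<in> char_equiv"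
    using characteristic_int_pow_equiv assms mn by simp
  ultimately show ?thesis
    using symD[OF sym] transD[OF trans] mn(2) by metis
qed

lemma rank1_type_eq:
  assumes "x \<in> carrier G" "x \<noteq> \<one>"
  shows "rank1_type G = char_equiv `` {characteristic G x}"
  unfolding rank1_type_def
proof (rule the_equality)
  show "\<exists>y\<in>carrier G. y \<noteq> \<one> \<and> char_equiv `` {characteristic G x} = char_equiv `` {characteristic G y}"
    using assms by blast
  fix \<tau> assume "\<exists>y\<in>carrier G. y \<noteq> \<one> \<and> \<tau> = char_equiv `` {characteristic G y}"
  then show "\<tau> = char_equiv `` {characteristic G x}"
    using characteristic_equiv assms equiv_class_eq[OF equiv_char_equiv] by metis
qed

lemma characteristic_in_rank1_type:
  assumes "x \<in> carrier G" "x \<noteq> \<one>"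
  shows "characteristic G x \<in> rank1_type G"
  using characteristic_equiv rank1_type_eq assms by auto

text \<open>All members of a type are infinite at the same places, so this holds for every element
  and not only for a well chosen generator.\<close>

lemma itype_divisible:
  assumes "rank1_type G = itype S" "x \<in> carrier G" "p \<in> S" 
  shows "\<exists>y\<in>carrier G. y [^] (p ^ n) = x"
proof (cases "x = \<one>")
  case True
  then show ?thesis by (intro bexI[of _ \<one>]) auto
next
  case False
  then have "characteristic G x p = \<infinity>"
    using characteristic_in_rank1_type mem_itype_infinity assms by metis
  then have "height G p x = \<infinity>" by (auto simp: characteristic_def zero_enat_def split: if_splits)
  then show ?thesis using height_eq_infinity_iff assms by blast
qed

text \<open>Any nontrivial \<open>b\<close> has the right characteristic up to finitely many primes,
  at which its height is finite and should be 0. Dividing \<open>b\<close> by \<open>p ^ h p\<close>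
  at these primes corrects all of them at once.\<close>

lemma idempotent_generator:
  assumes "idempotent_type (rank1_type G)"
  obtains a S where "a \<in> carrier G" "a \<noteq> \<one>" "\<And>p. p \<in> S \<Longrightarrow> Factorial_Ring.prime p"
    "rank1_type G = itype S" "characteristic G a = (\<lambda>p. if p \<in> S then \<infinity> else 0)"
proof -
  obtain b where b: "b \<in> carrier G" "b \<noteq> \<one>" using nontrivial by blast
  obtain \<chi> where \<chi>: "\<chi> \<in> rank1_type G" "\<And>p. \<chi> p = 0 \<or> \<chi> p = \<infinity>"
    using assms by (auto simp: idempotent_type_def)
  define S where "S = {p. \<chi> p = \<infinity>}"
  have \<chi>S: "\<chi> = (\<lambda>p. if p \<in> S then \<infinity> else 0)" using \<chi>(2) by (fastforce simp: S_def fun_eq_iff simp del: not_infinity_eq)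
  have eq: "(characteristic G b, \<chi>) \<in> char_equiv" using \<chi> rank1_type_eq[OF b] by simp
  have primes: "Factorial_Ring.prime p" if "p \<in> S" for p
    using eq that by (force simp: char_equiv_def characteristics_def S_def)
  define P where "P = {p. characteristic G b p \<noteq> \<chi> p}"
  define h where "h p = the_enat (height G p b)" for p
  have fin: "finite P" using eq by (simp add: P_def char_equiv_def)
  have P: "Factorial_Ring.prime p \<and> \<chi> p = 0 \<and> height G p b = enat (h p) \<and> p \<notin> S" if "p \<in> P" for p
  proof -
    have ne: "characteristic G b p \<noteq> \<infinity>" "\<chi> p \<noteq> \<infinity>" using that eq by (auto simp: char_equiv_def P_def)
    then have c0: "\<chi> p = 0" using \<chi>(2) by metis
    have p: "Factorial_Ring.prime p" using that c0 by (auto simp: P_def characteristic_def split: if_splits)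
    show ?thesis using p c0 ne by (auto simp: characteristic_def h_def S_def zero_enat_def)
  qed
  have "\<exists>y\<in>carrier G. y [^] (\<Prod>p\<in>P. p ^ h p) = b"
    using prod_prime_roots[OF b(1) fin, of h] P height_ge_iff[OF b(1)] by (metis order_refl)
  then obtain a where a: "a \<in> carrier G" "a [^] (\<Prod>p\<in>P. p ^ h p) = b" by blast
  have "a \<noteq> \<one>" using a b by auto
  have ch: "characteristic G a p = \<chi> p" for p
  proof (cases "p \<in> P")
    case True
    \<comment> \<open>A \<open>p\<close>-th root of \<open>a\<close> would give a root of
      \<open>b\<close> beyond the height \<open>h p\<close>.\<close>
    have "height G p a \<le> 0"
    proof (rule ccontr)
      assume "\<not> height G p a \<le> 0"
      then have "enat 1 \<le> height G p a" by (metis ileI1 linorder_not_le one_eSuc one_enat_def)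
      then obtain y where y: "y \<in> carrier G" "y [^] p = a" using height_ge_iff[OF a(1), of 1 p] by auto
      have "(\<Prod>p\<in>P. p ^ h p) = p ^ h p * (\<Prod>p\<in>P - {p}. p ^ h p)" using fin True by (rule prod.remove)
      then have "(y [^] (\<Prod>p\<in>P - {p}. p ^ h p)) [^] (p ^ Suc (h p)) = b"
        using y a(2) by (auto simp: nat_pow_pow mult_ac)
      then have "enat (Suc (h p)) \<le> height G p b" using height_ge_iff[OF b(1)] y by blast
      then show False using P[OF True] by simp
    qed
    then show ?thesis using P[OF True] by (simp add: characteristic_def)
  next
    case False
    show ?thesis
    proof (cases "Factorial_Ring.prime p")
      case True
      have "coprime (\<Prod>p\<in>P. p ^ h p) p"
        using P False True by (intro prod_coprime_left) (metis coprime_power_left_iff primes_coprime)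
      then have "height G p b = height G p a" using height_pow_coprime a by blast
      then show ?thesis using False True by (auto simp: P_def characteristic_def)
    qed (use eq in \<open>auto simp: char_equiv_def characteristics_def characteristic_def\<close>)
  qed
  have "rank1_type G = itype S"
    unfolding rank1_type_eq[OF a(1) \<open>a \<noteq> \<one>\<close>] itype_def using ch \<chi>S by presburger
  moreover have "characteristic G a = (\<lambda>p. if p \<in> S then \<infinity> else 0)" using ch \<chi>S by auto
  ultimately show ?thesis using that a \<open>a \<noteq> \<one>\<close> primes by blast
qed

end

section \<open>Localizations of the integers and lattices\<close>

definition Zs :: "nat set \<Rightarrow> rat set" where
  "Zs S = {of_int m / of_nat n | m n. n > 0 \<and> (\<forall>p. Factorial_Ring.prime p \<longrightarrow> p dvd n \<longrightarrow> p \<in> S)}"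

lemma ZsI:
  assumes "n > 0" "\<And>p. Factorial_Ring.prime p \<Longrightarrow> p dvd n \<Longrightarrow> p \<in> S" "x = of_int m / of_nat n"
  shows "x \<in> Zs S"
  using assms unfolding Zs_def by blast

lemma ZsE:
  assumes "x \<in> Zs S"
  obtains m n where "n > 0" "\<And>p. Factorial_Ring.prime p \<Longrightarrow> p dvd n \<Longrightarrow> p \<in> S" "x = of_int m / of_nat n"
  using assms unfolding Zs_def by blast

lemma Zs_of_int [simp]: "of_int m \<in> Zs S"
  by (rule ZsI[of 1 _ _ m]) auto

lemma Zs_0 [simp]: "0 \<in> Zs S" and Zs_1 [simp]: "1 \<in> Zs S" and Zs_of_nat [simp]: "of_nat k \<in> Zs S"
  using Zs_of_int[of 0 S] Zs_of_int[of 1 S] Zs_of_int[of "int k" S] by simp_all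

lemma Zs_add [intro]:
  assumes "x \<in> Zs S" "y \<in> Zs S" shows "x + y \<in> Zs S"
proof -
  from assms(1) obtain m n where 1: "n > 0" "\<And>p. Factorial_Ring.prime p \<Longrightarrow> p dvd n \<Longrightarrow> p \<in> S"
    "x = of_int m / of_nat n" by (rule ZsE) blast
  from assms(2) obtain m' n' where 2: "n' > 0" "\<And>p. Factorial_Ring.prime p \<Longrightarrow> p dvd n' \<Longrightarrow> p \<in> S"
    "y = of_int m' / of_nat n'" by (rule ZsE) blast
  show ?thesis
    by (rule ZsI[of "n * n'" _ _ "m * int n' + m' * int n"])
      (use 1 2 in \<open>auto simp: prime_dvd_mult_iff field_simps\<close>)
qed

lemma Zs_mult [intro]:
  assumes "x \<in> Zs S" "y \<in> Zs S" shows "x * y \<in> Zs S"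
proof -
  from assms(1) obtain m n where 1: "n > 0" "\<And>p. Factorial_Ring.prime p \<Longrightarrow> p dvd n \<Longrightarrow> p \<in> S"
    "x = of_int m / of_nat n" by (rule ZsE) blast
  from assms(2) obtain m' n' where 2: "n' > 0" "\<And>p. Factorial_Ring.prime p \<Longrightarrow> p dvd n' \<Longrightarrow> p \<in> S"
    "y = of_int m' / of_nat n'" by (rule ZsE) blast
  show ?thesis
    by (rule ZsI[of "n * n'" _ _ "m * m'"])
      (use 1 2 in \<open>auto simp: prime_dvd_mult_iff\<close>)
qed

lemma Zs_uminus [intro]: "x \<in> Zs S \<Longrightarrow> - x \<in> Zs S"
  using Zs_mult[of "of_int (-1)" S x] Zs_of_int[of "-1" S] by simp

lemma Zs_diff [intro]: "x \<in> Zs S \<Longrightarrow> y \<in> Zs S \<Longrightarrow> x - y \<in> Zs S"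
  using Zs_add[of x S "- y"] Zs_uminus[of y S] by simp

lemma Zs_sum [intro]: "(\<And>i. i \<in> A \<Longrightarrow> f i \<in> Zs S) \<Longrightarrow> (\<Sum>i\<in>A. f i) \<in> Zs S"
  by (induction A rule: infinite_finite_induct) auto

lemma Zs_divide_prime_power:
  assumes "x \<in> Zs S" "p \<in> S" "Factorial_Ring.prime p" shows "x / of_nat (p ^ n) \<in> Zs S"
proof -
  have "1 / of_nat (p ^ n) \<in> Zs S"
    by (rule ZsI[of "p ^ n" _ _ 1])
      (use assms in \<open>auto simp: prime_gt_0_nat dest: prime_dvd_power primes_dvd_imp_eq\<close>)
  from Zs_mult[OF assms(1) this] show ?thesis by simp
qed

text \<open>The denominators are prime to \<open>p\<close>, so every power of \<open>p\<close>
  divides the numerator, which is impossible for a nonzero integer.\<close>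

lemma Zs_divisible_imp_0:
  assumes p: "Factorial_Ring.prime p" "p \<notin> S" and x: "\<And>n. x / of_nat (p ^ n) \<in> Zs S"
  shows "x = 0"
proof -
  from x[of 0] have "x \<in> Zs S" by simp
  then obtain m k where 1: "k > 0" "\<And>q. Factorial_Ring.prime q \<Longrightarrow> q dvd k \<Longrightarrow> q \<in> S"
    "x = of_int m / of_nat k" by (rule ZsE) blast
  have "int p ^ n dvd m" for n
  proof -
    from x[of n] obtain a b where 2: "b > 0" "\<And>q. Factorial_Ring.prime q \<Longrightarrow> q dvd b \<Longrightarrow> q \<in> S"
      "x / of_nat (p ^ n) = of_int a / of_nat b" by (rule ZsE) blast
    have "coprime (p ^ n) b" using prime_imp_coprime[OF p(1), of b] 2 p by auto
    have "of_int (m * int b) = (of_int (int p ^ n * (a * int k)) :: rat)"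
      using 1(1) 2(1,3) p(1) unfolding 1(3) by (auto simp: field_simps prime_gt_0_nat)
    then have "m * int b = int p ^ n * (a * int k)" by linarith
    then have "int p ^ n dvd m * int b" by simp
    moreover have "coprime (int p ^ n) (int b)"
      using \<open>coprime (p ^ n) b\<close> by (metis coprime_int_iff of_nat_power)
    ultimately show ?thesis by (simp add: coprime_dvd_mult_left_iff)
  qed
  then have dvd: "int p ^ n dvd m" for n by blast
  have "m = 0"
  proof (rule ccontr)
    assume "m \<noteq> 0"
    have "int p ^ nat \<bar>m\<bar> \<le> \<bar>m\<bar>" using dvd_imp_le_int[OF \<open>m \<noteq> 0\<close> dvd[of "nat \<bar>m\<bar>"]] by simp
    moreover have "nat \<bar>m\<bar> < p ^ nat \<bar>m\<bar>" using p by (intro power_gt_expt) (simp add: prime_gt_Suc_0_nat)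
    then have "\<bar>m\<bar> < int p ^ nat \<bar>m\<bar>" by (metis nat_less_iff abs_ge_zero of_nat_power)
    ultimately show False by simp
  qed
  then show ?thesis using 1 by simp
qed

text \<open>One prime factor of \<open>n\<close> at a time: a prime in \<open>S\<close> divides
  every element, and for any other prime Bezout against the denominator supplies the integer. When a
  coordinate is rescaled by \<open>v\<close>, this reduces all new elements to multiples of one of
  them.\<close>

lemma Zs_approx:
  assumes "x \<in> Zs S" "n > (0::nat)"
  shows "\<exists>(j::int). \<exists>y\<in>Zs S. x = of_int j + of_nat n * y"
  using assms(2,1)
proof (induction n arbitrary: x rule: prime_divisors_induct)
  case (unit n)
  then show ?case by (intro exI[of _ 0] bexI[of _ x]) auto
next
  case zero
  then show ?case by simp
next
  case (factor p n)
  have "n > 0" using factor by simp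
  then obtain j y where 1: "y \<in> Zs S" "x = of_int j + of_nat n * y"
    using factor.IH factor.prems by blast
  have "\<exists>(i::int). \<exists>z\<in>Zs S. y = of_int i + of_nat p * z"
  proof (cases "p \<in> S")
    case True
    then show ?thesis
      using Zs_divide_prime_power[OF 1(1) True factor.hyps, of 1] factor.hyps
      by (intro exI[of _ 0] bexI[of _ "y / of_nat p"]) (auto simp: prime_gt_0_nat)
  next
    case False
    from 1(1) obtain m k where 2: "k > 0" "\<And>q. Factorial_Ring.prime q \<Longrightarrow> q dvd k \<Longrightarrow> q \<in> S"
      "y = of_int m / of_nat k" by (rule ZsE) blast
    have "coprime p k" using prime_imp_coprime[OF factor.hyps, of k] 2 False factor.hyps by auto
    then obtain u v where uv: "u * int p + v * int k = 1"
      using bezout_int[of "int p" "int k"] by (auto simp: coprime_iff_gcd_eq_1)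
    have "of_int u * of_nat p + of_int v * of_nat k = (1::rat)"
      using arg_cong[OF uv, of "of_int :: int \<Rightarrow> rat"] by simp
    then have "y = y * (of_int u * of_nat p + of_int v * of_nat k)" by simp
    also have "\<dots> = of_int (v * m) + of_nat p * (of_int u * y)"
      using 2 by (simp add: field_simps)
    finally show ?thesis
      using 1(1) by (intro exI[of _ "v * m"] bexI[of _ "of_int u * y"]) auto
  qed
  then obtain i z where 3: "z \<in> Zs S" "y = of_int i + of_nat p * z" by blast
  have "x = of_int (j + int n * i) + of_nat (p * n) * z" using 1 3 by (simp add: algebra_simps)
  then show ?case using 3 by blast
qed

text \<open>Bezout writes \<open>x / w\<close> as an integral combination of
  \<open>s * x / w\<close> and \<open>x\<close>.\<close>

lemma Zs_coprime_cancel: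
  assumes "coprime (s::int) w" "x \<in> Zs S" "of_int s * x / of_int w \<in> Zs S" "w \<noteq> 0"
  shows "x / of_int w \<in> Zs S"
proof -
  obtain u v where uv: "u * s + v * w = 1"
    using bezout_int[of s w] assms by (auto simp: coprime_iff_gcd_eq_1)
  have uv': "of_int u * of_int s + of_int v * of_int w = (1::rat)"
    using arg_cong[OF uv, of "of_int :: int \<Rightarrow> rat"] by simp
  have "x / of_int w = x * (of_int u * of_int s + of_int v * of_int w) / of_int w"
    unfolding uv' by simp
  also have "\<dots> = of_int u * (of_int s * x / of_int w) + of_int v * x"
    using assms(4) by (simp add: field_simps)
  also have "\<dots> \<in> Zs S" using assms by (intro Zs_add Zs_mult) auto
  finally show ?thesis .
qed

lemma common_denominator:
  fixes u :: "'v \<Rightarrow> rat"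
  assumes "finite A"
  shows "\<exists>N>0::nat. \<forall>v\<in>A. \<exists>k::int. of_nat N * u v = of_int k"
  using assms
proof (induction A)
  case empty
  then show ?case by auto
next
  case (insert a A)
  then obtain N where N: "N > 0" "\<And>v. v \<in> A \<Longrightarrow> \<exists>k::int. of_nat N * u v = of_int k" by blast
  obtain r t where q: "u a = of_int r / of_int t" "t > 0"
    using quotient_of_div[of "u a"] quotient_of_denom_pos[of "u a"] by (metis prod.exhaust_sel)
  have "\<exists>k::int. of_nat (nat t * N) * u v = of_int k" if v: "v \<in> insert a A" for v
  proof (cases "v = a")
    case True
    have "of_nat (nat t * N) * u v = of_int (int N * r)" using q True by simp
    then show ?thesis by blast
  next
    case False
    then obtain k :: int where "of_nat N * u v = of_int k" using N v by blast
    then have "of_nat (nat t * N) * u v = of_int (t * k)" using q by (simp add: mult.assoc)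
    then show ?thesis by blast
  qed
  then show ?case using N q by (intro exI[of _ "nat t * N"]) auto
qed

section \<open>Lattices and their extension by one vector\<close>

definition lat :: "'i set \<Rightarrow> ('i \<Rightarrow> nat set) \<Rightarrow> ('i \<Rightarrow> rat) set" where
  "lat I \<sigma> = {f. \<forall>i. f i \<in> (if i \<in> I then Zs (\<sigma> i) else {0})}"

lemma latD: "f \<in> lat I \<sigma> \<Longrightarrow> i \<in> I \<Longrightarrow> f i \<in> Zs (\<sigma> i)" "f \<in> lat I \<sigma> \<Longrightarrow> i \<notin> I \<Longrightarrow> f i = 0"
  unfolding lat_def by (auto split: if_splits)

lemma latI: "(\<And>i. i \<in> I \<Longrightarrow> f i \<in> Zs (\<sigma> i)) \<Longrightarrow> (\<And>i. i \<notin> I \<Longrightarrow> f i = 0) \<Longrightarrow> f \<in> lat I \<sigma>"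
  by (auto simp: lat_def)

lemma lat_add: "f \<in> lat I \<sigma> \<Longrightarrow> g \<in> lat I \<sigma> \<Longrightarrow> f + g \<in> lat I \<sigma>"
  by (intro latI) (auto dest: latD simp: latD(2))

lemma lat_0: "0 \<in> lat I \<sigma>"
  by (intro latI) auto

lemma lat_int_mult: "f \<in> lat I \<sigma> \<Longrightarrow> (\<lambda>i. of_int n * f i) \<in> lat I \<sigma>"
  by (intro latI) (auto dest: latD)

text \<open>A codomain in which coordinate maps are group homomorphisms, so that laws about powers
  carry over to coordinates.\<close>

definition fun_group :: "('i \<Rightarrow> rat) monoid" where
  "fun_group = \<lparr>carrier = UNIV, monoid.mult = (+), one = 0\<rparr>"

lemma comm_group_fun_group: "comm_group (fun_group :: ('i \<Rightarrow> rat) monoid)"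
proof (rule comm_groupI)
  fix f :: "'i \<Rightarrow> rat" assume "f \<in> carrier fun_group"
  show "\<exists>g\<in>carrier fun_group. g \<otimes>\<^bsub>fun_group\<^esub> f = \<one>\<^bsub>fun_group\<^esub>"
    by (intro bexI[of _ "- f"]) (auto simp: fun_group_def)
qed (auto simp: fun_group_def add_ac)

lemma fun_group_int_pow: "f [^]\<^bsub>fun_group\<^esub> (n::int) = (\<lambda>i. of_int n * f i)"
proof -
  interpret comm_group "fun_group :: ('b \<Rightarrow> rat) monoid" by (rule comm_group_fun_group)
  have nat: "f [^]\<^bsub>fun_group\<^esub> (k::nat) = (\<lambda>i. of_nat k * f i)" for k
    by (induction k) (auto simp: fun_group_def fun_eq_iff algebra_simps)
  show ?thesis
  proof (cases "n \<ge> 0")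
    case True
    then show ?thesis using nat[of "nat n"] int_pow_int[of fun_group f "nat n"] by simp
  next
    case False
    have "f [^]\<^bsub>fun_group\<^esub> n = inv\<^bsub>fun_group\<^esub> (f [^]\<^bsub>fun_group\<^esub> (nat (-n)))"
      using int_pow_neg_int[of f "nat (-n)"] False by (simp add: fun_group_def)
    also have "\<dots> = (\<lambda>i. of_int n * f i)"
      unfolding nat by (rule inv_equality) (use False in \<open>auto simp: fun_group_def fun_eq_iff algebra_simps\<close>)
    finally show ?thesis .
  qed
qed

definition lattice_group :: "'i set \<Rightarrow> ('i \<Rightarrow> nat set) \<Rightarrow> ('i \<Rightarrow> rat) \<Rightarrow> ('i \<Rightarrow> rat) monoid" where
  "lattice_group I \<sigma> d = \<lparr>carrier = {f + (\<lambda>i. of_int t * d i) | f t. f \<in> lat I \<sigma>}, monoid.mult = (+), one = 0\<rparr>"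

lemma lattice_group_simps [simp]:
  "f \<otimes>\<^bsub>lattice_group I \<sigma> d\<^esub> g = f + g" "\<one>\<^bsub>lattice_group I \<sigma> d\<^esub> = 0"
  by (simp_all add: lattice_group_def)

lemma carrier_lattice_group: "carrier (lattice_group I \<sigma> d) = {f + (\<lambda>i. of_int t * d i) | f t. f \<in> lat I \<sigma>}"
  by (simp add: lattice_group_def)

lemma carrier_lattice_group_iff: "f \<in> carrier (lattice_group I \<sigma> d) \<longleftrightarrow> (\<exists>t::int. (\<lambda>i. f i - of_int t * d i) \<in> lat I \<sigma>)"
proof
  assume "f \<in> carrier (lattice_group I \<sigma> d)"
  then obtain g t where "g \<in> lat I \<sigma>" "f = g + (\<lambda>i. of_int t * d i)" by (auto simp: carrier_lattice_group)
  then show "\<exists>t. (\<lambda>i. f i - of_int t * d i) \<in> lat I \<sigma>" by (intro exI[of _ t]) simp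
next
  assume "\<exists>t. (\<lambda>i. f i - of_int t * d i) \<in> lat I \<sigma>"
  then obtain t where t: "(\<lambda>i. f i - of_int t * d i) \<in> lat I \<sigma>" by blast
  have "f = (\<lambda>i. f i - of_int t * d i) + (\<lambda>i. of_int t * d i)" by (simp add: fun_eq_iff)
  then show "f \<in> carrier (lattice_group I \<sigma> d)" using t unfolding carrier_lattice_group by blast
qed

lemma lat_subset_lattice_group: "lat I \<sigma> \<subseteq> carrier (lattice_group I \<sigma> d)"
  unfolding carrier_lattice_group_iff subset_iff by (auto intro!: exI[of _ 0])

lemma lattice_group_int_mult: "f \<in> carrier (lattice_group I \<sigma> d) \<Longrightarrow> (\<lambda>i. of_int n * f i) \<in> carrier (lattice_group I \<sigma> d)"
  unfolding carrier_lattice_group_iff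
proof (elim exE)
  fix t assume "(\<lambda>i. f i - of_int t * d i) \<in> lat I \<sigma>"
  from lat_int_mult[OF this, of n] show "\<exists>t. (\<lambda>i. of_int n * f i - of_int t * d i) \<in> lat I \<sigma>"
    by (intro exI[of _ "n * t"]) (simp add: algebra_simps)
qed

lemma d_in_lattice_group: "d \<in> carrier (lattice_group I \<sigma> d)"
  unfolding carrier_lattice_group_iff using lat_0[of I \<sigma>] by (intro exI[of _ 1]) (simp add: zero_fun_def)

lemma lattice_group_add: "f \<in> carrier (lattice_group I \<sigma> d) \<Longrightarrow> g \<in> carrier (lattice_group I \<sigma> d) \<Longrightarrow> f + g \<in> carrier (lattice_group I \<sigma> d)"
  unfolding carrier_lattice_group_iff
proof (elim exE)
  fix t u assume "(\<lambda>i. f i - of_int t * d i) \<in> lat I \<sigma>" "(\<lambda>i. g i - of_int u * d i) \<in> lat I \<sigma>"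
  from lat_add[OF this] show "\<exists>t. (\<lambda>i. (f + g) i - of_int t * d i) \<in> lat I \<sigma>"
    by (intro exI[of _ "t + u"]) (simp add: algebra_simps plus_fun_def)
qed

lemma comm_group_lattice_group: "comm_group (lattice_group I \<sigma> d)"
proof (rule comm_groupI)
  show "\<one>\<^bsub>lattice_group I \<sigma> d\<^esub> \<in> carrier (lattice_group I \<sigma> d)" using lat_0 lat_subset_lattice_group by fastforce
  fix f assume f: "f \<in> carrier (lattice_group I \<sigma> d)"
  show "\<exists>g\<in>carrier (lattice_group I \<sigma> d). g \<otimes>\<^bsub>lattice_group I \<sigma> d\<^esub> f = \<one>\<^bsub>lattice_group I \<sigma> d\<^esub>"
    using lattice_group_int_mult[OF f, of "-1"] by (intro bexI[of _ "\<lambda>i. of_int (-1) * f i"]) (auto simp: fun_eq_iff)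
qed (auto simp: add_ac lattice_group_add)

section \<open>The rank of a lattice\<close>

lemma embed_int_pow:
  fixes G (structure)
  assumes "group G" "\<And>x y. x \<in> carrier G \<Longrightarrow> y \<in> carrier G \<Longrightarrow> \<phi> (x \<otimes> y) = \<phi> x + (\<phi> y :: 'i \<Rightarrow> rat)"
    "x \<in> carrier G"
  shows "\<phi> (x [^] (n::int)) = (\<lambda>i. of_int n * \<phi> x i)"
proof -
  interpret F: comm_group "fun_group :: ('i \<Rightarrow> rat) monoid" by (rule comm_group_fun_group)
  interpret group_hom G fun_group \<phi>
    using assms by (intro group_hom.intro group_hom_axioms.intro F.is_group) (auto simp: hom_def fun_group_def)
  show ?thesis using hom_int_pow[OF assms(3), of n] by (simp add: fun_group_int_pow)
qed

lemma embed_one: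
  fixes G (structure)
  assumes "group G" "\<And>x y. x \<in> carrier G \<Longrightarrow> y \<in> carrier G \<Longrightarrow> \<phi> (x \<otimes> y) = \<phi> x + (\<phi> y :: 'i \<Rightarrow> rat)"
  shows "\<phi> \<one> = 0"
proof -
  interpret group G by fact
  show ?thesis using assms(2)[of "\<one>" "\<one>"] by simp
qed

lemma embed_finprod:
  fixes G (structure)
  assumes "comm_group G" "\<And>x y. x \<in> carrier G \<Longrightarrow> y \<in> carrier G \<Longrightarrow> \<phi> (x \<otimes> y) = \<phi> x + (\<phi> y :: 'i \<Rightarrow> rat)"
    "finite A" "\<And>a. a \<in> A \<Longrightarrow> f a \<in> carrier G"
  shows "\<phi> (finprod G f A) = (\<Sum>a\<in>A. \<phi> (f a))"
proof -
  interpret comm_group G by fact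
  show ?thesis using assms(3,4)
  proof (induction A)
    case empty
    then show ?case using embed_one[OF is_group assms(2)] by simp
  next
    case (insert a A)
    then have "f \<in> A \<rightarrow> carrier G" "f a \<in> carrier G" by auto
    then show ?case using insert by (simp add: assms(2))
  qed
qed

lemma sum_fun_apply: "(\<Sum>a\<in>A. f a) i = (\<Sum>a\<in>A. f a (i::'i) :: rat)"
  by (induction A rule: infinite_finite_induct) auto

text \<open>Independence over the integers becomes linear independence over the rationals, which
  bounds independent sets by the dimension \<open>card I\<close>. The preimages of multiples of the
  unit vectors form an independent set of that size.\<close>

lemma group_rank_embed:
  fixes G (structure) and \<phi> :: "'a \<Rightarrow> 'i \<Rightarrow> rat"
  assumes G: "comm_group G"
    and add: "\<And>x y. x \<in> carrier G \<Longrightarrow> y \<in> carrier G \<Longrightarrow> \<phi> (x \<otimes> y) = \<phi> x + \<phi> y"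
    and inj: "inj_on \<phi> (carrier G)" and I: "finite I"
    and supp: "\<And>x i. x \<in> carrier G \<Longrightarrow> i \<notin> I \<Longrightarrow> \<phi> x i = 0"
    and unit: "\<And>i. i \<in> I \<Longrightarrow> \<exists>x\<in>carrier G. \<exists>c. c \<noteq> 0 \<and> \<phi> x = (\<lambda>j. if j = i then c else 0)"
  shows "group_rank G = enat (card I)"
proof (rule antisym)
  interpret comm_group G by fact
  have comb: "\<phi> (\<Otimes>x\<in>F. x [^] c x) = (\<Sum>x\<in>F. (\<lambda>i. of_int (c x) * \<phi> x i))"
    if "finite F" "F \<subseteq> carrier G" for F and c :: "'a \<Rightarrow> int"
  proof -
    have "\<phi> (\<Otimes>x\<in>F. x [^] c x) = (\<Sum>x\<in>F. \<phi> (x [^] c x))"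
      using that by (intro embed_finprod[OF G add]) auto
    also have "\<dots> = (\<Sum>x\<in>F. (\<lambda>i. of_int (c x) * \<phi> x i))"
      using that by (intro sum.cong refl embed_int_pow[OF is_group add]) auto
    finally show ?thesis .
  qed
  have one: "\<phi> \<one> = 0" by (rule embed_one[OF is_group add])
  interpret V: vector_space "\<lambda>(q::rat) (f::'i \<Rightarrow> rat) i. q * f i"
    by unfold_locales (auto simp: fun_eq_iff algebra_simps)
  let ?e = "\<lambda>i j. if j = i then 1 else (0::rat)"
  show "group_rank G \<le> enat (card I)"
    unfolding group_rank_def
  proof (rule SUP_least)
    fix S assume "S \<in> {S. finite S \<and> independent_set G S}"
    then have S: "finite S" "independent_set G S" by auto
    then have SG: "S \<subseteq> carrier G" by (simp add: independent_set_def)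
    have inj': "inj_on \<phi> S" using inj SG by (rule inj_on_subset)
    have "\<not> V.dependent (\<phi> ` S)"
    proof
      assume "V.dependent (\<phi> ` S)"
      then obtain u x where u: "(\<Sum>v\<in>\<phi> ` S. (\<lambda>i. u v * v i)) = 0" "x \<in> S" "u (\<phi> x) \<noteq> 0"
        using V.dependent_finite[of "\<phi> ` S"] S by auto
      obtain N where N: "N > 0" "\<And>v. v \<in> \<phi> ` S \<Longrightarrow> \<exists>k::int. of_nat N * u v = of_int k"
        using common_denominator[of "\<phi> ` S" u] S by blast
      \<comment> \<open>A linear relation has rational coefficients \<open>u\<close>; the common
        denominator \<open>N\<close> turns it into a relation in the group.\<close>
      define k where "k x = \<lfloor>of_nat N * u (\<phi> x)\<rfloor>" for x
      have k: "of_nat N * u (\<phi> x) = of_int (k x)" if x: "x \<in> S" for x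
      proof -
        obtain j :: int where "of_nat N * u (\<phi> x) = of_int j" using N(2)[OF imageI[OF x]] by blast
        then show ?thesis by (simp add: k_def)
      qed
      have "\<phi> (\<Otimes>x\<in>S. x [^] k x) = (\<Sum>x\<in>S. (\<lambda>i. of_int (k x) * \<phi> x i))"
        by (rule comb[OF S(1) SG])
      also have "\<dots> = (\<Sum>x\<in>S. (\<lambda>i. of_nat N * (u (\<phi> x) * \<phi> x i)))"
      proof (intro sum.cong refl ext)
        fix x i assume "x \<in> S"
        then have "of_int (k x) = of_nat N * u (\<phi> x)" using k by simp
        then show "of_int (k x) * \<phi> x i = of_nat N * (u (\<phi> x) * \<phi> x i)" by (simp add: mult.assoc)
      qed
      also have "\<dots> = (\<lambda>i. of_nat N * (\<Sum>x\<in>S. (\<lambda>i. u (\<phi> x) * \<phi> x i)) i)"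
        by (rule ext) (simp only: sum_fun_apply sum_distrib_left)
      also have "(\<Sum>x\<in>S. (\<lambda>i. u (\<phi> x) * \<phi> x i)) = 0"
        using u(1) by (simp add: sum.reindex[OF inj'])
      finally have "\<phi> (\<Otimes>x\<in>S. x [^] k x) = \<phi> \<one>" by (simp add: one fun_eq_iff)
      moreover have "(\<Otimes>x\<in>S. x [^] k x) \<in> carrier G" using SG by (intro finprod_closed) auto
      ultimately have "(\<Otimes>x\<in>S. x [^] k x) = \<one>" using inj by (auto dest: inj_onD)
      moreover have "\<forall>F (c :: 'a \<Rightarrow> int). finite F \<and> F \<subseteq> S \<and> (\<Otimes>x\<in>F. x [^] c x) = \<one>
        \<longrightarrow> (\<forall>x\<in>F. c x = 0)" using S(2) unfolding independent_set_def by (elim conjE)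
      ultimately have "\<forall>x\<in>S. k x = 0" using S(1) by (elim allE[of _ S] allE[of _ k]) simp
      then show False using k[OF u(2)] u N by simp
    qed
    moreover have "\<phi> ` S \<subseteq> V.span (?e ` I)"
    proof
      fix f assume "f \<in> \<phi> ` S"
      then obtain x where x: "x \<in> carrier G" "f = \<phi> x" using SG by blast
      have "f = (\<Sum>i\<in>I. (\<lambda>j. f i * ?e i j))"
        using supp[OF x(1)] I x by (auto simp: fun_eq_iff sum_fun_apply if_distrib sum.delta cong: if_cong)
      also have "\<dots> \<in> V.span (?e ` I)" by (intro V.span_sum V.span_scale V.span_base) auto
      finally show "f \<in> V.span (?e ` I)" .
    qed
    ultimately have "card (\<phi> ` S) \<le> card (?e ` I)"
      using V.independent_span_bound[of "?e ` I" "\<phi> ` S"] I by blast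
    also have "\<dots> \<le> card I" by (rule card_image_le[OF I])
    finally show "enat (card S) \<le> enat (card I)" using card_image[OF inj'] by simp
  qed
  obtain x c where xc: "\<And>i. i \<in> I \<Longrightarrow> x i \<in> carrier G \<and> c i \<noteq> 0 \<and> \<phi> (x i) = (\<lambda>j. if j = i then c i else 0)"
    using unit by metis
  have injx: "inj_on x I"
    by (rule inj_onI) (use xc in \<open>metis (mono_tags)\<close>)
  have ind: "independent_set G (x ` I)"
    unfolding independent_set_def
  proof (intro conjI allI impI ballI)
    show "x ` I \<subseteq> carrier G" using xc by auto
    fix F and k :: "'a \<Rightarrow> int" and y
    assume F: "finite F \<and> F \<subseteq> x ` I \<and> (\<Otimes>x\<in>F. x [^] k x) = \<one>" and y: "y \<in> F"
    then obtain i where i: "i \<in> I" "y = x i" by auto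
    have z: "\<phi> z i = (if z = y then c i else 0)" if z: "z \<in> F" for z
    proof -
      obtain j where j: "j \<in> I" "z = x j" using z F by auto
      then show ?thesis using xc[of j] i injx by (auto dest: inj_onD)
    qed
    have "F \<subseteq> carrier G" using F xc by auto
    then have "0 = (\<Sum>x\<in>F. (\<lambda>i. of_int (k x) * \<phi> x i)) i"
      using comb[of F k] F one by simp
    also have "\<dots> = (\<Sum>x\<in>F. of_int (k x) * (if x = y then c i else 0))"
      unfolding sum_fun_apply by (intro sum.cong) (auto simp: z)
    also have "\<dots> = of_int (k y) * c i" using F y by (simp add: if_distrib sum.delta cong: if_cong)
    finally show "k y = 0" using xc i by auto
  qed
  have "enat (card (x ` I)) \<le> group_rank G"
    unfolding group_rank_def using ind I by (intro SUP_upper) auto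
  then show "enat (card I) \<le> group_rank G" using card_image[OF injx] by simp
qed

section \<open>Decompositions into groups of rank one\<close>

lemma (in group) subgroup_nat_pow_closed:
  "subgroup H G \<Longrightarrow> x \<in> H \<Longrightarrow> x [^] (n::nat) \<in> H"
  using subgroup_int_pow_closed[of H x "int n"] by (simp add: int_pow_int)

locale decomp = tf_group +
  fixes C :: "'a set" and \<D> :: "'a set set"
  assumes dec: "rank1_decomposition G C \<D>"
begin

lemma fin: "finite \<D>"
  using dec by (simp add: rank1_decomposition_def)

lemma subgr: "A \<in> \<D> \<Longrightarrow> subgroup A G"
  using dec by (simp add: rank1_decomposition_def)

lemma part_carrier: "A \<in> \<D> \<Longrightarrow> x \<in> A \<Longrightarrow> x \<in> carrier G"
  using subgr subgroup.mem_carrier by metis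

lemma rank1_part: "A \<in> \<D> \<Longrightarrow> rank1_group (G\<lparr>carrier := A\<rparr>)"
  using dec tf_subgroup[OF subgr]
  by (auto simp: rank1_decomposition_def rank1_group_def rank1_group_axioms_def)

lemma bij: "bij_betw (\<lambda>x. \<Otimes>A\<in>\<D>. x A) (\<Pi>\<^sub>E A\<in>\<D>. A) C"
  using dec by (simp add: rank1_decomposition_def)

definition pr :: "'a \<Rightarrow> 'a set \<Rightarrow> 'a" where
  "pr = inv_into (\<Pi>\<^sub>E A\<in>\<D>. A) (\<lambda>x. \<Otimes>A\<in>\<D>. x A)"

lemma pr_PiE: "x \<in> C \<Longrightarrow> pr x \<in> (\<Pi>\<^sub>E A\<in>\<D>. A)"
  unfolding pr_def using bij by (metis bij_betw_imp_surj_on inv_into_into)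

lemma pr_mem: "x \<in> C \<Longrightarrow> A \<in> \<D> \<Longrightarrow> pr x A \<in> A"
  using pr_PiE by (auto simp: PiE_def Pi_def)

lemma pr_carrier: "x \<in> C \<Longrightarrow> A \<in> \<D> \<Longrightarrow> pr x A \<in> carrier G"
  using pr_mem part_carrier by blast

lemma prod_pr: "x \<in> C \<Longrightarrow> (\<Otimes>A\<in>\<D>. pr x A) = x"
  unfolding pr_def using bij_betw_inv_into_right[OF bij] by simp

lemma prod_mem: "f \<in> (\<Pi>\<^sub>E A\<in>\<D>. A) \<Longrightarrow> (\<Otimes>A\<in>\<D>. f A) \<in> C"
  using bij by (metis bij_betw_apply)

lemma pr_prod_PiE: "f \<in> (\<Pi>\<^sub>E A\<in>\<D>. A) \<Longrightarrow> pr (\<Otimes>A\<in>\<D>. f A) = f"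
  unfolding pr_def using bij_betw_inv_into_left[OF bij] by simp

lemma
  assumes f: "\<And>A. A \<in> \<D> \<Longrightarrow> f A \<in> A"
  shows prod_in: "(\<Otimes>A\<in>\<D>. f A) \<in> C" and pr_prod: "B \<in> \<D> \<Longrightarrow> pr (\<Otimes>A\<in>\<D>. f A) B = f B"
proof -
  have eq: "(\<Otimes>A\<in>\<D>. f A) = (\<Otimes>A\<in>\<D>. restrict f \<D> A)"
    using f part_carrier by (intro finprod_cong') auto
  have mem: "restrict f \<D> \<in> (\<Pi>\<^sub>E A\<in>\<D>. A)" using f by auto
  show "(\<Otimes>A\<in>\<D>. f A) \<in> C" unfolding eq by (rule prod_mem[OF mem])
  show "B \<in> \<D> \<Longrightarrow> pr (\<Otimes>A\<in>\<D>. f A) B = f B" unfolding eq pr_prod_PiE[OF mem] by simp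
qed

lemma C_carrier: "x \<in> C \<Longrightarrow> x \<in> carrier G"
  using prod_pr[of x] pr_carrier[of x] by (metis (mono_tags, lifting) finprod_closed Pi_I)

lemma
  assumes "x \<in> C" "y \<in> C"
  shows C_mult: "x \<otimes> y \<in> C" and pr_mult: "A \<in> \<D> \<Longrightarrow> pr (x \<otimes> y) A = pr x A \<otimes> pr y A"
proof -
  have mem: "pr x A \<otimes> pr y A \<in> A" if "A \<in> \<D>" for A
    using that assms pr_mem subgroup.m_closed[OF subgr] by metis
  have eq: "(\<Otimes>A\<in>\<D>. pr x A \<otimes> pr y A) = x \<otimes> y"
    using assms pr_carrier by (subst finprod_multf) (auto simp: prod_pr)
  show "x \<otimes> y \<in> C" using prod_in[of "\<lambda>A. pr x A \<otimes> pr y A"] mem unfolding eq by blast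
  show "A \<in> \<D> \<Longrightarrow> pr (x \<otimes> y) A = pr x A \<otimes> pr y A"
    using pr_prod[of "\<lambda>A. pr x A \<otimes> pr y A"] mem unfolding eq by blast
qed

lemma
  assumes "A \<in> \<D>" "x \<in> A"
  shows part_mem: "x \<in> C" and pr_part: "B \<in> \<D> \<Longrightarrow> pr x B = (if B = A then x else \<one>)"
proof -
  have mem: "(if B = A then x else \<one>) \<in> B" if "B \<in> \<D>" for B
    using that assms subgroup.one_closed[OF subgr] by auto
  have "(\<Otimes>B\<in>\<D>. if A = B then x else \<one>) = x"
    using assms fin part_carrier by (intro finprod_singleton) auto
  then have eq: "(\<Otimes>B\<in>\<D>. if B = A then x else \<one>) = x"
    by (simp add: eq_commute[of A])
  show "x \<in> C" using prod_in[of "\<lambda>B. if B = A then x else \<one>"] mem unfolding eq by blast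
  show "B \<in> \<D> \<Longrightarrow> pr x B = (if B = A then x else \<one>)"
    using pr_prod[of "\<lambda>B. if B = A then x else \<one>"] mem unfolding eq by blast
qed

lemma subgroup_C: "subgroup C G"
proof (rule subgroupI)
  show "C \<subseteq> carrier G" using C_carrier by blast
  show "C \<noteq> {}" using prod_in[of "\<lambda>A. \<one>"] subgroup.one_closed[OF subgr] by blast
  show "x \<otimes> y \<in> C" if "x \<in> C" "y \<in> C" for x y using C_mult that by blast
  fix x assume x: "x \<in> C"
  have mem: "inv (pr x A) \<in> A" if "A \<in> \<D>" for A
    using that x pr_mem subgroup.m_inv_closed[OF subgr] by metis
  have "(\<Otimes>A\<in>\<D>. inv (pr x A)) \<otimes> (\<Otimes>A\<in>\<D>. pr x A) = (\<Otimes>A\<in>\<D>. inv (pr x A) \<otimes> pr x A)"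
    using x pr_carrier by (subst finprod_multf) auto
  also have "\<dots> = \<one>" using x pr_carrier by (intro finprod_one_eqI) auto
  finally have "inv x = (\<Otimes>A\<in>\<D>. inv (pr x A))"
    using x C_carrier pr_carrier prod_pr[OF x] by (intro inv_equality) auto
  then show "inv x \<in> C" using prod_in[of "\<lambda>A. inv (pr x A)"] mem by simp
qed

lemma pr_hom: "A \<in> \<D> \<Longrightarrow> (\<lambda>x. pr x A) \<in> hom (G\<lparr>carrier := C\<rparr>) (G\<lparr>carrier := A\<rparr>)"
  using pr_mem pr_mult by (auto simp: hom_def)

lemma pr_nat_pow: "A \<in> \<D> \<Longrightarrow> x \<in> C \<Longrightarrow> pr (x [^] (n::nat)) A = pr x A [^] n"
proof (induction n)
  case 0
  have "\<one> \<in> A" using 0 subgroup.one_closed[OF subgr] by blast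
  then show ?case using pr_part[OF 0(1), of \<one> A] 0 by simp
next
  case (Suc n)
  have "x [^] n \<in> C" using Suc subgroup_nat_pow_closed[OF subgroup_C] by blast
  then show ?case using Suc by (simp add: pr_mult)
qed

end

lemma (in tf_group) pow_hom: "subgroup A G \<Longrightarrow> subgroup C G \<Longrightarrow> (\<And>x. x \<in> A \<Longrightarrow> x [^] (N::nat) \<in> C) \<Longrightarrow>
   (\<lambda>x. x [^] N) \<in> hom (G\<lparr>carrier := A\<rparr>) (G\<lparr>carrier := C\<rparr>)"
  by (auto simp: hom_def nat_pow_distrib subgroup.mem_carrier)

text \<open>
  Multiplication by \<open>N\<close> followed by projections gives nonzero homomorphisms from \<open>A\<close> to some \<open>B\<close>
  and back, which squeeze the characteristics.
\<close>

lemma decomp_types_subset: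
  fixes G (structure)
  assumes 1: "decomp G C \<D>" and 2: "decomp G C' \<D>'" and N: "N > (0::nat)"
    and sub: "\<And>x. x \<in> C \<Longrightarrow> x [^] N \<in> C'" "\<And>x. x \<in> C' \<Longrightarrow> x [^] N \<in> C"
    and A: "A \<in> \<D>"
  shows "\<exists>B\<in>\<D>'. rank1_type (G\<lparr>carrier := B\<rparr>) = rank1_type (G\<lparr>carrier := A\<rparr>)"
proof -
  interpret D: decomp G C \<D> by fact
  interpret D': decomp G C' \<D>' by fact
  interpret A: rank1_group "G\<lparr>carrier := A\<rparr>" by (rule D.rank1_part[OF A])
  obtain a where a: "a \<in> A" "a \<noteq> \<one>" using A.nontrivial by auto
  note ac = D.part_carrier[OF A a(1)]
  let ?b = "\<lambda>B. D'.pr (a [^] N) B"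
  have aN: "a [^] N \<in> C'" using sub D.part_mem[OF A a(1)] by blast
  have bC: "?b B \<in> C'" "?b B [^] N \<in> C" if "B \<in> \<D>'" for B
    using that aN D'.pr_mem D'.part_mem sub by blast+
  \<comment> \<open>Otherwise the components of \<open>a [^] N\<close> in \<open>C'\<close>, raised
    to the power \<open>N\<close>, would all project to \<one> in \<open>A\<close>. Their product is
    \<open>(a [^] N) [^] N\<close>, which projects to itself and is nontrivial because the group is
    torsion-free.\<close>
  have ex: "\<exists>B\<in>\<D>'. D.pr (?b B [^] N) A \<noteq> \<one>"
  proof (rule ccontr)
    assume "\<not> ?thesis"
    then have z: "D.pr (?b B [^] N) A = \<one>" if "B \<in> \<D>'" for B using that by blast
    have *: "finprod G (\<lambda>B. ?b B [^] N) F \<in> C \<and> D.pr (finprod G (\<lambda>B. ?b B [^] N) F) A = \<one>"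
      if "F \<subseteq> \<D>'" for F
      using finite_subset[OF that D'.fin] that
    proof (induction F)
      case empty
      have "\<one> \<in> A" using A subgroup.one_closed[OF D.subgr] by blast
      then show ?case using D.pr_part[OF A _ A] D.part_mem[OF A] by simp
    next
      case (insert B F)
      have "(\<lambda>B. ?b B [^] N) \<in> F \<rightarrow> carrier G" "?b B [^] N \<in> carrier G"
        using bC D.C_carrier insert by auto
      then show ?case using insert z bC by (simp add: D.C_mult D.pr_mult A)
    qed
    have "finprod G (\<lambda>B. ?b B [^] N) F = finprod G ?b F [^] N" if "F \<subseteq> \<D>'" for F
      using finite_subset[OF that D'.fin] that
    proof (induction F)
      case (insert B F)
      have "?b \<in> F \<rightarrow> carrier G" "?b B \<in> carrier G" "(\<lambda>B. ?b B [^] N) \<in> F \<rightarrow> carrier G"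
        using bC D'.C_carrier insert by auto
      then show ?case using insert by (simp add: D.nat_pow_distrib)
    qed simp
    from this[of \<D>'] have "finprod G (\<lambda>B. ?b B [^] N) \<D>' = (a [^] N) [^] N"
      using D'.prod_pr[OF aN] by simp
    then have "D.pr ((a [^] N) [^] N) A = \<one>" using *[of \<D>'] by simp
    then have "(a [^] N) [^] N = \<one>"
      using D.pr_nat_pow[OF A] D.part_mem[OF A a(1)] D.subgroup_C D.pr_part[OF A a(1) A]
      by (metis D.subgroup_nat_pow_closed)
    then show False using a ac N D.nat_pow_eq_one D.nat_pow_closed by metis
  qed
  then obtain B where B: "B \<in> \<D>'" "D.pr (?b B [^] N) A \<noteq> \<one>" by blast
  interpret B: rank1_group "G\<lparr>carrier := B\<rparr>" by (rule D'.rank1_part[OF B(1)])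
  let ?\<phi> = "\<lambda>x. D'.pr (x [^] N) B" and ?\<psi> = "\<lambda>x. D.pr (x [^] N) A"
  have \<phi>: "?\<phi> \<in> hom (G\<lparr>carrier := A\<rparr>) (G\<lparr>carrier := B\<rparr>)"
  proof -
    have "(\<lambda>x. x [^] N) \<in> hom (G\<lparr>carrier := A\<rparr>) (G\<lparr>carrier := C'\<rparr>)"
      using sub D.part_mem[OF A] by (intro D.pow_hom D.subgr[OF A] D'.subgroup_C) blast
    from hom_compose[OF this D'.pr_hom[OF B(1)]] show ?thesis by (simp add: o_def)
  qed
  have \<psi>: "?\<psi> \<in> hom (G\<lparr>carrier := B\<rparr>) (G\<lparr>carrier := A\<rparr>)"
  proof -
    have "(\<lambda>x. x [^] N) \<in> hom (G\<lparr>carrier := B\<rparr>) (G\<lparr>carrier := C\<rparr>)"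
      using sub D'.part_mem[OF B(1)] by (intro D.pow_hom D'.subgr[OF B(1)] D.subgroup_C) blast
    from hom_compose[OF this D.pr_hom[OF A]] show ?thesis by (simp add: o_def)
  qed
  have b: "?\<phi> a \<in> B" using D'.pr_mem aN B by blast
  have a': "?\<psi> (?\<phi> a) \<in> A" using \<psi> b by (auto simp: hom_def)
  have b1: "?\<phi> a \<noteq> \<one>"
  proof
    assume "?\<phi> a = \<one>"
    then have "?\<psi> (?\<phi> a) = D.pr \<one> A" by simp
    also have "\<dots> = \<one>"
      using D.pr_part[OF A _ A] subgroup.one_closed[OF D.subgr[OF A]] by auto
    finally show False using B by simp
  qed
  let ?cA = "characteristic (G\<lparr>carrier := A\<rparr>)" and ?cB = "characteristic (G\<lparr>carrier := B\<rparr>)"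
  have "(?cA a, ?cB (?\<phi> a)) \<in> char_equiv"
  proof (rule char_equiv_sandwich)
    show "(?cA a, ?cA (?\<psi> (?\<phi> a))) \<in> char_equiv"
      using a a' B by (intro A.characteristic_equiv) auto
    show "?cB (?\<phi> a) \<in> characteristics" by (rule B.characteristic_in)
    show "?cA a p \<le> ?cB (?\<phi> a) p" for p
      using A.height_hom_le[OF _ B.tf_group_axioms \<phi>, of a p] a by (simp add: characteristic_def)
    show "?cB (?\<phi> a) p \<le> ?cA (?\<psi> (?\<phi> a)) p" for p
      using B.height_hom_le[OF _ A.tf_group_axioms \<psi>, of "?\<phi> a" p] b by (simp add: characteristic_def)
  qed
  then have "rank1_type (G\<lparr>carrier := B\<rparr>) = rank1_type (G\<lparr>carrier := A\<rparr>)"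
    using A.rank1_type_eq[of a] B.rank1_type_eq[of "?\<phi> a"] a b b1
      equiv_class_eq[OF equiv_char_equiv] by auto
  then show ?thesis using B by blast
qed

section \<open>The regulator\<close>

text \<open>In a torsion-free group and for a set \<open>S\<close> of primes this is the subgroup
  \<open>G(\<tau>)\<close> of the elements of type at least \<open>\<tau> = itype S\<close>. For
  idempotent types, divisibility alone describes it.\<close>

definition divis :: "('a, 'm) monoid_scheme \<Rightarrow> nat set \<Rightarrow> 'a set" where
  "divis G S = {x \<in> carrier G. \<forall>p\<in>S. \<forall>n. \<exists>y\<in>carrier G. y [^]\<^bsub>G\<^esub> (p ^ n) = x}"

lemma (in comm_group) index_pow_mem:
  assumes "subgroup H G" "finite (rcosets H)" "x \<in> carrier G"
  shows "x [^] card (rcosets H) \<in> H"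
proof -
  have n: "H \<lhd> G" using assms(1) by (simp add: subgroup_imp_normal)
  interpret N: normal H G by fact
  interpret Q: group "G Mod H" by (rule N.factorgroup_is_group)
  have c: "H #> x \<in> carrier (G Mod H)" using assms by (auto simp: FactGroup_def RCOSETS_def)
  have "(H #> x) [^]\<^bsub>G Mod H\<^esub> card (rcosets H) = \<one>\<^bsub>G Mod H\<^esub>"
    using Q.pow_order_eq_1[OF c] by (simp add: order_def FactGroup_def)
  then have "H #> (x [^] card (rcosets H)) = H"
    using N.FactGroup_pow[OF assms(3)] by (simp add: FactGroup_def)
  then show ?thesis using rcos_self[OF nat_pow_closed[OF assms(3)] assms(1)] by metis
qed

text \<open>Sending a coset of \<open>C\<close> to the coset of \<open>B\<close> around it is onto.
  If the indices agree, it is injective, so \<open>b \<in> B\<close> cannot lead out of the coset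
  \<open>C\<close>.\<close>

lemma (in group) rcosets_mono:
  assumes C: "subgroup C G" and B: "subgroup B G" and sub: "C \<subseteq> B" and f: "finite (rcosets C)"
  shows "finite (rcosets B)" "card (rcosets B) \<le> card (rcosets C)"
    "card (rcosets C) \<le> card (rcosets B) \<Longrightarrow> C = B"
proof -
  define F where "F K = B <#> K" for K
  have F: "F (C #> x) = B #> x" if "x \<in> carrier G" for x
  proof -
    have "B <#> (C #> x) = (B <#> C) #> x"
      using that subgroup.subset[OF B] subgroup.subset[OF C] by (simp add: setmult_rcos_assoc)
    also have "B <#> C = B"
    proof
      show "B <#> C \<subseteq> B" using sub subgroup.m_closed[OF B] by (auto simp: set_mult_def)
      show "B \<subseteq> B <#> C"
      proof
        fix b assume "b \<in> B"
        then have "b = b \<otimes> \<one>" using subgroup.mem_carrier[OF B] by simp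
        then show "b \<in> B <#> C" using \<open>b \<in> B\<close> subgroup.one_closed[OF C] by (auto simp: set_mult_def)
      qed
    qed
    finally show ?thesis by (simp add: F_def)
  qed
  have im: "rcosets B = F ` (rcosets C)"
    using F by (auto simp: RCOSETS_def image_iff)
  show "finite (rcosets B)" "card (rcosets B) \<le> card (rcosets C)"
    unfolding im using f by (auto intro: card_image_le)
  assume "card (rcosets C) \<le> card (rcosets B)"
  then have "card (F ` (rcosets C)) = card (rcosets C)"
    using im card_image_le[OF f, of F] by simp
  then have inj: "inj_on F (rcosets C)" by (rule eq_card_imp_inj_on[OF f])
  have "B \<subseteq> C"
  proof
    fix b assume b: "b \<in> B"
    then have bc: "b \<in> carrier G" by (rule subgroup.mem_carrier[OF B])
    have "F (C #> b) = F (C #> \<one>)"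
      unfolding F[OF bc] F[OF one_closed]
      using b subgroup.rcos_const[OF B is_group b] subgroup.subset[OF B] by (simp add: coset_mult_one)
    moreover have "C #> b \<in> rcosets C" "C #> \<one> \<in> rcosets C"
      using rcosetsI[OF subgroup.subset[OF C]] bc one_closed by blast+
    ultimately have "C #> b = C #> \<one>" using inj by (meson inj_onD)
    then have "C #> b = C" using subgroup.subset[OF C] by (simp add: coset_mult_one)
    then show "b \<in> C" using rcos_self[OF bc C] by simp
  qed
  then show "C = B" using sub by blast
qed

text \<open>
  All completely decomposable subgroups of finite index are contained in \<open>C\<close>, so \<open>C\<close> is the only
  one of least index.
\<close>

lemma (in decomp) Reg_eq:
  assumes fin: "finite (rcosets C)"
    and types: "\<And>A. A \<in> \<D> \<Longrightarrow> \<exists>S. rank1_type (G\<lparr>carrier := A\<rparr>) = itype S \<and> divis G S \<subseteq> C"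
  shows "Reg G = C"
proof -
  have C: "C \<in> cd_finite_index G"
    using fin dec subgroup_C by (auto simp: cd_finite_index_def completely_decomposable_in_def)
  have sub: "C' \<subseteq> C" if "C' \<in> cd_finite_index G" for C'
  proof -
    obtain \<D>' where d: "rank1_decomposition G C' \<D>'" and f: "finite (rcosets C')"
      using \<open>C' \<in> cd_finite_index G\<close> by (auto simp: cd_finite_index_def completely_decomposable_in_def)
    interpret D': decomp G C' \<D>' using d by unfold_locales
    let ?n = "card (rcosets C)" and ?n' = "card (rcosets C')"
    have pos: "?n > 0" "?n' > 0"
      using fin f subgroup_C D'.subgroup_C by (auto simp: card_gt_0_iff RCOSETS_def)
    have N: "x [^] (?n * ?n') \<in> C" "x [^] (?n * ?n') \<in> C'" if x: "x \<in> carrier G" for x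
      using index_pow_mem[OF subgroup_C fin nat_pow_closed[OF x, of ?n']]
        index_pow_mem[OF D'.subgroup_C f nat_pow_closed[OF x, of ?n]] x
      by (simp_all add: nat_pow_pow mult.commute)
    have part: "A \<subseteq> C" if A: "A \<in> \<D>'" for A
    proof
      fix x assume x: "x \<in> A"
      interpret A: rank1_group "G\<lparr>carrier := A\<rparr>" by (rule D'.rank1_part[OF A])
      \<comment> \<open>The product of both indices maps the group into \<open>C\<close> and into
        \<open>C'\<close>, so every type of \<open>C'\<close> occurs in \<open>C\<close>. A summand
        of type \<open>itype S\<close> then consists of elements infinitely divisible by the primes
        of \<open>S\<close>, and these lie in \<open>C\<close>.\<close>
      obtain B where "B \<in> \<D>" "rank1_type (G\<lparr>carrier := B\<rparr>) = rank1_type (G\<lparr>carrier := A\<rparr>)"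
        using decomp_types_subset[OF D'.decomp_axioms decomp_axioms, of "?n * ?n'" A] pos N A C_carrier D'.C_carrier
        by auto
      then obtain S where S: "rank1_type (G\<lparr>carrier := A\<rparr>) = itype S" "divis G S \<subseteq> C" using types by metis
      have "x \<in> divis G S"
        unfolding divis_def
      proof (intro CollectI conjI ballI allI)
        show "x \<in> carrier G" by (rule D'.part_carrier[OF A x])
        fix p n assume "p \<in> S"
        then obtain y where "y \<in> A" "y [^]\<^bsub>G\<lparr>carrier := A\<rparr>\<^esub> (p ^ n) = x"
          using A.itype_divisible[OF S(1), of x p n] x by auto
        then show "\<exists>y\<in>carrier G. y [^] (p ^ n) = x"
          using D'.part_carrier[OF A] by (auto simp: nat_pow_consistent[symmetric])
      qed
      then show "x \<in> C" using S by blast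
    qed
    show ?thesis
    proof
      fix x assume x: "x \<in> C'"
      have "finprod G (D'.pr x) F \<in> C" if "F \<subseteq> \<D>'" for F
        using finite_subset[OF that D'.fin] that
      proof (induction F)
        case empty
        then show ?case using subgroup.one_closed[OF subgroup_C] by simp
      next
        case (insert A F)
        have "D'.pr x \<in> F \<rightarrow> carrier G" "D'.pr x A \<in> carrier G" "D'.pr x A \<in> C"
          using D'.pr_carrier[OF x] D'.pr_mem[OF x, of A] part[of A] insert by auto
        then show ?case using insert C_mult by simp
      qed
      from this[of \<D>'] show "x \<in> C" using D'.prod_pr[OF x] by simp
    qed
  qed
  have "{C' \<in> cd_finite_index G. \<forall>C''\<in>cd_finite_index G. card (rcosets C') \<le> card (rcosets C'')} = {C}"
  proof (intro equalityI subsetI; clarsimp)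
    fix C' assume "C' \<in> cd_finite_index G" "\<forall>C''\<in>cd_finite_index G. card (rcosets C') \<le> card (rcosets C'')"
    then show "C' = C"
      using rcosets_mono(3)[OF _ subgroup_C sub] C
      by (auto simp: cd_finite_index_def completely_decomposable_in_def)
  next
    show "C \<in> cd_finite_index G \<and> (\<forall>C''\<in>cd_finite_index G. card (rcosets C) \<le> card (rcosets C''))"
      using C rcosets_mono(2)[OF _ subgroup_C sub]
      by (auto simp: cd_finite_index_def completely_decomposable_in_def)
  qed
  then show ?thesis by (simp add: Reg_def)
qed

section \<open>Groups in coordinates\<close>

text \<open>Purity of the blocks, expressed through \<open>d\<close> alone. An element
  \<open>f + t d\<close> with \<open>f\<close> in the lattice that is supported on the block of
  \<open>S\<close> has \<open>t d\<close> integral at all other coordinates; the condition makes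
  \<open>t d\<close> integral everywhere, so the element already lies in the lattice.\<close>

definition pure_data :: "'i set \<Rightarrow> ('i \<Rightarrow> nat set) \<Rightarrow> ('i \<Rightarrow> rat) \<Rightarrow> bool" where
  "pure_data I \<sigma> d \<longleftrightarrow> (\<forall>S\<in>\<sigma> ` I. \<forall>t::int. (\<forall>i\<in>I. \<sigma> i \<noteq> S \<longrightarrow> of_int t * d i \<in> Zs (\<sigma> i)) \<longrightarrow>
      (\<forall>i\<in>I. of_int t * d i \<in> Zs (\<sigma> i)))"

lemma (in comm_group) finprod_in_subgroup:
  assumes "subgroup H G" "finite A" "\<And>a. a \<in> A \<Longrightarrow> f a \<in> H"
  shows "finprod G f A \<in> H"
  using assms(2,3)
proof (induction A)
  case empty
  then show ?case using subgroup.one_closed[OF assms(1)] by simp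
next
  case (insert a A)
  then have "f \<in> A \<rightarrow> carrier G" "f a \<in> carrier G"
    using subgroup.mem_carrier[OF assms(1)] by auto
  then show ?case using insert subgroup.m_closed[OF assms(1)] by simp
qed

locale coord = comm_group G for G (structure) +
  fixes I :: "'i set" and \<sigma> :: "'i \<Rightarrow> nat set" and d :: "'i \<Rightarrow> rat" and \<phi> :: "'a \<Rightarrow> 'i \<Rightarrow> rat"
  assumes finI: "finite I"
    and primes: "\<And>i p. i \<in> I \<Longrightarrow> p \<in> \<sigma> i \<Longrightarrow> Factorial_Ring.prime p"
    and d_supp: "\<And>i. i \<notin> I \<Longrightarrow> d i = 0"
    and \<phi>_iso: "\<phi> \<in> iso G (lattice_group I \<sigma> d)"
begin

lemma \<phi>_mult: "x \<in> carrier G \<Longrightarrow> y \<in> carrier G \<Longrightarrow> \<phi> (x \<otimes> y) = \<phi> x + \<phi> y"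
  using \<phi>_iso by (auto simp: iso_def hom_def)

lemma \<phi>_inj: "inj_on \<phi> (carrier G)" and \<phi>_img: "\<phi> ` carrier G = carrier (lattice_group I \<sigma> d)"
  using \<phi>_iso by (auto simp: iso_def bij_betw_def)

lemma \<phi>_eqD: "x \<in> carrier G \<Longrightarrow> y \<in> carrier G \<Longrightarrow> (\<And>i. \<phi> x i = \<phi> y i) \<Longrightarrow> x = y"
  by (rule inj_onD[OF \<phi>_inj]) (auto simp: fun_eq_iff)

lemma \<phi>_one: "\<phi> \<one> = 0"
  by (rule embed_one[OF is_group \<phi>_mult])

lemma \<phi>_int_pow: "x \<in> carrier G \<Longrightarrow> \<phi> (x [^] (n::int)) i = of_int n * \<phi> x i"
  using embed_int_pow[OF is_group \<phi>_mult, of x n] by simp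

lemma \<phi>_nat_pow: "x \<in> carrier G \<Longrightarrow> \<phi> (x [^] (n::nat)) i = of_nat n * \<phi> x i"
  using \<phi>_int_pow[of x "int n" i] by (simp add: int_pow_int)

lemma \<phi>_inv: "x \<in> carrier G \<Longrightarrow> \<phi> (inv x) i = - \<phi> x i"
  using \<phi>_int_pow[of x "-1" i] by (simp add: int_pow_neg)

lemma \<phi>_supp: 
  assumes "x \<in> carrier G" "i \<notin> I" shows "\<phi> x i = 0"
proof -
  have "\<phi> x \<in> carrier (lattice_group I \<sigma> d)" using assms \<phi>_img by blast
  then obtain t where "(\<lambda>i. \<phi> x i - of_int t * d i) \<in> lat I \<sigma>" by (auto simp: carrier_lattice_group_iff)
  from latD(2)[OF this assms(2)] show ?thesis using d_supp[OF assms(2)] by simp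
qed

definition el :: "('i \<Rightarrow> rat) \<Rightarrow> 'a" where "el = inv_into (carrier G) \<phi>"

lemma \<phi>_el: "f \<in> carrier (lattice_group I \<sigma> d) \<Longrightarrow> \<phi> (el f) = f"
  and el_carrier: "f \<in> carrier (lattice_group I \<sigma> d) \<Longrightarrow> el f \<in> carrier G"
  unfolding el_def using \<phi>_img by (auto simp: f_inv_into_f inv_into_into)

sublocale tf_group
proof
  show "torsion_free G"
    unfolding torsion_free_def
  proof (intro ballI allI impI)
    fix x and n :: nat assume x: "x \<in> carrier G" "n > 0" "x [^] n = \<one>"
    have "\<phi> x i = \<phi> \<one> i" for i
      using \<phi>_nat_pow[OF x(1), of n i] x by (simp add: \<phi>_one)
    then show "x = \<one>" using \<phi>_eqD x by blast
  qed
qed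

definition L :: "'a set" where "L = {x \<in> carrier G. \<phi> x \<in> lat I \<sigma>}"

lemma el_L: "f \<in> lat I \<sigma> \<Longrightarrow> el f \<in> L" and \<phi>_el_lat: "f \<in> lat I \<sigma> \<Longrightarrow> \<phi> (el f) = f"
  using lat_subset_lattice_group[of I \<sigma> d] by (auto simp: L_def \<phi>_el el_carrier subset_iff)

lemma subgroup_L: "subgroup L G"
proof (rule subgroupI)
  show "L \<noteq> {}" using lat_0 by (auto simp: L_def \<phi>_one intro!: exI[of _ \<one>])
  show "inv x \<in> L" if "x \<in> L" for x
  proof -
    have "\<phi> (inv x) = (\<lambda>i. of_int (-1) * \<phi> x i)"
      using \<phi>_inv[of x] that by (simp add: L_def fun_eq_iff)
    moreover have "(\<lambda>i. of_int (-1) * \<phi> x i) \<in> lat I \<sigma>"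
      using that by (intro lat_int_mult) (simp add: L_def)
    ultimately show ?thesis using that by (simp add: L_def)
  qed
  show "x \<otimes> y \<in> L" if "x \<in> L" "y \<in> L" for x y
    using that by (auto simp: L_def \<phi>_mult lat_add)
qed (auto simp: L_def)

definition gen :: 'a where "gen = el d"

lemma gen: "gen \<in> carrier G" "\<phi> gen = d"
  using \<phi>_el[OF d_in_lattice_group] el_carrier[OF d_in_lattice_group] by (simp_all add: gen_def)

lemma decompose:
  assumes "x \<in> carrier G"
  shows "\<exists>y\<in>L. \<exists>t::int. x = y \<otimes> gen [^] t"
proof -
  have "\<phi> x \<in> carrier (lattice_group I \<sigma> d)" using assms \<phi>_img by blast
  then obtain t where t: "(\<lambda>i. \<phi> x i - of_int t * d i) \<in> lat I \<sigma>" by (auto simp: carrier_lattice_group_iff)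
  let ?y = "el (\<lambda>i. \<phi> x i - of_int t * d i)"
  have y: "?y \<in> L" "?y \<in> carrier G" using el_L[OF t] by (auto simp: L_def)
  have "x = ?y \<otimes> gen [^] t"
    using assms y gen by (intro \<phi>_eqD) (auto simp: \<phi>_mult \<phi>_el_lat[OF t] \<phi>_int_pow)
  then show ?thesis using y by blast
qed

lemma exponent: "\<exists>N>0::nat. \<forall>x\<in>carrier G. x [^] N \<in> L"
proof -
  obtain N where N: "N > 0" "\<And>i. i \<in> I \<Longrightarrow> \<exists>k::int. of_nat N * d i = of_int k"
    using common_denominator[OF finI, of d] by blast
  have "x [^] N \<in> L" if x: "x \<in> carrier G" for x
  proof -
    have "\<phi> x \<in> carrier (lattice_group I \<sigma> d)" using x \<phi>_img by blast
    then obtain t where t: "(\<lambda>i. \<phi> x i - of_int t * d i) \<in> lat I \<sigma>" by (auto simp: carrier_lattice_group_iff)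
    have "of_nat N * \<phi> x i \<in> Zs (\<sigma> i)" if i: "i \<in> I" for i
    proof -
      obtain k :: int where k: "of_nat N * d i = of_int k" using N(2)[OF i] by blast
      have "of_nat N * \<phi> x i = of_nat N * (\<phi> x i - of_int t * d i) + of_int t * (of_nat N * d i)"
        by (simp add: algebra_simps)
      also have "\<dots> \<in> Zs (\<sigma> i)"
        unfolding k using latD(1)[OF t i] by (intro Zs_add Zs_mult) auto
      finally show ?thesis .
    qed
    then show ?thesis using x by (auto simp: L_def \<phi>_nat_pow \<phi>_supp intro!: latI)
  qed
  then show ?thesis using N by blast
qed

lemma coset_gen:
  assumes "x \<in> carrier G" shows "\<exists>t::int. L #> x = L #> gen [^] t"
proof -
  obtain y and t :: int where y: "y \<in> L" "x = y \<otimes> gen [^] t" using decompose[OF assms] by blast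
  have "L #> x = (L #> y) #> gen [^] t"
    using y gen subgroup.subset[OF subgroup_L] by (auto simp: coset_mult_assoc subset_iff)
  also have "L #> y = L" using y subgroup.rcos_const[OF subgroup_L is_group] by blast
  finally show ?thesis by blast
qed

text \<open>Modulo \<open>L\<close> every element is a multiple of \<open>gen\<close>, and only the
  residue of the multiplier modulo the exponent counts.\<close>

lemma finite_index: "finite (rcosets L)"
proof -
  obtain N :: nat where N: "N > 0" "\<And>x. x \<in> carrier G \<Longrightarrow> x [^] N \<in> L" using exponent by blast
  have "rcosets L \<subseteq> (\<lambda>t. L #> gen [^] (t::int)) ` {0..<int N}"
  proof
    fix K assume "K \<in> rcosets L"
    then obtain x where x: "x \<in> carrier G" "K = L #> x" by (auto simp: RCOSETS_def)
    then obtain t :: int where t: "K = L #> gen [^] t" using coset_gen by blast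
    let ?r = "t mod int N" and ?q = "t div int N"
    have e: "gen [^] t = (gen [^] N) [^] ?q \<otimes> gen [^] ?r"
      using gen by (simp add: int_pow_int[symmetric] int_pow_pow int_pow_mult[symmetric])
    have m: "(gen [^] N) [^] ?q \<in> L"
      using N(2)[OF gen(1)] by (intro subgroup_int_pow_closed subgroup_L)
    have "K = (L #> (gen [^] N) [^] ?q) #> gen [^] ?r"
      unfolding t e using gen subgroup.subset[OF subgroup_L] by (simp add: coset_mult_assoc)
    also have "L #> (gen [^] N) [^] ?q = L" using m subgroup.rcos_const[OF subgroup_L is_group] by blast
    finally show "K \<in> (\<lambda>t. L #> gen [^] (t::int)) ` {0..<int N}" using N(1) by auto
  qed
  then show ?thesis by (rule finite_subset) auto
qed

lemma cyclic_quotient: "cyclic_group (G Mod L)"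
proof -
  have "L \<lhd> G" using subgroup_L by (simp add: subgroup_imp_normal)
  then interpret N: normal L G .
  interpret Q: group "G Mod L" by (rule N.factorgroup_is_group)
  have c: "L #> gen \<in> carrier (G Mod L)" using gen by (auto simp: FactGroup_def RCOSETS_def)
  have "carrier (G Mod L) = range (\<lambda>n::int. (L #> gen) [^]\<^bsub>G Mod L\<^esub> n)"
    unfolding N.FactGroup_int_pow[OF gen(1)]
    using coset_gen gen by (auto simp: FactGroup_def RCOSETS_def image_iff)
  then show ?thesis using Q.cyclic_group c by blast
qed

definition part :: "'i \<Rightarrow> 'a set" where "part i = {x \<in> L. \<forall>j. j \<noteq> i \<longrightarrow> \<phi> x j = 0}"

lemma part_L: "part i \<subseteq> L" and part_carrier: "x \<in> part i \<Longrightarrow> x \<in> carrier G"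
  by (auto simp: part_def L_def)

definition single :: "'i \<Rightarrow> rat \<Rightarrow> 'i \<Rightarrow> rat" where "single i q = (\<lambda>j. if j = i then q else 0)"

lemma single_lat: "i \<in> I \<Longrightarrow> q \<in> Zs (\<sigma> i) \<Longrightarrow> single i q \<in> lat I \<sigma>"
  by (rule latI) (auto simp: single_def)

lemma single_part:
  assumes "i \<in> I" "q \<in> Zs (\<sigma> i)"
  shows "el (single i q) \<in> part i" "\<phi> (el (single i q)) = single i q"
  using el_L[OF single_lat[OF assms]] \<phi>_el_lat[OF single_lat[OF assms]]
  by (auto simp: part_def single_def)

lemma part_coord: "i \<in> I \<Longrightarrow> x \<in> part i \<Longrightarrow> \<phi> x i \<in> Zs (\<sigma> i)"
  by (auto simp: part_def L_def dest: latD)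

lemma subgroup_part: "subgroup (part i) G"
proof (rule subgroupI)
  show "part i \<subseteq> carrier G" using part_carrier by blast
  have "\<one> \<in> part i" using subgroup.one_closed[OF subgroup_L] by (simp add: part_def \<phi>_one)
  then show "part i \<noteq> {}" by blast
  show "inv x \<in> part i" if "x \<in> part i" for x
    using that subgroup.m_inv_closed[OF subgroup_L] part_carrier[OF that] by (simp add: part_def \<phi>_inv)
  show "x \<otimes> y \<in> part i" if "x \<in> part i" "y \<in> part i" for x y
    using that subgroup.m_closed[OF subgroup_L] part_carrier[OF that(1)] part_carrier[OF that(2)]
    by (simp add: part_def \<phi>_mult)
qed

lemma inj_part: "inj_on part I"
proof (rule inj_onI)
  fix i j assume ij: "i \<in> I" "j \<in> I" "part i = part j"
  show "i = j"
  proof (rule ccontr)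
    assume "i \<noteq> j"
    have "el (single i 1) \<in> part j" using single_part(1)[of i 1] ij by simp
    then have "\<phi> (el (single i 1)) i = 0" using \<open>i \<noteq> j\<close> by (auto simp: part_def)
    then show False using single_part(2)[of i 1] ij by (simp add: single_def)
  qed
qed

lemma rank_part:
  assumes i: "i \<in> I" shows "group_rank (G\<lparr>carrier := part i\<rparr>) = 1"
proof -
  have "group_rank (G\<lparr>carrier := part i\<rparr>) = enat (card {i})"
  proof (rule group_rank_embed)
    show "comm_group (G\<lparr>carrier := part i\<rparr>)"
      using tf_subgroup[OF subgroup_part] by (simp add: tf_group_def)
    show "inj_on \<phi> (carrier (G\<lparr>carrier := part i\<rparr>))"
      using \<phi>_inj part_carrier by (auto intro: inj_on_subset)
    show "\<exists>x\<in>carrier (G\<lparr>carrier := part i\<rparr>). \<exists>c. c \<noteq> 0 \<and> \<phi> x = (\<lambda>j'. if j' = j then c else 0)"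
      if "j \<in> {i}" for j
      using single_part[OF i Zs_1] that by (intro bexI[of _ "el (single i 1)"] exI[of _ 1]) (auto simp: single_def)
  qed (auto simp: \<phi>_mult part_carrier, auto simp: part_def)
  then show ?thesis by (simp add: one_enat_def)
qed

text \<open>The unit vector has \<open>p\<close>-power roots of all orders if
  \<open>p \<in> \<sigma> i\<close>. For another prime, a single \<open>p\<close>-th root would put
  \<open>p\<close> into a denominator of \<open>Zs (\<sigma> i)\<close>.\<close>

lemma type_part:
  assumes i: "i \<in> I" shows "rank1_type (G\<lparr>carrier := part i\<rparr>) = itype (\<sigma> i)"
proof -
  interpret P: rank1_group "G\<lparr>carrier := part i\<rparr>"
    using tf_subgroup[OF subgroup_part] rank_part[OF i] by (simp add: rank1_group_def rank1_group_axioms_def)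
  let ?a = "el (single i 1)"
  have a: "?a \<in> part i" "\<phi> ?a = single i 1" using single_part[OF i Zs_1] by auto
  have a1: "?a \<noteq> \<one>"
  proof
    assume "?a = \<one>"
    then have "single i 1 i = 0" using a \<phi>_one by (metis zero_fun_apply)
    then show False by (simp add: single_def)
  qed
  have pow: "y [^]\<^bsub>G\<lparr>carrier := part i\<rparr>\<^esub> (n::nat) = y [^] n" for y n by (simp add: nat_pow_consistent[symmetric])
  have "characteristic (G\<lparr>carrier := part i\<rparr>) ?a p = (if p \<in> \<sigma> i then \<infinity> else 0)" for p
  proof (cases "Factorial_Ring.prime p")
    case p: True
    show ?thesis
    proof (cases "p \<in> \<sigma> i")
      case True
      have "\<exists>y\<in>part i. y [^] (p ^ n) = ?a" for n
      proof -
        have z: "1 / of_nat (p ^ n) \<in> Zs (\<sigma> i)" by (rule Zs_divide_prime_power[OF Zs_1 True p])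
        let ?y = "el (single i (1 / of_nat (p ^ n)))"
        have y: "?y \<in> part i" "\<phi> ?y = single i (1 / of_nat (p ^ n))" using single_part[OF i z] by auto
        have "?y [^] (p ^ n) = ?a"
          using y a p part_carrier by (intro \<phi>_eqD) (auto simp: \<phi>_nat_pow single_def prime_gt_0_nat)
        then show ?thesis using y by blast
      qed
      then have "height (G\<lparr>carrier := part i\<rparr>) p ?a = \<infinity>"
        using P.height_eq_infinity_iff[of ?a p] a by (simp add: pow)
      then show ?thesis using p True by (simp add: characteristic_def)
    next
      case False
      have "\<not> enat 1 \<le> height (G\<lparr>carrier := part i\<rparr>) p ?a"
      proof
        assume "enat 1 \<le> height (G\<lparr>carrier := part i\<rparr>) p ?a"
        then obtain y where y: "y \<in> part i" "y [^] p = ?a"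
          using P.height_ge_iff[of ?a 1 p] a by (auto simp: pow)
        have "of_nat p * \<phi> y i = 1"
          using \<phi>_nat_pow[OF part_carrier[OF y(1)], of p i] y a by (simp add: single_def)
        moreover obtain m n where n: "n > 0" "\<And>p. Factorial_Ring.prime p \<Longrightarrow> p dvd n \<Longrightarrow> p \<in> \<sigma> i"
            "\<phi> y i = of_int m / of_nat n"
          using part_coord[OF i y(1)] by (rule ZsE) blast
        ultimately have "(of_int (int n) :: rat) = of_int (int p * m)" by (simp add: field_simps)
        then have "int n = int p * m" by linarith
        then have "p dvd n" by (metis dvd_triv_left of_nat_dvd_iff)
        then show False using n p False by blast
      qed
      then have "height (G\<lparr>carrier := part i\<rparr>) p ?a = 0"
        by (metis ileI1 linorder_not_le not_gr_zero one_eSuc one_enat_def)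
      then show ?thesis using False by (simp add: characteristic_def)
    qed
  next
    case False
    then show ?thesis using primes[OF i] by (auto simp: characteristic_def)
  qed
  then have "characteristic (G\<lparr>carrier := part i\<rparr>) ?a = (\<lambda>p. if p \<in> \<sigma> i then \<infinity> else 0)" by blast
  then show ?thesis using P.rank1_type_eq[of ?a] a a1 by (simp add: itype_def)
qed

lemma prod_coord:
  assumes f: "\<And>i. i \<in> I \<Longrightarrow> f (part i) \<in> part i" and j: "j \<in> I"
  shows "\<phi> (\<Otimes>A\<in>part ` I. f A) j = \<phi> (f (part j)) j"
proof -
  have "\<phi> (\<Otimes>A\<in>part ` I. f A) = (\<Sum>A\<in>part ` I. \<phi> (f A))"
    using f part_carrier finI by (intro embed_finprod[OF comm_group_axioms \<phi>_mult]) auto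
  also have "\<dots> = (\<Sum>i\<in>I. \<phi> (f (part i)))" by (simp add: sum.reindex[OF inj_part])
  finally have "\<phi> (\<Otimes>A\<in>part ` I. f A) j = (\<Sum>i\<in>I. \<phi> (f (part i)) j)" by (simp add: sum_fun_apply)
  also have "\<dots> = (\<Sum>i\<in>I. if i = j then \<phi> (f (part j)) j else 0)"
    using f by (intro sum.cong) (auto simp: part_def)
  finally show ?thesis using finI j by simp
qed

lemma dec_L: "rank1_decomposition G L (part ` I)"
proof -
  have "bij_betw (\<lambda>f. \<Otimes>A\<in>part ` I. f A) (\<Pi>\<^sub>E A\<in>part ` I. A) L"
    unfolding bij_betw_def
  proof (intro conjI equalityI subsetI inj_onI)
    fix f g assume fg: "f \<in> (\<Pi>\<^sub>E A\<in>part ` I. A)" "g \<in> (\<Pi>\<^sub>E A\<in>part ` I. A)"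
      "(\<Otimes>A\<in>part ` I. f A) = (\<Otimes>A\<in>part ` I. g A)"
    have m: "f (part i) \<in> part i" "g (part i) \<in> part i" if "i \<in> I" for i using fg that by auto
    show "f = g"
    proof (rule PiE_ext[OF fg(1,2)])
      fix A assume "A \<in> part ` I"
      then obtain i where i: "i \<in> I" "A = part i" by blast
      have "\<phi> (f (part i)) i = \<phi> (g (part i)) i"
        using prod_coord[of f, OF m(1) i(1)] prod_coord[of g, OF m(2) i(1)] fg(3) by simp
      then have "\<phi> (f A) j = \<phi> (g A) j" for j
        using m[OF i(1)] i by (cases "j = i") (auto simp: part_def)
      then show "f A = g A" using m[OF i(1)] i part_carrier by (intro \<phi>_eqD) auto
    qed
  next
    fix x assume "x \<in> (\<lambda>f. \<Otimes>A\<in>part ` I. f A) ` (\<Pi>\<^sub>E A\<in>part ` I. A)"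
    then obtain f where f: "f \<in> (\<Pi>\<^sub>E A\<in>part ` I. A)" "x = (\<Otimes>A\<in>part ` I. f A)" by blast
    show "x \<in> L"
      unfolding f(2) using f(1) part_L finI by (intro finprod_in_subgroup[OF subgroup_L]) auto
  next
    fix x assume x: "x \<in> L"
    then have xc: "x \<in> carrier G" "\<phi> x \<in> lat I \<sigma>" by (auto simp: L_def)
    define f where "f = (\<lambda>A\<in>part ` I. el (single (inv_into I part A) (\<phi> x (inv_into I part A))))"
    have fi: "f (part i) = el (single i (\<phi> x i))" if "i \<in> I" for i
      using that inv_into_f_f[OF inj_part] by (auto simp: f_def)
    have fm: "f (part i) \<in> part i" "\<phi> (f (part i)) = single i (\<phi> x i)" if "i \<in> I" for i
      unfolding fi[OF that] using single_part[OF that latD(1)[OF xc(2) that]] by auto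
    have fP: "f \<in> (\<Pi>\<^sub>E A\<in>part ` I. A)" using fm by (auto simp: f_def)
    have "(\<Otimes>A\<in>part ` I. f A) \<in> carrier G" using fm part_carrier by (intro finprod_closed) auto
    then have "x = (\<Otimes>A\<in>part ` I. f A)"
    proof (intro \<phi>_eqD xc)
      fix j
      assume c: "(\<Otimes>A\<in>part ` I. f A) \<in> carrier G"
      show "\<phi> x j = \<phi> (\<Otimes>A\<in>part ` I. f A) j"
      proof (cases "j \<in> I")
        case True
        then show ?thesis using prod_coord[of f, OF fm(1) True] fm(2)[OF True] by (simp add: single_def)
      next
        case False
        then show ?thesis using \<phi>_supp c xc by simp
      qed
    qed
    then show "x \<in> (\<lambda>f. \<Otimes>A\<in>part ` I. f A) ` (\<Pi>\<^sub>E A\<in>part ` I. A)" using fP by blast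
  qed
  then show ?thesis
    using finI subgroup_part rank_part by (auto simp: rank1_decomposition_def)
qed

definition block :: "nat set \<Rightarrow> 'a set" where
  "block S = {x \<in> L. \<forall>i\<in>I. \<sigma> i \<noteq> S \<longrightarrow> \<phi> x i = 0}"

lemma block_root:
  assumes x: "x \<in> block S" and p: "p \<in> S" "Factorial_Ring.prime p"
  shows "\<exists>y\<in>block S. y [^] (p ^ n) = x"
proof -
  have xc: "x \<in> carrier G" "\<phi> x \<in> lat I \<sigma>" "\<And>i. i \<in> I \<Longrightarrow> \<sigma> i \<noteq> S \<Longrightarrow> \<phi> x i = 0"
    using x by (auto simp: block_def L_def)
  let ?f = "\<lambda>i. \<phi> x i / of_nat (p ^ n)"
  have f: "?f \<in> lat I \<sigma>"
  proof (rule latI)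
    fix i assume i: "i \<in> I"
    show "?f i \<in> Zs (\<sigma> i)"
      using xc(3)[OF i] Zs_divide_prime_power[OF latD(1)[OF xc(2) i], of p n] p by (cases "\<sigma> i = S") auto
  qed (use xc \<phi>_supp in auto)
  define y where "y = el ?f"
  have y: "y \<in> L" "y \<in> carrier G" "\<And>i. \<phi> y i = \<phi> x i / of_nat (p ^ n)"
    using el_L[OF f] \<phi>_el_lat[OF f] by (simp_all only: y_def) (simp add: L_def)
  have "y \<in> block S" using y xc(3) by (simp add: block_def)
  moreover have "y [^] (p ^ n) = x"
    using y xc p by (intro \<phi>_eqD) (auto simp: \<phi>_nat_pow prime_gt_0_nat)
  ultimately show ?thesis by blast
qed

end

section \<open>The regulator in pure coordinates\<close>

locale pure_coord = coord +
  assumes antichain: "\<And>i j. i \<in> I \<Longrightarrow> j \<in> I \<Longrightarrow> \<sigma> i \<subseteq> \<sigma> j \<Longrightarrow> \<sigma> i = \<sigma> j"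
    and pure: "pure_data I \<sigma> d"
begin

text \<open>For \<open>i\<close> outside the block, incomparability supplies a prime in
  \<open>S\<close> but not in \<open>\<sigma> i\<close>, and infinite divisibility by it forces this
  coordinate to be 0. Purity then puts the element into \<open>L\<close>. The left side does not
  mention coordinates, which is what makes blocks recognizable in other decompositions and in
  products.\<close>

lemma divis_eq_block:
  assumes S: "S \<in> \<sigma> ` I" shows "divis G S = block S"
proof (intro equalityI subsetI)
  fix x assume x: "x \<in> divis G S"
  then have xc: "x \<in> carrier G" by (simp add: divis_def)
  obtain N :: nat where N: "N > 0" "\<And>x. x \<in> carrier G \<Longrightarrow> x [^] N \<in> L" using exponent by blast
  have z: "\<phi> x i = 0" if i: "i \<in> I" "\<sigma> i \<noteq> S" for i
  proof -
    obtain p where p: "p \<in> S" "p \<notin> \<sigma> i" using antichain[of _ i] S i by blast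
    have pp: "Factorial_Ring.prime p" using S p primes by blast
    have "(of_nat N * \<phi> x i) / of_nat (p ^ n) \<in> Zs (\<sigma> i)" for n
    proof -
      obtain y where y: "y \<in> carrier G" "y [^] (p ^ n) = x" using x p by (auto simp: divis_def)
      have "\<phi> (y [^] N) i \<in> Zs (\<sigma> i)" using latD(1)[of "\<phi> (y [^] N)" I \<sigma> i] N(2)[OF y(1)] i(1) by (simp add: L_def)
      moreover have "\<phi> (y [^] N) i = (of_nat N * \<phi> x i) / of_nat (p ^ n)"
        using y pp by (auto simp: \<phi>_nat_pow prime_gt_0_nat)
      ultimately show ?thesis by simp
    qed
    from Zs_divisible_imp_0[OF pp p(2) this] show ?thesis using N by simp
  qed
  have "\<phi> x \<in> carrier (lattice_group I \<sigma> d)" using xc \<phi>_img by blast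
  then obtain t where t: "(\<lambda>i. \<phi> x i - of_int t * d i) \<in> lat I \<sigma>" by (auto simp: carrier_lattice_group_iff)
  have "of_int t * d i \<in> Zs (\<sigma> i)" if "i \<in> I" "\<sigma> i \<noteq> S" for i
    using Zs_uminus[OF latD(1)[OF t that(1)]] z[OF that] by simp
  then have td: "of_int t * d i \<in> Zs (\<sigma> i)" if "i \<in> I" for i
    using pure S that unfolding pure_data_def by blast
  have "\<phi> x \<in> lat I \<sigma>"
  proof (rule latI)
    fix i assume i: "i \<in> I"
    show "\<phi> x i \<in> Zs (\<sigma> i)" using Zs_add[OF latD(1)[OF t i] td[OF i]] by simp
  qed (use xc \<phi>_supp in auto)
  then show "x \<in> block S" using xc z by (auto simp: block_def L_def)
next
  fix x assume x: "x \<in> block S"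
  have "\<exists>y\<in>carrier G. y [^] (p ^ n) = x" if p: "p \<in> S" for p n
    using block_root[OF x p, of n] primes S p by (auto simp: block_def L_def)
  then show "x \<in> divis G S" using x by (auto simp: divis_def block_def L_def)
qed

sublocale dL: decomp G L "part ` I"
  using dec_L by unfold_locales

lemma Reg_eq_L: "Reg G = L"
proof (rule dL.Reg_eq[OF finite_index])
  fix A assume "A \<in> part ` I"
  then obtain i where i: "i \<in> I" "A = part i" by blast
  have "divis G (\<sigma> i) \<subseteq> L" using i by (subst divis_eq_block) (auto simp: block_def)
  then show "\<exists>S. rank1_type (G\<lparr>carrier := A\<rparr>) = itype S \<and> divis G S \<subseteq> L" using type_part i by blast
qed

lemma critical_type:
  assumes "\<tau> \<in> critical_types G \<D>"
  shows "\<exists>A\<in>\<D>. rank1_type (G\<lparr>carrier := A\<rparr>) = \<tau>"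
proof (rule ccontr)
  assume "\<not> ?thesis"
  then have e: "{A \<in> \<D>. rank1_type (G\<lparr>carrier := A\<rparr>) = \<tau>} = {}" by blast
  have "Reg_part G \<D> \<tau> = generate G {}" unfolding Reg_part_def e by simp
  then show False using assms by (simp add: critical_types_def generate_empty)
qed

lemma critical_types_part: "critical_types G (part ` I) \<subseteq> (\<lambda>i. itype (\<sigma> i)) ` I"
  using critical_type[of _ "part ` I"] type_part by fastforce

lemma class_A0: "class_A0 G"
proof -
  have rank: "group_rank G = enat (card I)"
  proof (rule group_rank_embed)
    show "\<exists>x\<in>carrier G. \<exists>c. c \<noteq> 0 \<and> \<phi> x = (\<lambda>j. if j = i then c else 0)" if "i \<in> I" for i
      using single_part[OF that Zs_1] part_carrier
      by (intro bexI[of _ "el (single i 1)"] exI[of _ 1]) (auto simp: single_def)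
  qed (auto intro: comm_group_axioms \<phi>_mult \<phi>_inj finI \<phi>_supp)
  have "L \<in> cd_finite_index G"
    using dec_L subgroup_L finite_index by (auto simp: cd_finite_index_def completely_decomposable_in_def)
  then have acd: "almost_completely_decomposable G"
    using comm_group_axioms tf rank by (auto simp: almost_completely_decomposable_def)
  have "\<sigma>' = \<tau>" if ct: "\<sigma>' \<in> critical_types G (part ` I)" "\<tau> \<in> critical_types G (part ` I)"
    and le: "type_le \<sigma>' \<tau>" for \<sigma>' \<tau>
  proof -
    obtain i j where ij: "i \<in> I" "j \<in> I" "\<sigma>' = itype (\<sigma> i)" "\<tau> = itype (\<sigma> j)"
      using ct critical_types_part by blast
    then have "\<sigma> i \<subseteq> \<sigma> j" using le type_le_itype_iff[of "\<sigma> i" "\<sigma> j"] primes by blast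
    then show ?thesis using antichain[OF ij(1,2)] ij(3,4) by simp
  qed
  then have "block_rigid G" using dec_L Reg_eq_L unfolding block_rigid_def by metis
  moreover have "of_ring_type G"
    unfolding of_ring_type_def
  proof (intro exI[of _ "part ` I"] conjI ballI)
    fix \<tau> assume "\<tau> \<in> critical_types G (part ` I)"
    then obtain i where "i \<in> I" "\<tau> = itype (\<sigma> i)" using critical_types_part by blast
    then show "idempotent_type \<tau>" using idempotent_itype primes by blast
  qed (simp add: Reg_eq_L dec_L)
  ultimately show ?thesis using acd cyclic_quotient by (simp add: class_A0_def Reg_eq_L)
qed

lemma subgroup_block: "subgroup (block S) G"
proof (rule subgroupI)
  show "block S \<subseteq> carrier G" by (auto simp: block_def L_def)
  have "\<one> \<in> block S" using subgroup.one_closed[OF subgroup_L] by (simp add: block_def \<phi>_one)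
  then show "block S \<noteq> {}" by blast
  show "inv x \<in> block S" if "x \<in> block S" for x
    using that subgroup.m_inv_closed[OF subgroup_L] subgroup.mem_carrier[OF subgroup_L]
    by (simp add: block_def \<phi>_inv)
  show "x \<otimes> y \<in> block S" if "x \<in> block S" "y \<in> block S" for x y
    using that subgroup.m_closed[OF subgroup_L] subgroup.mem_carrier[OF subgroup_L]
    by (simp add: block_def \<phi>_mult)
qed

lemma rank_block: "group_rank (G\<lparr>carrier := block S\<rparr>) = enat (card {i \<in> I. \<sigma> i = S})"
proof (rule group_rank_embed)
  show "comm_group (G\<lparr>carrier := block S\<rparr>)"
    using tf_subgroup[OF subgroup_block] by (simp add: tf_group_def)
  show "inj_on \<phi> (carrier (G\<lparr>carrier := block S\<rparr>))"
    using \<phi>_inj by (rule inj_on_subset) (auto simp: block_def L_def)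
  show "\<exists>x\<in>carrier (G\<lparr>carrier := block S\<rparr>). \<exists>c. c \<noteq> 0 \<and> \<phi> x = (\<lambda>j. if j = i then c else 0)"
    if i: "i \<in> {i \<in> I. \<sigma> i = S}" for i
  proof -
    have "i \<in> I" using i by blast
    note s = single_part[OF this Zs_1]
    have "el (single i 1) \<in> block S" using s i by (auto simp: block_def part_def single_def)
    then show ?thesis using s by (intro bexI[of _ "el (single i 1)"] exI[of _ 1]) (auto simp: single_def)
  qed
  show "\<phi> x i = 0" if "x \<in> carrier (G\<lparr>carrier := block S\<rparr>)" "i \<notin> {i \<in> I. \<sigma> i = S}" for x i
    using that \<phi>_supp[of x i] by (cases "i \<in> I") (auto simp: block_def L_def)
qed (auto simp: finI \<phi>_mult block_def L_def)

context
  fixes \<D> assumes dec: "rank1_decomposition G (Reg G) \<D>"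
begin

interpretation D: decomp G L \<D>
  using dec Reg_eq_L by unfold_locales simp

text \<open>Both decompositions are of the same subgroup, so \<open>decomp_types_subset\<close>
  applies with exponent 1.\<close>

lemma type_in_decomposition:
  assumes "A \<in> \<D>" shows "\<exists>i\<in>I. rank1_type (G\<lparr>carrier := A\<rparr>) = itype (\<sigma> i)"
proof -
  have "\<exists>B\<in>part ` I. rank1_type (G\<lparr>carrier := B\<rparr>) = rank1_type (G\<lparr>carrier := A\<rparr>)"
    by (rule decomp_types_subset[OF D.decomp_axioms dL.decomp_axioms, of 1]) (use assms D.C_carrier in auto)
  then show ?thesis using type_part by auto
qed

lemma part_in_divis:
  assumes A: "A \<in> \<D>" "rank1_type (G\<lparr>carrier := A\<rparr>) = itype S" shows "A \<subseteq> divis G S"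
proof
  fix x assume x: "x \<in> A"
  interpret A: rank1_group "G\<lparr>carrier := A\<rparr>" by (rule D.rank1_part[OF A(1)])
  have "\<exists>y\<in>carrier G. y [^] (p ^ n) = x" if "p \<in> S" for p n
    using A.itype_divisible[OF A(2), of x p n] that x D.part_carrier[OF A(1)]
    by (auto simp: nat_pow_consistent[symmetric])
  then show "x \<in> divis G S" using x D.part_carrier[OF A(1)] by (auto simp: divis_def)
qed

text \<open>Projections of \<open>\<D>\<close> preserve divisibility, so they map the block of
  \<open>S\<close> into itself. A summand lies in the block of its own type, and different blocks
  share only \<one>; hence an element of the block has nontrivial components only in summands of
  type \<open>itype S\<close>.\<close>

lemma Reg_part_eq:
  assumes S: "S \<in> \<sigma> ` I" shows "Reg_part G \<D> (itype S) = block S"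
proof (intro equalityI subsetI)
  have "\<Union>{A \<in> \<D>. rank1_type (G\<lparr>carrier := A\<rparr>) = itype S} \<subseteq> block S"
    using part_in_divis divis_eq_block[OF S] by blast
  then show "x \<in> block S" if "x \<in> Reg_part G \<D> (itype S)" for x
    using that generate_subgroup_incl[OF _ subgroup_block] unfolding Reg_part_def by blast
  fix x assume x: "x \<in> block S"
  have xL: "x \<in> L" using x by (simp add: block_def)
  let ?U = "\<Union>{A \<in> \<D>. rank1_type (G\<lparr>carrier := A\<rparr>) = itype S}"
  have U: "?U \<subseteq> carrier G" using D.part_carrier by blast
  have "D.pr x A \<in> generate G ?U" if A: "A \<in> \<D>" for A
  proof (cases "D.pr x A = \<one>")
    case True
    then show ?thesis by (simp add: generate.one)
  next
    case False
    obtain i where i: "i \<in> I" "rank1_type (G\<lparr>carrier := A\<rparr>) = itype (\<sigma> i)"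
      using type_in_decomposition[OF A] by blast
    have pc: "D.pr x A \<in> carrier G" by (rule D.pr_carrier[OF xL A])
    have "D.pr x A \<in> divis G S"
      unfolding divis_def
    proof (intro CollectI conjI ballI allI)
      fix p n assume p: "p \<in> S"
      obtain y where y: "y \<in> block S" "y [^] (p ^ n) = x" using block_root[OF x p] primes S p by blast
      have "D.pr y A [^] (p ^ n) = D.pr x A" using D.pr_nat_pow[OF A, of y "p ^ n"] y by (simp add: block_def)
      moreover have "D.pr y A \<in> carrier G" using D.pr_carrier[OF _ A] y by (simp add: block_def)
      ultimately show "\<exists>z\<in>carrier G. z [^] (p ^ n) = D.pr x A" by blast
    qed (rule pc)
    then have 1: "D.pr x A \<in> block S" using divis_eq_block[OF S] by simp
    have 2: "D.pr x A \<in> block (\<sigma> i)"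
      using part_in_divis[OF A i(2)] D.pr_mem[OF xL A] divis_eq_block i(1) by blast
    obtain j where j: "\<phi> (D.pr x A) j \<noteq> 0"
      using False \<phi>_eqD[OF pc one_closed] by (auto simp: \<phi>_one)
    have "j \<in> I" using j \<phi>_supp[OF pc] by blast
    then have "\<sigma> j = S" "\<sigma> j = \<sigma> i" using 1 2 j by (auto simp: block_def)
    then show ?thesis using i A D.pr_mem[OF xL A] by (intro generate.incl) auto
  qed
  then have "(\<Otimes>A\<in>\<D>. D.pr x A) \<in> generate G ?U"
    by (intro finprod_in_subgroup generate_is_subgroup U D.fin)
  then show "x \<in> Reg_part G \<D> (itype S)" using D.prod_pr[OF xL] by (simp add: Reg_part_def)
qed

lemma rank_critical:
  assumes "\<tau> \<in> critical_types G \<D>"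
  shows "\<exists>S\<in>\<sigma> ` I. group_rank (G\<lparr>carrier := Reg_part G \<D> \<tau>\<rparr>) = enat (card {i \<in> I. \<sigma> i = S})"
proof -
  obtain A where A: "A \<in> \<D>" "rank1_type (G\<lparr>carrier := A\<rparr>) = \<tau>" using critical_type[OF assms] by blast
  then obtain i where i: "i \<in> I" "\<tau> = itype (\<sigma> i)" using type_in_decomposition by blast
  then show ?thesis using Reg_part_eq rank_block by auto
qed

text \<open>Complements \<open>rank_critical\<close>: every block shows up as a critical type, so a
  condition on critical types reaches all blocks.\<close>

lemma critical_rank:
  assumes S: "S \<in> \<sigma> ` I"
  shows "itype S \<in> critical_types G \<D>"
    "group_rank (G\<lparr>carrier := Reg_part G \<D> (itype S)\<rparr>) = enat (card {i \<in> I. \<sigma> i = S})"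
proof -
  obtain i where i: "i \<in> I" "S = \<sigma> i" using S by blast
  note s = single_part[OF i(1) Zs_1]
  have "el (single i 1) \<in> block S" using s i by (auto simp: block_def part_def single_def)
  moreover have "el (single i 1) \<noteq> \<one>"
  proof
    assume "el (single i 1) = \<one>"
    then have "single i 1 i = 0" using s \<phi>_one by (metis zero_fun_apply)
    then show False by (simp add: single_def)
  qed
  ultimately show "itype S \<in> critical_types G \<D>"
    using Reg_part_eq[OF S] by (auto simp: critical_types_def)
  show "group_rank (G\<lparr>carrier := Reg_part G \<D> (itype S)\<rparr>) = enat (card {i \<in> I. \<sigma> i = S})"
    using Reg_part_eq[OF S] rank_block by simp
qed

end

end

section \<open>Coordinates for almost completely decomposable groups\<close>

context rank1_group
begin

context
  fixes a assumes a: "a \<in> carrier G" "a \<noteq> \<one>"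
begin

definition ratio :: "'a \<Rightarrow> rat" where
  "ratio x = (THE q. \<exists>(m::int) (n::int). n \<noteq> 0 \<and> x [^] n = a [^] m \<and> q = of_int m / of_int n)"

text \<open>Two relations between \<open>x\<close> and \<open>a\<close> give
  \<open>m * n' = m' * n\<close>, since \<open>a\<close> has infinite order; so the quotient is well
  defined.\<close>

lemma ratio_eqI:
  assumes x: "x \<in> carrier G" and n: "n \<noteq> 0" "x [^] (n::int) = a [^] (m::int)"
  shows "ratio x = of_int m / of_int n"
  unfolding ratio_def
proof (rule the_equality)
  show "\<exists>(m'::int) (n'::int). n' \<noteq> 0 \<and> x [^] n' = a [^] m' \<and> (of_int m / of_int n :: rat) = of_int m' / of_int n'"
    using n by blast
  fix q :: rat assume "\<exists>(m'::int) (n'::int). n' \<noteq> 0 \<and> x [^] n' = a [^] m' \<and> q = of_int m' / of_int n'"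
  then obtain m' n' :: int where m': "n' \<noteq> 0" "x [^] n' = a [^] m'" "q = of_int m' / of_int n'" by blast
  have "a [^] (m * n') = (x [^] n) [^] n'" using n(2) a by (simp add: int_pow_pow)
  also have "\<dots> = (x [^] n') [^] n" using x by (simp add: int_pow_pow mult.commute)
  also have "\<dots> = a [^] (m' * n)" using m'(2) a by (simp add: int_pow_pow)
  finally have "m * n' = m' * n" by (rule int_pow_eqD[OF a])
  then have "(of_int m * of_int n' :: rat) = of_int m' * of_int n" by (metis of_int_mult)
  then show "q = of_int m / of_int n" using m'(1,3) n(1) by (simp add: frac_eq_eq)
qed

lemma ratio_ex:
  assumes "x \<in> carrier G" shows "\<exists>(m::int) (n::int). n \<noteq> 0 \<and> x [^] n = a [^] m \<and> ratio x = of_int m / of_int n"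
proof -
  obtain m n :: int where mn: "n \<noteq> 0" "a [^] m = x [^] n"
    using dependent_nz[OF a(1) assms a(2)] by blast
  then show ?thesis using ratio_eqI[OF assms mn(1), of m] by (intro exI[of _ m] exI[of _ n]) simp
qed

lemma ratio_mult:
  assumes "x \<in> carrier G" "y \<in> carrier G" shows "ratio (x \<otimes> y) = ratio x + ratio y"
proof -
  obtain m n :: int where x: "n \<noteq> 0" "x [^] n = a [^] m" "ratio x = of_int m / of_int n"
    using ratio_ex[OF assms(1)] by blast
  obtain m' n' :: int where y: "n' \<noteq> 0" "y [^] n' = a [^] m'" "ratio y = of_int m' / of_int n'"
    using ratio_ex[OF assms(2)] by blast
  have "(x \<otimes> y) [^] (n * n') = (x [^] n) [^] n' \<otimes> (y [^] n') [^] n"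
    using assms by (simp add: int_pow_distrib int_pow_pow mult.commute)
  also have "\<dots> = a [^] (m * n' + m' * n)"
    unfolding x(2) y(2) using a by (simp add: int_pow_pow int_pow_mult)
  finally have "ratio (x \<otimes> y) = of_int (m * n' + m' * n) / of_int (n * n')"
    using assms x y by (intro ratio_eqI) auto
  then show ?thesis using x(1,3) y(1,3) by (simp add: add_frac_eq)
qed

lemma inj_ratio: "inj_on ratio (carrier G)"
proof (rule inj_onI)
  fix x y assume xy: "x \<in> carrier G" "y \<in> carrier G" "ratio x = ratio y"
  obtain m n :: int where x: "n \<noteq> 0" "x [^] n = a [^] m" "ratio x = of_int m / of_int n"
    using ratio_ex[OF xy(1)] by blast
  obtain m' n' :: int where y: "n' \<noteq> 0" "y [^] n' = a [^] m'" "ratio y = of_int m' / of_int n'"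
    using ratio_ex[OF xy(2)] by blast
  have "(of_int (m * n') :: rat) = of_int (m' * n)" using x y xy(3) by (simp add: field_simps)
  then have e: "m * n' = m' * n" by linarith
  have "x [^] (n * n') = (x [^] n) [^] n'" using xy by (simp add: int_pow_pow)
  also have "\<dots> = a [^] (m' * n)" unfolding x(2) using a e by (simp add: int_pow_pow)
  also have "\<dots> = (y [^] n') [^] n" unfolding y(2) using a by (simp add: int_pow_pow)
  also have "\<dots> = y [^] (n * n')" using xy by (simp add: int_pow_pow mult.commute)
  finally show "x = y" using int_pow_cancel[of x y "n * n'"] xy x y by simp
qed

text \<open>A fraction in lowest terms is a coordinate only if \<open>a\<close> has a
  \<open>p\<close>-th root for each prime \<open>p\<close> in the denominator, and the
  characteristic of \<open>a\<close> allows this just for \<open>p \<in> S\<close>. Conversely,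
  \<open>a\<close> has roots of all orders built from such primes.\<close>

lemma ratio_image:
  assumes ch: "characteristic G a = (\<lambda>p. if p \<in> S then \<infinity> else 0)"
    and S: "\<And>p. p \<in> S \<Longrightarrow> Factorial_Ring.prime p"
  shows "ratio ` carrier G = Zs S"
proof (intro equalityI subsetI)
  have ht: "height G p a = (if p \<in> S then \<infinity> else 0)" if "Factorial_Ring.prime p" for p
    using fun_cong[OF ch, of p] that by (simp add: characteristic_def)
  {
    fix q assume "q \<in> ratio ` carrier G"
    then obtain x where x: "x \<in> carrier G" "q = ratio x" by blast
    obtain m n :: int where mn: "n \<noteq> 0" "x [^] n = a [^] m" "ratio x = of_int m / of_int n"
      using ratio_ex[OF x(1)] by blast
    obtain m' n' :: int where q: "quotient_of q = (m', n')" by (metis surj_pair)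
    have q': "n' > 0" "coprime m' n'" "q = of_int m' / of_int n'"
      using quotient_of_denom_pos[OF q] quotient_of_coprime[OF q] quotient_of_div[OF q] by auto
    have "(of_int (m' * n) :: rat) = of_int (m * n')" using q' x(2) mn by (simp add: field_simps)
    then have e: "m' * n = m * n'" by linarith
    have "(x [^] n') [^] n = (x [^] n) [^] n'" using x by (simp add: int_pow_pow mult.commute)
    also have "\<dots> = (a [^] m') [^] n" unfolding mn(2) using a e by (simp add: int_pow_pow)
    finally have xn: "x [^] n' = a [^] m'" using mn(1) x a int_pow_cancel[of "x [^] n'" "a [^] m'" n] by simp
    show "q \<in> Zs S"
    proof (rule ZsI)
      show "nat n' > 0" using q' by simp
      show "q = of_int m' / of_nat (nat n')" using q' by simp
      fix p assume p: "Factorial_Ring.prime p" "p dvd nat n'"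
      then obtain k where k: "n' = int p * k" using q' by (metis dvd_def int_dvd_int_iff int_nat_eq less_imp_le)
      have "\<not> int p dvd m'"
      proof
        assume "int p dvd m'"
        then have "is_unit (int p)" using coprime_common_divisor[OF q'(2), of "int p"] k by simp
        then show False using p(1) by auto
      qed
      then have "coprime m' (int p)" using prime_imp_coprime[of "int p" m'] p(1) by (simp add: coprime_commute)
      then obtain u v where uv: "u * m' + v * int p = 1"
        using bezout_int[of m' "int p"] by (auto simp: coprime_iff_gcd_eq_1)
      \<comment> \<open>As \<open>n' = p * k\<close>, \<open>x [^] n' = a [^] m'\<close> and
        \<open>u * m' + v * p = 1\<close>, this element is a \<open>p\<close>-th root of
        \<open>a\<close>.\<close>
      have "(x [^] (k * u) \<otimes> a [^] v) [^] int p = (x [^] n') [^] u \<otimes> (a [^] v) [^] int p"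
        using x a k by (simp add: int_pow_distrib int_pow_pow mult_ac)
      also have "\<dots> = a [^] (u * m' + v * int p)"
        unfolding xn using a by (simp add: int_pow_pow int_pow_mult mult.commute)
      finally have "(x [^] (k * u) \<otimes> a [^] v) [^] (p ^ 1) = a" using a uv by (simp add: int_pow_int)
      then have "enat 1 \<le> height G p a" using height_ge_iff[OF a(1), of 1 p] x a by blast
      then show "p \<in> S" using ht[OF p(1)] by (auto simp: zero_enat_def split: if_splits)
    qed
  next
    fix q assume "q \<in> Zs S"
    then obtain m n where mn: "n > 0" "\<And>p. Factorial_Ring.prime p \<Longrightarrow> p dvd n \<Longrightarrow> p \<in> S"
      "q = of_int m / of_nat n" by (rule ZsE) blast
    have "\<exists>y\<in>carrier G. y [^] (\<Prod>p\<in>prime_factors n. p ^ multiplicity p n) = a"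
    proof (rule prod_prime_roots[OF a(1)])
      fix p assume p: "p \<in> prime_factors n"
      then have "height G p a = \<infinity>" using mn(2)[of p] ht[of p] by (auto simp: in_prime_factors_iff)
      then show "\<exists>y\<in>carrier G. y [^] (p ^ multiplicity p n) = a" using height_eq_infinity_iff[OF a(1)] by blast
    qed auto
    then obtain y where y: "y \<in> carrier G" "y [^] n = a"
      using mn(1) prod_prime_factors[of n] by auto
    have "(y [^] m) [^] int n = (y [^] int n) [^] m" using y by (simp add: int_pow_pow mult.commute)
    also have "\<dots> = a [^] m" using y by (simp add: int_pow_int)
    finally have "ratio (y [^] m) = of_int m / of_int (int n)" using mn(1) y by (intro ratio_eqI) auto
    then show "q \<in> ratio ` carrier G" using mn y by (intro image_eqI[of _ _ "y [^] m"]) auto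
  }
qed

end

lemma rank1_coordinate:
  assumes "idempotent_type (rank1_type G)"
  shows "\<exists>S \<kappa>. (\<forall>p\<in>S. Factorial_Ring.prime p) \<and> rank1_type G = itype S \<and>
    (\<forall>x\<in>carrier G. \<forall>y\<in>carrier G. \<kappa> (x \<otimes> y) = \<kappa> x + \<kappa> y) \<and> inj_on \<kappa> (carrier G) \<and> \<kappa> ` carrier G = Zs S"
proof -
  obtain a S where a: "a \<in> carrier G" "a \<noteq> \<one>" "\<And>p. p \<in> S \<Longrightarrow> Factorial_Ring.prime p"
    "rank1_type G = itype S" "characteristic G a = (\<lambda>p. if p \<in> S then \<infinity> else 0)"
    using idempotent_generator[OF assms] by metis
  show ?thesis
    using a ratio_mult[OF a(1,2)] inj_ratio[OF a(1,2)] ratio_image[OF a(1,2) a(5,3)]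
    by (intro exI[of _ S] exI[of _ "ratio a"]) auto
qed

end

section \<open>Coordinates from a decomposition of the regulator\<close>

lemma (in decomp) critical_type_part:
  assumes A: "A \<in> \<D>" shows "rank1_type (G\<lparr>carrier := A\<rparr>) \<in> critical_types G \<D>"
proof -
  interpret A: rank1_group "G\<lparr>carrier := A\<rparr>" by (rule rank1_part[OF A])
  obtain x where "x \<in> A" "x \<noteq> \<one>" using A.nontrivial by auto
  moreover have "x \<in> Reg_part G \<D> (rank1_type (G\<lparr>carrier := A\<rparr>))" if "x \<in> A"
    unfolding Reg_part_def using that A by (intro generate.incl) auto
  ultimately show ?thesis by (auto simp: critical_types_def)
qed

text \<open>The regulator is an intersection of possibly many subgroups, but all of them have the
  same least index, which is therefore a common exponent for all the quotients.\<close>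

lemma (in comm_group) Reg_exponent:
  assumes "cd_finite_index G \<noteq> {}"
  shows "\<exists>N>0::nat. \<forall>x\<in>carrier G. x [^] N \<in> Reg G"
proof -
  let ?n = "\<lambda>C. card (rcosets C)"
  obtain C0 where C0: "C0 \<in> cd_finite_index G" "\<And>C. C \<in> cd_finite_index G \<Longrightarrow> ?n C0 \<le> ?n C"
    using arg_min_nat_lemma[of "\<lambda>C. C \<in> cd_finite_index G" _ ?n] assms by blast
  have cd: "subgroup C G" "finite (rcosets C)" if "C \<in> cd_finite_index G" for C
    using that by (auto simp: cd_finite_index_def completely_decomposable_in_def)
  have "?n C0 > 0" using cd[OF C0(1)] by (auto simp: card_gt_0_iff RCOSETS_def)
  moreover have "x [^] ?n C0 \<in> Reg G" if x: "x \<in> carrier G" for x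
    unfolding Reg_def
  proof (rule InterI, clarify)
    fix C assume C: "C \<in> cd_finite_index G" "\<forall>C'\<in>cd_finite_index G. ?n C \<le> ?n C'"
    then have "?n C = ?n C0" using C0 by (simp add: le_antisym)
    then show "x [^] ?n C0 \<in> C" using index_pow_mem[OF cd[OF C(1)] x] by simp
  qed
  ultimately show ?thesis by blast
qed

text \<open>Block rigidity and ring type each come with a decomposition of their own. Coordinates
  are taken from the one with idempotent types; incomparability is carried over from the other one
  by \<open>decomp_types_subset\<close> with exponent 1. The extra vector is the image of a
  generator of the cyclic quotient.\<close>

lemma class_A0_coord:
  fixes G :: "('a, 'm) monoid_scheme" (structure)
  assumes A0: "class_A0 G"
  shows "\<exists>(I :: 'a set set) \<sigma> d \<phi>. coord G I \<sigma> d \<phi> \<and>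
    (\<forall>i\<in>I. \<forall>j\<in>I. \<sigma> i \<subseteq> \<sigma> j \<longrightarrow> \<sigma> i = \<sigma> j)"
proof -
  have acd: "comm_group G" "torsion_free G" "cd_finite_index G \<noteq> {}"
    using A0 by (auto simp: class_A0_def almost_completely_decomposable_def)
  interpret comm_group G by fact
  interpret tf_group G by unfold_locales fact
  obtain \<D>1 where D1: "rank1_decomposition G (Reg G) \<D>1"
    "\<forall>\<sigma>\<in>critical_types G \<D>1. \<forall>\<tau>\<in>critical_types G \<D>1. type_le \<sigma> \<tau> \<longrightarrow> \<sigma> = \<tau>"
    using A0 by (auto simp: class_A0_def block_rigid_def)
  obtain \<D> where D2: "rank1_decomposition G (Reg G) \<D>" "\<forall>\<tau>\<in>critical_types G \<D>. idempotent_type \<tau>"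
    using A0 by (auto simp: class_A0_def of_ring_type_def)
  interpret D1: decomp G "Reg G" \<D>1 by unfold_locales (rule D1)
  interpret D: decomp G "Reg G" \<D> by unfold_locales (rule D2)
  obtain N :: nat where N: "N > 0" "\<And>x. x \<in> carrier G \<Longrightarrow> x [^] N \<in> Reg G"
    using Reg_exponent[OF acd(3)] by blast
  have ex: "\<forall>A\<in>\<D>. \<exists>S\<kappa>. (\<forall>p\<in>fst S\<kappa>. Factorial_Ring.prime p) \<and> rank1_type (G\<lparr>carrier := A\<rparr>) = itype (fst S\<kappa>) \<and>
    (\<forall>x\<in>A. \<forall>y\<in>A. snd S\<kappa> (x \<otimes> y) = snd S\<kappa> x + snd S\<kappa> y) \<and> inj_on (snd S\<kappa>) A \<and> snd S\<kappa> ` A = Zs (fst S\<kappa>)"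
  proof
    fix A assume A: "A \<in> \<D>"
    interpret A: rank1_group "G\<lparr>carrier := A\<rparr>" by (rule D.rank1_part[OF A])
    show "\<exists>S\<kappa>. (\<forall>p\<in>fst S\<kappa>. Factorial_Ring.prime p) \<and> rank1_type (G\<lparr>carrier := A\<rparr>) = itype (fst S\<kappa>) \<and>
      (\<forall>x\<in>A. \<forall>y\<in>A. snd S\<kappa> (x \<otimes> y) = snd S\<kappa> x + snd S\<kappa> y) \<and> inj_on (snd S\<kappa>) A \<and> snd S\<kappa> ` A = Zs (fst S\<kappa>)"
      using A.rank1_coordinate D.critical_type_part[OF A] D2(2) by simp
  qed
  from bchoice[OF ex] obtain S\<kappa> where S\<kappa>: "\<forall>A\<in>\<D>. (\<forall>p\<in>fst (S\<kappa> A). Factorial_Ring.prime p) \<and>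
    rank1_type (G\<lparr>carrier := A\<rparr>) = itype (fst (S\<kappa> A)) \<and>
    (\<forall>x\<in>A. \<forall>y\<in>A. snd (S\<kappa> A) (x \<otimes> y) = snd (S\<kappa> A) x + snd (S\<kappa> A) y) \<and> inj_on (snd (S\<kappa> A)) A \<and>
    snd (S\<kappa> A) ` A = Zs (fst (S\<kappa> A))"
    by (rule exE)
  define \<sigma> \<kappa> where "\<sigma> A = fst (S\<kappa> A)" and "\<kappa> A = snd (S\<kappa> A)" for A
  have \<sigma>: "\<And>p. p \<in> \<sigma> A \<Longrightarrow> Factorial_Ring.prime p" "rank1_type (G\<lparr>carrier := A\<rparr>) = itype (\<sigma> A)"
    and \<kappa>: "\<And>x y. x \<in> A \<Longrightarrow> y \<in> A \<Longrightarrow> \<kappa> A (x \<otimes> y) = \<kappa> A x + \<kappa> A y" "inj_on (\<kappa> A) A" "\<kappa> A ` A = Zs (\<sigma> A)"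
    if "A \<in> \<D>" for A
    using bspec[OF S\<kappa> that] by (auto simp: \<sigma>_def \<kappa>_def)
  have \<kappa>_pow: "\<kappa> A (x [^] (n::nat)) = of_nat n * \<kappa> A x" if A: "A \<in> \<D>" "x \<in> A" for A x n
  proof (induction n)
    case 0
    have "\<one> \<in> A" using subgroup.one_closed[OF D.subgr[OF A(1)]] .
    from \<kappa>(1)[OF A(1) this this] show ?case by simp
  next
    case (Suc n)
    have "x [^] n \<in> A" using subgroup_nat_pow_closed[OF D.subgr[OF A(1)] A(2)] .
    from \<kappa>(1)[OF A(1) this A(2)] Suc show ?case by (simp add: algebra_simps)
  qed
  \<comment> \<open>Components exist only inside the regulator, so those of \<open>x [^] N\<close>
    are taken and divided by \<open>N\<close>.\<close>
  define \<phi> where "\<phi> x = (\<lambda>A. if A \<in> \<D> then \<kappa> A (D.pr (x [^] N) A) / of_nat N else 0)" for x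
  have \<phi>_mult: "\<phi> (x \<otimes> y) = \<phi> x + \<phi> y" if "x \<in> carrier G" "y \<in> carrier G" for x y
    using that N(2) D.pr_mem
    by (auto simp: \<phi>_def fun_eq_iff nat_pow_distrib D.pr_mult \<kappa>(1) add_divide_distrib)
  have \<phi>_inj: "inj_on \<phi> (carrier G)"
  proof (rule inj_onI)
    fix x y assume xy: "x \<in> carrier G" "y \<in> carrier G" "\<phi> x = \<phi> y"
    have "D.pr (x [^] N) A = D.pr (y [^] N) A" if A: "A \<in> \<D>" for A
    proof (rule inj_onD[OF \<kappa>(2)[OF A]])
      show "\<kappa> A (D.pr (x [^] N) A) = \<kappa> A (D.pr (y [^] N) A)"
        using fun_cong[OF xy(3), of A] A N(1) by (simp add: \<phi>_def)
    qed (use D.pr_mem[OF N(2) A] xy in auto)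
    then have "(\<Otimes>A\<in>\<D>. D.pr (x [^] N) A) = (\<Otimes>A\<in>\<D>. D.pr (y [^] N) A)"
      using D.pr_carrier N(2) xy by (intro finprod_cong') auto
    then have "x [^] int N = y [^] int N"
      using D.prod_pr[OF N(2)] xy by (simp add: int_pow_int)
    then show "x = y" using int_pow_cancel[of x y "int N"] xy N(1) by simp
  qed
  have \<phi>_Reg: "\<phi> x = (\<lambda>A. if A \<in> \<D> then \<kappa> A (D.pr x A) else 0)" if "x \<in> Reg G" for x
    using that N(1) D.pr_mem[OF that] by (auto simp: \<phi>_def fun_eq_iff D.pr_nat_pow \<kappa>_pow)
  have img_Reg: "\<phi> ` Reg G = lat \<D> \<sigma>"
  proof (intro equalityI subsetI)
    fix f assume "f \<in> \<phi> ` Reg G"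
    then obtain x where x: "x \<in> Reg G" "f = \<phi> x" by blast
    then show "f \<in> lat \<D> \<sigma>" using \<kappa>(3) D.pr_mem[OF x(1)] by (intro latI) (auto simp: \<phi>_Reg)
  next
    fix f assume f: "f \<in> lat \<D> \<sigma>"
    have "\<forall>A\<in>\<D>. \<exists>y\<in>A. \<kappa> A y = f A"
      using \<kappa>(3) latD(1)[OF f] by (metis imageE)
    then obtain y where y: "\<And>A. A \<in> \<D> \<Longrightarrow> y A \<in> A" "\<And>A. A \<in> \<D> \<Longrightarrow> \<kappa> A (y A) = f A" by metis
    have "\<phi> (\<Otimes>A\<in>\<D>. y A) = f"
      using D.pr_prod[of y, OF y(1)] y latD(2)[OF f] by (auto simp: \<phi>_Reg[OF D.prod_in[of y, OF y(1)]] fun_eq_iff)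
    then show "f \<in> \<phi> ` Reg G" using D.prod_in[of y, OF y(1)] by blast
  qed
  have nR: "Reg G \<lhd> G" using D.subgroup_C by (simp add: subgroup_imp_normal)
  interpret nR: normal "Reg G" G by fact
  interpret Q: group "G Mod Reg G" by (rule nR.factorgroup_is_group)
  obtain K where K: "K \<in> carrier (G Mod Reg G)" "carrier (G Mod Reg G) = range (\<lambda>n::int. K [^]\<^bsub>G Mod Reg G\<^esub> n)"
    using A0 Q.cyclic_group by (auto simp: class_A0_def)
  obtain g where g: "g \<in> carrier G" "K = Reg G #> g" using K(1) by (auto simp: FactGroup_def RCOSETS_def)
  have \<phi>_gpow: "\<phi> (r \<otimes> g [^] (t::int)) = \<phi> r + (\<lambda>i. of_int t * \<phi> g i)" if "r \<in> carrier G" for r t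
    using that g \<phi>_mult embed_int_pow[OF is_group \<phi>_mult g(1), of t] by simp
  have img: "\<phi> ` carrier G = carrier (lattice_group \<D> \<sigma> (\<phi> g))"
  proof (intro equalityI subsetI)
    fix f assume "f \<in> \<phi> ` carrier G"
    then obtain x where x: "x \<in> carrier G" "f = \<phi> x" by blast
    have "Reg G #> x \<in> carrier (G Mod Reg G)" using x by (auto simp: FactGroup_def RCOSETS_def)
    then obtain t :: int where t: "Reg G #> x = Reg G #> (g [^] t)"
      using K(2) nR.FactGroup_int_pow[OF g(1)] g(2) by auto
    have "x \<in> Reg G #> (g [^] t)" using rcos_self[OF x(1) D.subgroup_C] t by simp
    then obtain r where r: "r \<in> Reg G" "x = r \<otimes> g [^] t" by (auto simp: r_coset_def)
    then have "f = \<phi> r + (\<lambda>i. of_int t * \<phi> g i)" using x \<phi>_gpow D.C_carrier by simp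
    then show "f \<in> carrier (lattice_group \<D> \<sigma> (\<phi> g))" using r img_Reg unfolding carrier_lattice_group by blast
  next
    fix f assume "f \<in> carrier (lattice_group \<D> \<sigma> (\<phi> g))"
    then obtain h t where h: "h \<in> lat \<D> \<sigma>" "f = h + (\<lambda>i. of_int t * \<phi> g i)" by (auto simp: carrier_lattice_group)
    then obtain r where r: "r \<in> Reg G" "h = \<phi> r" using img_Reg by blast
    then have "f = \<phi> (r \<otimes> g [^] t)" using h \<phi>_gpow D.C_carrier by simp
    then show "f \<in> \<phi> ` carrier G" using r g D.C_carrier by blast
  qed
  have "\<phi> \<in> iso G (lattice_group \<D> \<sigma> (\<phi> g))"
    unfolding iso_def bij_betw_def hom_def using img \<phi>_inj \<phi>_mult by auto
  then have "coord G \<D> \<sigma> (\<phi> g) \<phi>"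
    using \<sigma>(1) D.fin by unfold_locales (auto simp: \<phi>_def)
  moreover have "\<sigma> A = \<sigma> B" if AB: "A \<in> \<D>" "B \<in> \<D>" "\<sigma> A \<subseteq> \<sigma> B" for A B
  proof -
    have "\<exists>B\<in>\<D>1. rank1_type (G\<lparr>carrier := B\<rparr>) = rank1_type (G\<lparr>carrier := A\<rparr>)" if "A \<in> \<D>" for A
      by (rule decomp_types_subset[OF D.decomp_axioms D1.decomp_axioms, of 1]) (use that D.C_carrier in auto)
    then have "itype (\<sigma> A) \<in> critical_types G \<D>1" if "A \<in> \<D>" for A
      using \<sigma>(2)[OF that] that D1.critical_type_part by metis
    moreover have "type_le (itype (\<sigma> A)) (itype (\<sigma> B))"
      using AB \<sigma>(1) type_le_itype_iff[of "\<sigma> A" "\<sigma> B"] by blast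
    ultimately have "itype (\<sigma> A) = itype (\<sigma> B)" using D1(2) AB by blast
    then show ?thesis using itype_inj \<sigma>(1)[OF AB(1)] by blast
  qed
  ultimately show ?thesis by blast
qed

section \<open>Normal form of the coordinates\<close>

definition sparse :: "'i set \<Rightarrow> ('i \<Rightarrow> nat set) \<Rightarrow> ('i \<Rightarrow> rat) \<Rightarrow> bool" where
  "sparse I \<sigma> d \<longleftrightarrow> (\<forall>i\<in>I. \<forall>j\<in>I. i \<noteq> j \<longrightarrow> \<sigma> i = \<sigma> j \<longrightarrow> d i = 0 \<or> d j = 0)"

lemma lattice_group_map:
  assumes add: "\<And>f g. \<psi> (f + g) = \<psi> f + (\<psi> g :: 'j \<Rightarrow> rat)"
    and mult: "\<And>(t::int) f. \<psi> (\<lambda>i. of_int t * f i) = (\<lambda>i. of_int t * \<psi> f i)"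
    and lat: "\<And>f. f \<in> lat I \<sigma> \<Longrightarrow> \<psi> f \<in> carrier (lattice_group J \<rho> e)"
    and d: "\<psi> d \<in> carrier (lattice_group J \<rho> e)"
    and f: "f \<in> carrier (lattice_group I \<sigma> d)"
  shows "\<psi> f \<in> carrier (lattice_group J \<rho> e)"
proof -
  obtain g t where g: "g \<in> lat I \<sigma>" "f = g + (\<lambda>i. of_int t * d i)" using f by (auto simp: carrier_lattice_group)
  have "\<psi> f = \<psi> g + (\<lambda>i. of_int t * \<psi> d i)" unfolding g(2) add mult ..
  also have "\<dots> \<in> carrier (lattice_group J \<rho> e)" by (intro lattice_group_add lat g lattice_group_int_mult d)
  finally show ?thesis .
qed

lemma coord_transform:
  assumes c: "coord G I \<sigma> d \<phi>" and d': "\<And>i. i \<notin> I \<Longrightarrow> d' i = 0"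
    and add: "\<And>f g. \<psi> (f + g) = \<psi> f + \<psi> g" and inv: "\<And>f. \<psi> (\<psi>' f) = f" "\<And>f. \<psi>' (\<psi> f) = f"
    and maps: "\<And>f. f \<in> carrier (lattice_group I \<sigma> d) \<Longrightarrow> \<psi> f \<in> carrier (lattice_group I \<sigma> d')"
      "\<And>f. f \<in> carrier (lattice_group I \<sigma> d') \<Longrightarrow> \<psi>' f \<in> carrier (lattice_group I \<sigma> d)"
  shows "coord G I \<sigma> d' (\<lambda>x. \<psi> (\<phi> x))"
proof -
  interpret coord G I \<sigma> d \<phi> by fact
  have "\<psi> \<in> iso (lattice_group I \<sigma> d) (lattice_group I \<sigma> d')"
    unfolding iso_def
  proof (intro CollectI conjI)
    show "\<psi> \<in> hom (lattice_group I \<sigma> d) (lattice_group I \<sigma> d')" using maps add by (auto simp: hom_def)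
    show "bij_betw \<psi> (carrier (lattice_group I \<sigma> d)) (carrier (lattice_group I \<sigma> d'))"
      by (rule bij_betw_byWitness[of _ \<psi>']) (use inv maps in auto)
  qed
  from iso_set_trans[OF \<phi>_iso this] have "(\<lambda>x. \<psi> (\<phi> x)) \<in> iso G (lattice_group I \<sigma> d')" by (simp add: o_def)
  then show ?thesis
    using finI primes d' by unfold_locales
qed

text \<open>Coordinates of one block take values in the same ring \<open>Zs (\<sigma> i)\<close>, so
  an integral row operation between them preserves the lattice; its inverse uses
  \<open>- c\<close>.\<close>

lemma coord_shear:
  fixes c :: int
  assumes c: "coord G I \<sigma> d \<phi>" and ij: "i \<in> I" "j \<in> I" "i \<noteq> j" "\<sigma> i = \<sigma> j"
  shows "coord G I \<sigma> (d(i := d i + of_int c * d j)) (\<lambda>x. (\<phi> x)(i := \<phi> x i + of_int c * \<phi> x j))"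
proof -
  have maps: "f(i := f i + of_int k * f j) \<in> carrier (lattice_group I \<sigma> (e(i := e i + of_int k * e j)))"
    if f: "f \<in> carrier (lattice_group I \<sigma> e)" for f e and k :: int
  proof (rule lattice_group_map[where \<psi> = "\<lambda>f. f(i := f i + of_int k * f j)", OF _ _ _ _ f])
    fix g assume g: "g \<in> lat I \<sigma>"
    have "g(i := g i + of_int k * g j) \<in> lat I \<sigma>"
      using latD[OF g] latD(1)[OF g ij(1)] latD(1)[OF g ij(2)] ij(1,4)
        by (intro latI) (auto intro!: Zs_add Zs_mult)
    then show "g(i := g i + of_int k * g j) \<in> carrier (lattice_group I \<sigma> (e(i := e i + of_int k * e j)))"
      using lat_subset_lattice_group by blast
  qed (auto simp: fun_eq_iff algebra_simps d_in_lattice_group)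
  have maps_inv: "f(i := f i + of_int (-c) * f j) \<in> carrier (lattice_group I \<sigma> d)"
    if "f \<in> carrier (lattice_group I \<sigma> (d(i := d i + of_int c * d j)))" for f
  proof -
    have "(d(i := d i + of_int c * d j))(i := (d(i := d i + of_int c * d j)) i +
        of_int (-c) * (d(i := d i + of_int c * d j)) j) = d"
      using ij by (auto simp: fun_eq_iff)
    then show ?thesis using maps[OF that, of "-c"] by simp
  qed
  show ?thesis
  proof (rule coord_transform[OF c, where \<psi> = "\<lambda>f. f(i := f i + of_int c * f j)"
        and \<psi>' = "\<lambda>f. f(i := f i + of_int (-c) * f j)"])
    show "\<And>k. k \<notin> I \<Longrightarrow> (d(i := d i + of_int c * d j)) k = 0"
      using ij coord.d_supp[OF c] by auto
    show "f(i := f i + of_int c * f j) \<in> carrier (lattice_group I \<sigma> (d(i := d i + of_int c * d j)))"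
      if "f \<in> carrier (lattice_group I \<sigma> d)" for f by (rule maps[OF that])
    show "f(i := f i + of_int (-c) * f j) \<in> carrier (lattice_group I \<sigma> d)"
      if "f \<in> carrier (lattice_group I \<sigma> (d(i := d i + of_int c * d j)))" for f by (rule maps_inv[OF that])
  qed (use ij in \<open>auto simp: fun_eq_iff algebra_simps\<close>)
qed

text \<open>The induction step is a division step of Euclid's algorithm on two numerators of the same block.\<close>

lemma coord_sparse_aux:
  assumes "coord G I \<sigma> d \<phi>" "m > (0::nat)" "\<And>i. i \<in> I \<Longrightarrow> of_nat m * d i = of_int (w i)"
  shows "\<exists>d' \<phi>'. coord G I \<sigma> d' \<phi>' \<and> sparse I \<sigma> d'"
  using assms(1,3)
proof (induction "\<Sum>i\<in>I. nat \<bar>w i\<bar>" arbitrary: d \<phi> w rule: less_induct)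
  case less
  show ?case
  proof (cases "sparse I \<sigma> d")
    case True
    then show ?thesis using less.prems by blast
  next
    case False
    then obtain i' j' where ij': "i' \<in> I" "j' \<in> I" "i' \<noteq> j'" "\<sigma> i' = \<sigma> j'" "d i' \<noteq> 0" "d j' \<noteq> 0"
      by (auto simp: sparse_def)
    obtain i j where ij: "i \<in> I" "j \<in> I" "i \<noteq> j" "\<sigma> i = \<sigma> j" "d i \<noteq> 0" "d j \<noteq> 0" "\<bar>w j\<bar> \<le> \<bar>w i\<bar>"
    proof (cases "\<bar>w j'\<bar> \<le> \<bar>w i'\<bar>")
      case True
      then show ?thesis using ij' that by blast
    next
      case False
      then show ?thesis using ij' that[of j' i'] by simp
    qed
    have nz: "w i \<noteq> 0" "w j \<noteq> 0"
      using less.prems(2)[of i] less.prems(2)[of j] ij assms(2) by auto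
    \<comment> \<open>One subtraction replaces a full division: the signs move \<open>w i\<close>
      towards 0, and because \<open>\<bar>w j\<bar> \<le> \<bar>w i\<bar>\<close> its absolute value
      drops by exactly \<open>\<bar>w j\<bar>\<close>.\<close>
    define c where "c = - sgn (w i) * sgn (w j)"
    define w' where "w' = w(i := w i + c * w j)"
    have small: "\<bar>w' i\<bar> < \<bar>w i\<bar>"
      using nz ij(7) by (auto simp: w'_def c_def sgn_if abs_if split: if_splits)
    have finI: "finite I" using less.prems(1) by (simp add: coord_def coord_axioms_def)
    have "(\<Sum>k\<in>I. nat \<bar>w' k\<bar>) < (\<Sum>k\<in>I. nat \<bar>w k\<bar>)"
    proof (rule sum_strict_mono_ex1[OF finI])
      show "\<forall>k\<in>I. nat \<bar>w' k\<bar> \<le> nat \<bar>w k\<bar>" using small by (auto simp: w'_def)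
      show "\<exists>k\<in>I. nat \<bar>w' k\<bar> < nat \<bar>w k\<bar>" using small ij(1) nz by (intro bexI[of _ i]) auto
    qed
    then show ?thesis
    proof (rule less.hyps)
      show "coord G I \<sigma> (d(i := d i + of_int c * d j)) (\<lambda>x. (\<phi> x)(i := \<phi> x i + of_int c * \<phi> x j))"
        by (rule coord_shear[OF less.prems(1) ij(1-4)])
      fix k assume k: "k \<in> I"
      show "of_nat m * (d(i := d i + of_int c * d j)) k = of_int (w' k)"
        using less.prems(2)[OF k] less.prems(2)[OF ij(1)] less.prems(2)[OF ij(2)]
        by (simp add: w'_def algebra_simps)
    qed
  qed
qed

lemma coord_sparse:
  assumes c: "coord G I \<sigma> d \<phi>"
  shows "\<exists>d' \<phi>'. coord G I \<sigma> d' \<phi>' \<and> sparse I \<sigma> d'"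
proof -
  have "finite I" using c by (simp add: coord_def coord_axioms_def)
  then obtain m :: nat where m: "m > 0" "\<And>i. i \<in> I \<Longrightarrow> \<exists>k::int. of_nat m * d i = of_int k"
    using common_denominator[of I d] by blast
  have "of_nat m * d i = of_int \<lfloor>of_nat m * d i\<rfloor>" if i: "i \<in> I" for i
  proof -
    obtain k :: int where "of_nat m * d i = of_int k" using m(2)[OF i] by blast
    then show ?thesis by simp
  qed
  from coord_sparse_aux[OF c m(1) this] show ?thesis .
qed

lemma quotient_of_divide_denominator:
  assumes q: "quotient_of x = (s, g * v)" and gv: "g > 0" "v > 0"
  shows "quotient_of (of_int v * x) = (s, g)"
proof -
  have x: "x = of_int s / of_int (g * v)" "coprime s (g * v)"
    using quotient_of_div[OF q] quotient_of_coprime[OF q] by auto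
  have "of_int v * x = Fract s g" using gv unfolding x(1) by (simp add: Fract_of_int_quotient)
  moreover have "coprime s g" using x(2) by simp
  ultimately show ?thesis using gv by (simp add: quotient_of_Fract Rat.normalize_def)
qed

text \<open>
  If purity fails at the coordinate \<open>i\<close>, the group contains \<open>e\<^sub>i / v\<close> for some \<open>v > 1\<close>; replacing
  \<open>e\<^sub>i\<close> by \<open>e\<^sub>i / v\<close> divides the denominator of \<open>d i\<close> by \<open>v\<close>.
\<close>

lemma coord_pure:
  fixes d :: "'i \<Rightarrow> rat"
  assumes "coord G I \<sigma> d \<phi>" "sparse I \<sigma> d"
  shows "\<exists>d' \<phi>'. coord G I \<sigma> d' \<phi>' \<and> sparse I \<sigma> d' \<and> pure_data I \<sigma> d'"
  using assms
proof (induction "\<Sum>i\<in>I. nat (snd (quotient_of (d i)))" arbitrary: d \<phi> rule: less_induct)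
  case less
  interpret coord G I \<sigma> d \<phi> by (rule less.prems(1))
  show ?case
  proof (cases "pure_data I \<sigma> d")
    case True
    then show ?thesis using less.prems by blast
  next
    case False
    then obtain S i and t :: int where S: "\<And>j. j \<in> I \<Longrightarrow> \<sigma> j \<noteq> S \<Longrightarrow> of_int t * d j \<in> Zs (\<sigma> j)"
      and i: "i \<in> I" "of_int t * d i \<notin> Zs (\<sigma> i)"
      unfolding pure_data_def by blast
    have iS: "\<sigma> i = S" using S i by blast
    have "d i \<noteq> 0" using i(2) by auto
    then have others: "d j = 0" if "j \<in> I" "\<sigma> j = S" "j \<noteq> i" for j
      using less.prems(2) that i(1) iS unfolding sparse_def by metis
    obtain s w where q: "quotient_of (d i) = (s, w)" by (metis surj_pair)
    have sw: "w > 0" "coprime s w" "d i = of_int s / of_int w"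
      using quotient_of_denom_pos[OF q] quotient_of_coprime[OF q] quotient_of_div[OF q] by auto
    \<comment> \<open>With these, \<open>t * d i\<close> equals \<open>t' * s / v\<close> in lowest
      terms, so \<open>v\<close> is the denominator by which purity fails at
      \<open>i\<close>.\<close>
    define g where "g = gcd t w"
    define v where "v = w div g"
    define t' where "t' = t div g"
    have g: "g > 0" "w = g * v" "t = g * t'" using sw(1) by (auto simp: g_def v_def t'_def)
    have v: "v > 0" using g sw(1) by (metis zero_less_mult_pos)
    have "v \<noteq> 1"
    proof
      assume "v = 1"
      then have "of_int t * d i = of_int (t' * s)" using g sw by simp
      then show False using i(2) by (metis Zs_of_int)
    qed
    have cop: "coprime (t' * s) v"
    proof -
      have "coprime t' v"
        unfolding t'_def v_def g_def using sw(1) by (intro div_gcd_coprime) simp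
      moreover have "coprime s v" using sw(2) g(2) by simp
      ultimately show ?thesis by simp
    qed
    define \<psi> where "\<psi> = (\<lambda>f :: 'i \<Rightarrow> rat. f(i := of_int v * f i))"
    define \<psi>' where "\<psi>' = (\<lambda>f :: 'i \<Rightarrow> rat. f(i := f i / of_int v))"
    define d' where "d' = \<psi> d"
    \<comment> \<open>Bezout for the numerator \<open>t' * s\<close> and \<open>v\<close>. Since
      \<open>t * d\<close> is integral at all other coordinates, \<open>a * t * d\<close> is the
      vector \<open>e_i / v\<close> up to an element of the lattice.\<close>
    have unit: "\<exists>(a::int) (b::int). 1 / of_int v = of_int a * (of_int t * d i) + of_int b"
    proof -
      obtain a b where ab: "a * (t' * s) + b * v = 1"
        using bezout_int[of "t' * s" v] cop by (auto simp: coprime_iff_gcd_eq_1)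
      have "(of_int a * of_int (t' * s) + of_int b * of_int v :: rat) = 1"
        using arg_cong[OF ab, of "of_int :: int \<Rightarrow> rat"] by simp
      then have "1 / of_int v = (of_int a * of_int (t' * s) + of_int b * of_int v) / (of_int v :: rat)" by simp
      also have "\<dots> = of_int a * (of_int t * d i) + of_int b"
        unfolding sw(3) g(2,3) using v g(1) by (simp add: field_simps)
      finally show ?thesis by blast
    qed
    then obtain a b :: int where ab: "1 / of_int v = of_int a * (of_int t * d i) + of_int b" by blast
    have c': "coord G I \<sigma> d' (\<lambda>x. \<psi> (\<phi> x))"
    proof (rule coord_transform[OF less.prems(1), where \<psi>' = \<psi>'])
      show "d' k = 0" if "k \<notin> I" for k using that i(1) d_supp by (auto simp: d'_def \<psi>_def)
      show "\<psi> f \<in> carrier (lattice_group I \<sigma> d')" if f: "f \<in> carrier (lattice_group I \<sigma> d)" for f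
      proof (rule lattice_group_map[OF _ _ _ _ f])
        fix h assume "h \<in> lat I \<sigma>"
        then have "\<psi> h \<in> lat I \<sigma>" using i(1) by (intro latI) (auto simp: \<psi>_def dest: latD)
        then show "\<psi> h \<in> carrier (lattice_group I \<sigma> d')" using lat_subset_lattice_group by blast
      qed (auto simp: \<psi>_def d'_def d_in_lattice_group fun_eq_iff algebra_simps)
      show "\<psi>' f \<in> carrier (lattice_group I \<sigma> d)" if f: "f \<in> carrier (lattice_group I \<sigma> d')" for f
      proof (rule lattice_group_map[OF _ _ _ _ f])
        have "\<psi>' d' = d" using v by (auto simp: \<psi>_def \<psi>'_def d'_def)
        then show "\<psi>' d' \<in> carrier (lattice_group I \<sigma> d)" using d_in_lattice_group by metis
        fix h assume h: "h \<in> lat I \<sigma>"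
        \<comment> \<open>Modulo \<open>v\<close> the value \<open>h i\<close> is the integer
          \<open>j\<close>, so \<open>h i / v\<close> is \<open>j / v\<close> up to
          \<open>Zs (\<sigma> i)\<close>, and \<open>j * a * t\<close> copies of \<open>d\<close>
          produce it.\<close>
        obtain j y where jy: "y \<in> Zs (\<sigma> i)" "h i = of_int j + of_nat (nat v) * y"
          using Zs_approx[OF latD(1)[OF h i(1)], of "nat v"] v by auto
        have hv: "h i / of_int v = of_int j * (1 / of_int v) + y" using jy v by (simp add: field_simps)
        show "\<psi>' h \<in> carrier (lattice_group I \<sigma> d)"
          unfolding carrier_lattice_group_iff
        proof (intro exI latI)
          fix k assume k: "k \<in> I"
          show "\<psi>' h k - of_int (j * a * t) * d k \<in> Zs (\<sigma> k)"
          proof (cases "k = i")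
            case True
            have "\<psi>' h k - of_int (j * a * t) * d k = of_int (j * b) + y"
              using True hv unfolding ab by (simp add: \<psi>'_def algebra_simps)
            then show ?thesis using Zs_add[OF Zs_of_int jy(1), of "j * b"] True by simp
          next
            case False
            have e: "of_int (j * a * t) * d k = of_int (j * a) * (of_int t * d k)" by simp
            have "of_int (j * a * t) * d k \<in> Zs (\<sigma> k)"
              unfolding e using S[OF k] others[OF k] False by (cases "\<sigma> k = S") (auto intro!: Zs_mult)
            then show ?thesis using latD(1)[OF h k] False by (auto simp: \<psi>'_def)
          qed
        next
          fix k assume "k \<notin> I"
          then show "\<psi>' h k - of_int (j * a * t) * d k = 0"
            using d_supp latD(2)[OF h] i(1) by (auto simp: \<psi>'_def)
        qed
      qed (auto simp: \<psi>'_def fun_eq_iff add_divide_distrib)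
    qed (use v in \<open>auto simp: \<psi>_def \<psi>'_def fun_eq_iff algebra_simps\<close>)
    have sp: "sparse I \<sigma> d'"
      using less.prems(2) by (auto simp: sparse_def d'_def \<psi>_def)
    have qi: "quotient_of (d' i) = (s, g)"
      using quotient_of_divide_denominator[of "d i" s g v] q g v by (simp add: d'_def \<psi>_def)
    have "g < w" using g v \<open>v \<noteq> 1\<close> by (metis less_1_mult linorder_neqE_linordered_idom mult.right_neutral mult_strict_left_mono not_less_iff_gr_or_eq int_one_le_iff_zero_less order_le_less)
    have "(\<Sum>k\<in>I. nat (snd (quotient_of (d' k)))) < (\<Sum>k\<in>I. nat (snd (quotient_of (d k))))"
    proof (rule sum_strict_mono_ex1[OF finI])
      show "\<forall>k\<in>I. nat (snd (quotient_of (d' k))) \<le> nat (snd (quotient_of (d k)))"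
      proof
        fix k
        show "nat (snd (quotient_of (d' k))) \<le> nat (snd (quotient_of (d k)))"
          using qi q \<open>g < w\<close> by (cases "k = i") (auto simp: d'_def \<psi>_def)
      qed
      show "\<exists>k\<in>I. nat (snd (quotient_of (d' k))) < nat (snd (quotient_of (d k)))"
        using i(1) qi q \<open>g < w\<close> g(1) by (intro bexI[of _ i]) auto
    qed
    from less.hyps[OF this c' sp] show ?thesis .
  qed
qed

lemma class_A0_normal_form:
  fixes G :: "('a, 'm) monoid_scheme"
  assumes "class_A0 G"
  shows "\<exists>(I :: 'a set set) \<sigma> d \<phi>. pure_coord G I \<sigma> d \<phi> \<and> sparse I \<sigma> d"
proof -
  obtain I :: "'a set set" and \<sigma> d0 \<phi>0 where 1: "coord G I \<sigma> d0 \<phi>0"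
    "\<forall>i\<in>I. \<forall>j\<in>I. \<sigma> i \<subseteq> \<sigma> j \<longrightarrow> \<sigma> i = \<sigma> j"
    using class_A0_coord[OF assms] by blast
  obtain d1 \<phi>1 where 2: "coord G I \<sigma> d1 \<phi>1" "sparse I \<sigma> d1" using coord_sparse[OF 1(1)] by blast
  obtain d \<phi> where 3: "coord G I \<sigma> d \<phi>" "sparse I \<sigma> d" "pure_data I \<sigma> d" using coord_pure[OF 2] by blast
  then have "pure_coord G I \<sigma> d \<phi>" using 1(2) by (simp add: pure_coord_def pure_coord_axioms_def)
  then show ?thesis using 3(2) by blast
qed

section \<open>Multiplications as bilinear maps\<close>

locale tensor = G: comm_group G + H: comm_group H for G :: "('a, 'm) monoid_scheme" and H :: "('b, 'n) monoid_scheme"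
begin

abbreviation "F \<equiv> free_Abelian_group (carrier G \<times> carrier H)"
abbreviation "R \<equiv> generate F (tensor_relations G H)"
abbreviation "T \<equiv> tensor_product G H"

definition tens :: "'a \<Rightarrow> 'b \<Rightarrow> (('a \<times> 'b) \<Rightarrow>\<^sub>0 int) set" where
  "tens x y = R #>\<^bsub>F\<^esub> frag_of (x, y)"

lemma T_eq: "T = F Mod R"
  by (simp add: tensor_product_def Let_def)

lemma tensor_relation_cases:
  assumes "u \<in> tensor_relations G H"
  obtains (left) x x' y where "x \<in> carrier G" "x' \<in> carrier G" "y \<in> carrier H"
      "u = frag_of (x \<otimes>\<^bsub>G\<^esub> x', y) - frag_of (x, y) - frag_of (x', y)"
    | (right) x y y' where "x \<in> carrier G" "y \<in> carrier H" "y' \<in> carrier H"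
      "u = frag_of (x, y \<otimes>\<^bsub>H\<^esub> y') - frag_of (x, y) - frag_of (x, y')"
  using assms unfolding tensor_relations_def by (elim UnE CollectE exE conjE) (rule left right; assumption)+

lemma frag_relation_carrier:
  assumes "a \<in> carrier G \<times> carrier H" "b \<in> carrier G \<times> carrier H" "c \<in> carrier G \<times> carrier H"
  shows "frag_of a - frag_of b - frag_of c \<in> carrier F"
  using keys_diff[of "frag_of a - frag_of b" "frag_of c"] keys_diff[of "frag_of a" "frag_of b"] assms
  by auto

lemma relations_carrier: "tensor_relations G H \<subseteq> carrier F"
proof
  fix u assume "u \<in> tensor_relations G H"
  then show "u \<in> carrier F"
    by (cases rule: tensor_relation_cases) (simp_all only: frag_relation_carrier mem_Times_iff fst_conv snd_conv
      G.m_closed H.m_closed)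
qed

sublocale F: comm_group F
  by (rule abelian_free_Abelian_group)

lemma R_subgroup: "subgroup R F"
  by (rule F.generate_is_subgroup[OF relations_carrier])

sublocale R: normal R F
  using R_subgroup by (simp add: F.subgroup_imp_normal)

sublocale T: comm_group T
  unfolding T_eq by (rule F.abelian_FactGroup[OF R_subgroup])

lemma frag_carrier: "x \<in> carrier G \<Longrightarrow> y \<in> carrier H \<Longrightarrow> frag_of (x, y) \<in> carrier F"
  by simp

lemma tens_closed: "x \<in> carrier G \<Longrightarrow> y \<in> carrier H \<Longrightarrow> tens x y \<in> carrier T"
  unfolding T_eq tens_def carrier_FactGroup using frag_carrier by blast

lemma coset_eq_if_relation:
  assumes "u \<in> carrier F" "v \<in> carrier F" "w \<in> carrier F" "u - v - w \<in> tensor_relations G H"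
  shows "R #>\<^bsub>F\<^esub> u = (R #>\<^bsub>F\<^esub> v) \<otimes>\<^bsub>T\<^esub> (R #>\<^bsub>F\<^esub> w)"
proof -
  have "u \<otimes>\<^bsub>F\<^esub> inv\<^bsub>F\<^esub> (v \<otimes>\<^bsub>F\<^esub> w) = u - v - w"
    using F.m_closed[OF assms(2,3)] by (simp add: algebra_simps)
  then have "u \<otimes>\<^bsub>F\<^esub> inv\<^bsub>F\<^esub> (v \<otimes>\<^bsub>F\<^esub> w) \<in> R" using assms(4) by (metis generate.incl)
  then have "R #>\<^bsub>F\<^esub> (u \<otimes>\<^bsub>F\<^esub> inv\<^bsub>F\<^esub> (v \<otimes>\<^bsub>F\<^esub> w)) = R"
    using R.rcos_const by blast
  then have "R #>\<^bsub>F\<^esub> u = R #>\<^bsub>F\<^esub> (v \<otimes>\<^bsub>F\<^esub> w)"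
    by (rule F.coset_mult_inv1) (use assms F.m_closed[OF assms(2,3)] R.subset in auto)
  also have "\<dots> = (R #>\<^bsub>F\<^esub> v) \<otimes>\<^bsub>T\<^esub> (R #>\<^bsub>F\<^esub> w)"
    unfolding T_eq using R.rcos_sum[OF assms(2,3)] by (simp add: FactGroup_def)
  finally show ?thesis .
qed

lemma tens_add_left:
  assumes "x \<in> carrier G" "x' \<in> carrier G" "y \<in> carrier H"
  shows "tens (x \<otimes>\<^bsub>G\<^esub> x') y = tens x y \<otimes>\<^bsub>T\<^esub> tens x' y"
  unfolding tens_def
proof (rule coset_eq_if_relation)
  show "frag_of (x \<otimes>\<^bsub>G\<^esub> x', y) - frag_of (x, y) - frag_of (x', y) \<in> tensor_relations G H"
    unfolding tensor_relations_def using assms by blast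
qed (use assms in auto)

lemma tens_add_right:
  assumes "x \<in> carrier G" "y \<in> carrier H" "y' \<in> carrier H"
  shows "tens x (y \<otimes>\<^bsub>H\<^esub> y') = tens x y \<otimes>\<^bsub>T\<^esub> tens x y'"
  unfolding tens_def
proof (rule coset_eq_if_relation)
  show "frag_of (x, y \<otimes>\<^bsub>H\<^esub> y') - frag_of (x, y) - frag_of (x, y') \<in> tensor_relations G H"
    unfolding tensor_relations_def using assms by blast
qed (use assms in auto)

text \<open>Pulled back to the free Abelian group, both homomorphisms are determined by their values
  on generators, which are the elementary tensors.\<close>

lemma tens_hom_ext:
  assumes K: "group K" and h: "h \<in> hom T K" "h' \<in> hom T K"
    and eq: "\<And>x y. x \<in> carrier G \<Longrightarrow> y \<in> carrier H \<Longrightarrow> h (tens x y) = h' (tens x y)"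
    and u: "u \<in> carrier T"
  shows "h u = h' u"
proof -
  interpret K: group K by fact
  have hom: "(\<lambda>v. g (R #>\<^bsub>F\<^esub> v)) \<in> hom F K" if "g \<in> hom T K" for g
    using hom_compose[OF R.r_coset_hom_Mod, of g K] that by (simp add: T_eq o_def)
  interpret h: group_hom F K "\<lambda>v. h (R #>\<^bsub>F\<^esub> v)"
    using hom[OF h(1)] by unfold_locales
  interpret h': group_hom F K "\<lambda>v. h' (R #>\<^bsub>F\<^esub> v)"
    using hom[OF h(2)] by unfold_locales
  obtain v where v: "v \<in> carrier F" "u = R #>\<^bsub>F\<^esub> v"
    using u unfolding T_eq carrier_FactGroup by blast
  have "Poly_Mapping.keys v \<subseteq> carrier G \<times> carrier H" using v(1) by simp
  then have "h (R #>\<^bsub>F\<^esub> v) = h' (R #>\<^bsub>F\<^esub> v)"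
  proof (rule free_Abelian_group_induct)
    show "h (R #>\<^bsub>F\<^esub> 0) = h' (R #>\<^bsub>F\<^esub> 0)"
      using h.hom_one h'.hom_one by simp
  next
    fix a b
    assume ab: "Poly_Mapping.keys a \<subseteq> carrier G \<times> carrier H" "Poly_Mapping.keys b \<subseteq> carrier G \<times> carrier H"
      "h (R #>\<^bsub>F\<^esub> a) = h' (R #>\<^bsub>F\<^esub> a)" "h (R #>\<^bsub>F\<^esub> b) = h' (R #>\<^bsub>F\<^esub> b)"
    have eq: "a - b = a \<otimes>\<^bsub>F\<^esub> inv\<^bsub>F\<^esub> b" using ab by simp
    have "a \<in> carrier F" "b \<in> carrier F" using ab by auto
    then show "h (R #>\<^bsub>F\<^esub> (a - b)) = h' (R #>\<^bsub>F\<^esub> (a - b))"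
      unfolding eq using ab(3,4) by (simp only: h.hom_mult h'.hom_mult h.hom_inv h'.hom_inv F.inv_closed)
  next
    fix a assume "a \<in> carrier G \<times> carrier H"
    then show "h (R #>\<^bsub>F\<^esub> frag_of a) = h' (R #>\<^bsub>F\<^esub> frag_of a)"
      using eq[of "fst a" "snd a"] by (auto simp: tens_def)
  qed
  then show ?thesis using v by simp
qed

text \<open>The map extends to the free Abelian group, and additivity in both arguments says exactly
  that the defining relations lie in the kernel.\<close>

lemma tens_lift:
  assumes K: "comm_group K"
    and closed: "\<And>x y. x \<in> carrier G \<Longrightarrow> y \<in> carrier H \<Longrightarrow> \<beta> x y \<in> carrier K"
    and left: "\<And>x x' y. x \<in> carrier G \<Longrightarrow> x' \<in> carrier G \<Longrightarrow> y \<in> carrier H \<Longrightarrow>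
      \<beta> (x \<otimes>\<^bsub>G\<^esub> x') y = \<beta> x y \<otimes>\<^bsub>K\<^esub> \<beta> x' y"
    and right: "\<And>x y y'. x \<in> carrier G \<Longrightarrow> y \<in> carrier H \<Longrightarrow> y' \<in> carrier H \<Longrightarrow>
      \<beta> x (y \<otimes>\<^bsub>H\<^esub> y') = \<beta> x y \<otimes>\<^bsub>K\<^esub> \<beta> x y'"
  shows "\<exists>h\<in>hom T K. \<forall>x\<in>carrier G. \<forall>y\<in>carrier H. h (tens x y) = \<beta> x y"
proof -
  interpret K: comm_group K by fact
  have "case_prod \<beta> ` (carrier G \<times> carrier H) \<subseteq> carrier K" using closed by auto
  then obtain g where g: "g \<in> hom F K" "\<And>z. z \<in> carrier G \<times> carrier H \<Longrightarrow> g (frag_of z) = case_prod \<beta> z"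
    using K.free_Abelian_group_universal by blast
  interpret g: group_hom F K g using g(1) by unfold_locales
  have g_diff: "g (u - v - w) = g u \<otimes>\<^bsub>K\<^esub> inv\<^bsub>K\<^esub> (g v) \<otimes>\<^bsub>K\<^esub> inv\<^bsub>K\<^esub> (g w)"
    if uvw: "u \<in> carrier F" "v \<in> carrier F" "w \<in> carrier F" for u v w
  proof -
    have "u - v - w = u \<otimes>\<^bsub>F\<^esub> inv\<^bsub>F\<^esub> v \<otimes>\<^bsub>F\<^esub> inv\<^bsub>F\<^esub> w" using uvw by simp
    then show ?thesis using uvw by (simp only: g.hom_mult g.hom_inv F.inv_closed F.m_closed)
  qed
  have "tensor_relations G H \<subseteq> kernel F K g"
  proof
    fix u assume u: "u \<in> tensor_relations G H"
    then have "g u = \<one>\<^bsub>K\<^esub>"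
    proof (cases rule: tensor_relation_cases)
      case 1: (left x x' y)
      have "g u = (\<beta> x y \<otimes>\<^bsub>K\<^esub> \<beta> x' y) \<otimes>\<^bsub>K\<^esub> inv\<^bsub>K\<^esub> \<beta> x y \<otimes>\<^bsub>K\<^esub> inv\<^bsub>K\<^esub> \<beta> x' y"
        unfolding 1(4) using 1 by (subst g_diff) (auto simp: g(2) left)
      then show ?thesis using closed 1 by (simp add: K.m_ac)
    next
      case 2: (right x y y')
      have "g u = (\<beta> x y \<otimes>\<^bsub>K\<^esub> \<beta> x y') \<otimes>\<^bsub>K\<^esub> inv\<^bsub>K\<^esub> \<beta> x y \<otimes>\<^bsub>K\<^esub> inv\<^bsub>K\<^esub> \<beta> x y'"
        unfolding 2(4) using 2 by (subst g_diff) (auto simp: g(2) right)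
      then show ?thesis using closed 2 by (simp add: K.m_ac)
    qed
    then show "u \<in> kernel F K g" using u relations_carrier unfolding kernel_def by blast
  qed
  then have "R \<subseteq> kernel F K g"
    by (rule F.generate_subgroup_incl) (rule g.subgroup_kernel)
  then obtain h where h: "h \<in> hom (F Mod R) K" "\<And>u. u \<in> carrier F \<Longrightarrow> h (R #>\<^bsub>F\<^esub> u) = g u"
    using g.FactGroup_universal_kernel[OF R.normal_axioms] by blast
  show ?thesis
    using h g(2) frag_carrier by (intro bexI[of _ h]) (auto simp: T_eq tens_def)
qed

end

text \<open>Both \<open>s\<close> and \<open>c\<close> are units modulo \<open>w\<close>, so either
  product is integral exactly if \<open>t / w\<close> is. This carries purity between a vector with
  values \<open>s / w\<close> and one with values \<open>c / w\<close>.\<close>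

lemma Zs_frac_swap:
  fixes s w c k :: int
  assumes w: "w > 0" and cs: "c * s = 1 + k * w" and t: "of_int t * (of_int s / of_int w) \<in> Zs S"
  shows "of_int t * (of_int c / of_int w) \<in> Zs S"
proof -
  have "coprime s w"
  proof (rule coprimeI)
    fix e assume "e dvd s" "e dvd w"
    then have "e dvd c * s - k * w" by (intro dvd_diff dvd_mult)
    then show "is_unit e" using cs by simp
  qed
  then have "of_int t / of_int w \<in> Zs S" using w t by (intro Zs_coprime_cancel[of s w "of_int t"]) (auto simp: mult.commute)
  from Zs_mult[OF Zs_of_int[of c] this] show ?thesis by (simp add: mult.commute)
qed

section \<open>Coordinates of a multiplication\<close>

definition triples :: "'i set \<Rightarrow> ('i \<Rightarrow> nat set) \<Rightarrow> ('i \<times> 'i \<times> 'i) set" where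
  "triples I \<sigma> = {(i, j, l). i \<in> I \<and> j \<in> I \<and> l \<in> I \<and> \<sigma> i = \<sigma> j \<and> \<sigma> j = \<sigma> l}"

text \<open>The extra vector for the multiplications lives on the diagonal: a denominator at
  \<open>i\<close> reappears only at \<open>(i, i, i)\<close>, so each block keeps at most
  one.\<close>

definition diag :: "'i set \<Rightarrow> ('i \<Rightarrow> rat) \<Rightarrow> 'i \<times> 'i \<times> 'i \<Rightarrow> rat" where
  "diag I d = (\<lambda>(i, j, l). if i \<in> I \<and> i = j \<and> j = l then d i else 0)"

lemma finite_triples: "finite I \<Longrightarrow> finite (triples I \<sigma>)"
  by (rule finite_subset[of _ "I \<times> I \<times> I"]) (auto simp: triples_def)

lemma card_triples_block:
  assumes "finite I"
  shows "card {z \<in> triples I \<sigma>. \<sigma> (fst z) = S} = card {i \<in> I. \<sigma> i = S} ^ 3"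
proof -
  let ?B = "{i \<in> I. \<sigma> i = S}"
  have "{z \<in> triples I \<sigma>. \<sigma> (fst z) = S} = ?B \<times> ?B \<times> ?B"
    by (intro equalityI subsetI) (clarsimp simp: triples_def)+
  then show ?thesis by (simp add: card_cartesian_product power3_eq_cube)
qed

lemma image_triples: "(\<lambda>z. \<sigma> (fst z)) ` triples I \<sigma> = \<sigma> ` I"
proof (intro equalityI subsetI)
  fix S assume "S \<in> \<sigma> ` I"
  then obtain i where "i \<in> I" "S = \<sigma> i" by blast
  then show "S \<in> (\<lambda>z. \<sigma> (fst z)) ` triples I \<sigma>"
    by (intro image_eqI[of _ _ "(i, i, i)"]) (auto simp: triples_def)
qed (auto simp: triples_def)

text \<open>The inverses \<open>c\<close> and the cofactors \<open>k\<close> are parameters because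
  the realization needs an instance in which \<open>s\<close> and \<open>c\<close> exchange roles.
  The condition \<open>w_one\<close> is sparseness in terms of denominators.\<close>

locale mult_coord = pure_coord G I \<sigma> d \<phi>
  for G :: "('a, 'm) monoid_scheme" (structure) and I :: "'i set" and \<sigma> d \<phi> +
  fixes s w c k :: "'i \<Rightarrow> int"
  assumes w_pos: "\<And>i. i \<in> I \<Longrightarrow> w i > 0"
    and d_eq: "\<And>i. i \<in> I \<Longrightarrow> d i = of_int (s i) / of_int (w i)"
    and cs: "\<And>i. i \<in> I \<Longrightarrow> c i * s i = 1 + k i * w i"
    and w_one: "\<And>i j. i \<in> I \<Longrightarrow> j \<in> I \<Longrightarrow> i \<noteq> j \<Longrightarrow> \<sigma> i = \<sigma> j \<Longrightarrow> w i = 1 \<or> w j = 1"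
begin

abbreviation "I3 \<equiv> triples I \<sigma>"
abbreviation "\<sigma>3 \<equiv> \<lambda>z :: 'i \<times> 'i \<times> 'i. \<sigma> (fst z)"
abbreviation "e \<equiv> \<lambda>i. of_int (c i) / of_int (w i) :: rat"
abbreviation "d3 \<equiv> diag I e"

lemma coprime_sw: "i \<in> I \<Longrightarrow> coprime (s i) (w i)"
proof (rule coprimeI)
  fix e assume "i \<in> I" "e dvd s i" "e dvd w i"
  then have "e dvd c i * s i - k i * w i" by (intro dvd_diff dvd_mult)
  then show "is_unit e" using cs[OF \<open>i \<in> I\<close>] by simp
qed

text \<open>Integrality of \<open>t * d3\<close> outside a block is tested at the diagonal triples,
  translated to \<open>t * d\<close> by \<open>Zs_frac_swap\<close>, extended to all coordinates by
  purity of \<open>d\<close>, and translated back.\<close>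

lemma pure_triples: "pure_data I3 \<sigma>3 d3"
  unfolding pure_data_def image_triples
proof (intro ballI allI impI)
  fix S t z assume S: "S \<in> \<sigma> ` I" and z: "z \<in> I3"
    and *: "\<forall>z\<in>I3. \<sigma> (fst z) \<noteq> S \<longrightarrow> of_int t * d3 z \<in> Zs (\<sigma> (fst z))"
  have "of_int t * d i \<in> Zs (\<sigma> i)" if i: "i \<in> I" "\<sigma> i \<noteq> S" for i
  proof -
    have "of_int t * e i \<in> Zs (\<sigma> i)"
      using bspec[OF *, of "(i, i, i)"] i by (simp add: triples_def diag_def)
    then show ?thesis
      unfolding d_eq[OF i(1)] using cs[OF i(1)]
      by (intro Zs_frac_swap[OF w_pos[OF i(1)], where s = "c i" and c = "s i" and k = "k i"])
        (auto simp: mult.commute)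
  qed
  then have d: "of_int t * d i \<in> Zs (\<sigma> i)" if "i \<in> I" for i
    using pure S that unfolding pure_data_def by blast
  have "of_int t * e i \<in> Zs (\<sigma> i)" if i: "i \<in> I" for i
    using d[OF i] unfolding d_eq[OF i] by (rule Zs_frac_swap[OF w_pos[OF i] cs[OF i]])
  then show "of_int t * d3 z \<in> Zs (\<sigma> (fst z))"
    by (auto simp: diag_def split: prod.split)
qed

definition eps :: "'i \<Rightarrow> 'a" where "eps i = el (single i 1)"

lemma eps: "i \<in> I \<Longrightarrow> eps i \<in> carrier G" "i \<in> I \<Longrightarrow> \<phi> (eps i) = single i 1"
  using single_part[of i 1] part_carrier by (auto simp: eps_def)

text \<open>Additive maps into the rationals are linear: a suitable power \<open>x [^] N\<close> is
  an integral combination of the \<open>eps i\<close>, and the factor \<open>N\<close> can be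
  cancelled in the values.\<close>

lemma additive_expand:
  fixes g :: "'a \<Rightarrow> rat"
  assumes g: "\<And>x y. x \<in> carrier G \<Longrightarrow> y \<in> carrier G \<Longrightarrow> g (x \<otimes> y) = g x + g y"
    and x: "x \<in> carrier G"
  shows "g x = (\<Sum>i\<in>I. \<phi> x i * g (eps i))"
proof -
  \<comment> \<open>A rational is regarded as a function on one point, so that the laws for
    coordinate maps apply to \<open>g\<close>.\<close>
  let ?g = "\<lambda>x (_::unit). g x"
  have g': "?g (x \<otimes> y) = ?g x + ?g y" if "x \<in> carrier G" "y \<in> carrier G" for x y
    using g[OF that] by (simp add: fun_eq_iff)
  have gpow: "g (y [^] (n::int)) = of_int n * g y" if "y \<in> carrier G" for y n
    using fun_cong[OF embed_int_pow[OF is_group g' that, of n]] by simp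
  obtain N where N: "N > 0" "\<And>i. i \<in> I \<Longrightarrow> \<exists>k::int. of_nat N * \<phi> x i = of_int k"
    using common_denominator[OF finI, of "\<phi> x"] by blast
  define n where "n i = \<lfloor>of_nat N * \<phi> x i\<rfloor>" for i
  have n: "of_int (n i) = of_nat N * \<phi> x i" if i: "i \<in> I" for i
  proof -
    obtain k :: int where "of_nat N * \<phi> x i = of_int k" using N(2)[OF i] by blast
    then show ?thesis by (simp add: n_def)
  qed
  have closed: "(\<Otimes>i\<in>I. eps i [^] n i) \<in> carrier G" using eps by (intro finprod_closed) auto
  have "x [^] int N = (\<Otimes>i\<in>I. eps i [^] n i)"
  proof (rule \<phi>_eqD[OF _ closed])
    fix j
    have "\<phi> (\<Otimes>i\<in>I. eps i [^] n i) j = (\<Sum>i\<in>I. \<phi> (eps i [^] n i) j)"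
      using eps finI by (subst embed_finprod[OF comm_group_axioms \<phi>_mult]) (auto simp: sum_fun_apply)
    also have "\<dots> = (\<Sum>i\<in>I. if i = j then of_int (n j) else 0)"
      by (intro sum.cong) (auto simp: \<phi>_int_pow eps single_def)
    also have "\<dots> = \<phi> (x [^] int N) j"
      using x n finI \<phi>_supp[OF x] by (cases "j \<in> I") (auto simp: \<phi>_int_pow)
    finally show "\<phi> (x [^] int N) j = \<phi> (\<Otimes>i\<in>I. eps i [^] n i) j" by simp
  qed (use x in auto)
  then have "of_nat N * g x = g (\<Otimes>i\<in>I. eps i [^] n i)" using gpow[OF x, of "int N"] by simp
  also have "\<dots> = (\<Sum>i\<in>I. g (eps i [^] n i))"
    using embed_finprod[OF comm_group_axioms g' finI, of "\<lambda>i. eps i [^] n i"] eps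
    by (simp add: fun_eq_iff sum_fun_apply)
  also have "\<dots> = (\<Sum>i\<in>I. of_nat N * (\<phi> x i * g (eps i)))"
    by (intro sum.cong refl) (simp add: gpow eps n)
  also have "\<dots> = of_nat N * (\<Sum>i\<in>I. \<phi> x i * g (eps i))" by (simp only: sum_distrib_left)
  finally show ?thesis using N(1) by simp
qed

sublocale tensor G G ..

context
  fixes \<mu> assumes \<mu>: "\<mu> \<in> hom T G"
begin

definition \<beta> where "\<beta> x y = \<mu> (tens x y)"
definition coef where "coef i j l = \<phi> (\<beta> (eps i) (eps j)) l"

lemma \<beta>_closed: "x \<in> carrier G \<Longrightarrow> y \<in> carrier G \<Longrightarrow> \<beta> x y \<in> carrier G"
  using hom_in_carrier[OF \<mu> tens_closed] by (simp add: \<beta>_def)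

lemma \<beta>_left: "x \<in> carrier G \<Longrightarrow> x' \<in> carrier G \<Longrightarrow> y \<in> carrier G \<Longrightarrow> \<beta> (x \<otimes> x') y = \<beta> x y \<otimes> \<beta> x' y"
  using hom_mult[OF \<mu> tens_closed tens_closed] by (simp add: \<beta>_def tens_add_left)

lemma \<beta>_right: "x \<in> carrier G \<Longrightarrow> y \<in> carrier G \<Longrightarrow> y' \<in> carrier G \<Longrightarrow> \<beta> x (y \<otimes> y') = \<beta> x y \<otimes> \<beta> x y'"
  using hom_mult[OF \<mu> tens_closed tens_closed] by (simp add: \<beta>_def tens_add_right)

lemma \<beta>_expand_left:
  assumes "x \<in> carrier G" "y \<in> carrier G"
  shows "\<phi> (\<beta> x y) l = (\<Sum>i\<in>I. \<phi> x i * \<phi> (\<beta> (eps i) y) l)"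
  using assms by (intro additive_expand[where g = "\<lambda>x. \<phi> (\<beta> x y) l"]) (auto simp: \<beta>_left \<phi>_mult \<beta>_closed)

lemma \<beta>_expand_right:
  assumes "x \<in> carrier G" "y \<in> carrier G"
  shows "\<phi> (\<beta> x y) l = (\<Sum>j\<in>I. \<phi> y j * \<phi> (\<beta> x (eps j)) l)"
  using assms by (intro additive_expand[where g = "\<lambda>y. \<phi> (\<beta> x y) l"]) (auto simp: \<beta>_right \<phi>_mult \<beta>_closed)

lemma \<beta>_expand:
  assumes "x \<in> carrier G" "y \<in> carrier G"
  shows "\<phi> (\<beta> x y) l = (\<Sum>i\<in>I. \<Sum>j\<in>I. \<phi> x i * \<phi> y j * coef i j l)"
proof -
  have "\<phi> x i * \<phi> (\<beta> (eps i) y) l = (\<Sum>j\<in>I. \<phi> x i * \<phi> y j * coef i j l)" if i: "i \<in> I" for i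
    unfolding \<beta>_expand_right[OF eps(1)[OF i] assms(2)] coef_def by (simp add: sum_distrib_left mult_ac)
  then show ?thesis unfolding \<beta>_expand_left[OF assms] by (intro sum.cong) auto
qed

lemma eps_root:
  assumes i: "i \<in> I" and p: "p \<in> \<sigma> i"
  shows "\<exists>z\<in>carrier G. z [^] (p ^ n) = eps i"
proof -
  have "eps i \<in> block (\<sigma> i)" using single_part[OF i Zs_1] by (auto simp: eps_def block_def part_def single_def)
  then show ?thesis using block_root[of "eps i" "\<sigma> i" p n] p primes[OF i p] by (auto simp: block_def L_def)
qed

lemma \<beta>_pow:
  assumes "x \<in> carrier G" "y \<in> carrier G"
  shows "\<beta> (x [^] (n::nat)) y = \<beta> x y [^] n" "\<beta> x (y [^] (n::nat)) = \<beta> x y [^] n"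
proof -
  interpret hl: group_hom G G "\<lambda>x. \<beta> x y"
    using assms \<beta>_closed \<beta>_left by unfold_locales (auto simp: hom_def)
  interpret hr: group_hom G G "\<beta> x"
    using assms \<beta>_closed \<beta>_right by unfold_locales (auto simp: hom_def)
  show "\<beta> (x [^] (n::nat)) y = \<beta> x y [^] n" "\<beta> x (y [^] (n::nat)) = \<beta> x y [^] n"
    using hl.hom_nat_pow hr.hom_nat_pow assms by auto
qed

text \<open>Roots of \<open>eps i\<close> give roots of its products with any \<open>y\<close>, so
  these products inherit infinite divisibility by the primes of \<open>\<sigma> i\<close>; by
  \<open>divis_eq_block\<close> this places them in the block.\<close>

lemma \<beta>_block:
  assumes i: "i \<in> I" and y: "y \<in> carrier G"
  shows "\<beta> (eps i) y \<in> block (\<sigma> i)" "\<beta> y (eps i) \<in> block (\<sigma> i)"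
proof -
  have "\<beta> (eps i) y \<in> divis G (\<sigma> i) \<and> \<beta> y (eps i) \<in> divis G (\<sigma> i)"
    unfolding divis_def
  proof (intro conjI CollectI ballI allI)
    fix p n assume p: "p \<in> \<sigma> i"
    obtain z where z: "z \<in> carrier G" "z [^] (p ^ n) = eps i" using eps_root[OF i p] by blast
    show "\<exists>v\<in>carrier G. v [^] (p ^ n) = \<beta> (eps i) y"
      using \<beta>_pow(1)[OF z(1) y, of "p ^ n"] z y \<beta>_closed by (intro bexI[of _ "\<beta> z y"]) auto
    show "\<exists>v\<in>carrier G. v [^] (p ^ n) = \<beta> y (eps i)"
      using \<beta>_pow(2)[OF y z(1), of "p ^ n"] z y \<beta>_closed by (intro bexI[of _ "\<beta> y z"]) auto
  qed (use i y eps \<beta>_closed in auto)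
  then show "\<beta> (eps i) y \<in> block (\<sigma> i)" "\<beta> y (eps i) \<in> block (\<sigma> i)"
    using divis_eq_block i by auto
qed

text \<open>The product of \<open>eps i\<close> and \<open>eps j\<close> lies in the blocks of both
  factors, so it has coordinates only where both blocks agree.\<close>

lemma coef_zero:
  assumes "i \<in> I" "j \<in> I" "(i, j, l) \<notin> I3" shows "coef i j l = 0"
proof (cases "l \<in> I")
  case True
  then have "\<sigma> l \<noteq> \<sigma> i \<or> \<sigma> l \<noteq> \<sigma> j" using assms by (auto simp: triples_def)
  then show ?thesis
    using \<beta>_block(1)[OF assms(1) eps(1)[OF assms(2)]] \<beta>_block(2)[OF assms(2) eps(1)[OF assms(1)]] True
    by (auto simp: coef_def block_def)
next
  case False
  then show ?thesis using \<phi>_supp \<beta>_closed eps assms by (simp add: coef_def)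
qed

lemma block_coord: "x \<in> block S \<Longrightarrow> l \<in> I \<Longrightarrow> \<phi> x l \<in> Zs (\<sigma> l)"
  by (auto simp: block_def L_def dest: latD)

lemma coef_Zs: "i \<in> I \<Longrightarrow> j \<in> I \<Longrightarrow> l \<in> I \<Longrightarrow> coef i j l \<in> Zs (\<sigma> l)"
  unfolding coef_def using \<beta>_block(1) eps block_coord by blast

text \<open>
  At most one coordinate in each block has a denominator, so integrality of a sum over a block
  can be read off that coordinate alone.
\<close>

lemma sum_block_cancel:
  assumes j: "j \<in> I" and l: "l \<in> I" "\<sigma> l = \<sigma> j"
    and q: "\<And>i. i \<in> I \<Longrightarrow> q i \<in> Zs (\<sigma> l)" "\<And>i. i \<in> I \<Longrightarrow> \<sigma> i \<noteq> \<sigma> l \<Longrightarrow> q i = 0"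
    and sum: "(\<Sum>i\<in>I. d i * q i) \<in> Zs (\<sigma> l)"
  shows "q j / of_int (w j) \<in> Zs (\<sigma> l)"
proof (cases "w j = 1")
  case True
  then show ?thesis using q(1)[OF j] by simp
next
  case False
  have "d i * q i \<in> Zs (\<sigma> l)" if i: "i \<in> I - {j}" for i
  proof (cases "\<sigma> i = \<sigma> l")
    case True
    then have "w i = 1" using w_one[of i j] i j l False by auto
    then have "d i * q i = of_int (s i) * q i" using d_eq i by simp
    then show ?thesis using q(1) i by auto
  next
    case False
    then show ?thesis using q(2) i by simp
  qed
  then have "(\<Sum>i\<in>I. d i * q i) - (\<Sum>i\<in>I - {j}. d i * q i) \<in> Zs (\<sigma> l)" by (intro Zs_diff sum Zs_sum) auto
  moreover have "(\<Sum>i\<in>I. d i * q i) = d j * q j + (\<Sum>i\<in>I - {j}. d i * q i)"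
    by (rule sum.remove[OF finI j])
  ultimately have "of_int (s j) * q j / of_int (w j) \<in> Zs (\<sigma> l)" by (simp add: d_eq[OF j])
  then show ?thesis using w_pos[OF j] coprime_sw[OF j] Zs_coprime_cancel[OF _ q(1)[OF j]] by auto
qed

text \<open>The product of \<open>eps i\<close> and \<open>gen\<close> lies in a block and hence in
  the lattice. Its coordinate at \<open>l\<close> is the sum of all \<open>d j * coef i j l\<close>,
  so a denominator in \<open>d\<close> has to be absorbed by the coefficient next to it.\<close>

lemma coef_div_right:
  assumes "(i, j, l) \<in> I3" shows "coef i j l / of_int (w j) \<in> Zs (\<sigma> l)"
proof -
  have ijl: "i \<in> I" "j \<in> I" "l \<in> I" "\<sigma> l = \<sigma> j" using assms by (auto simp: triples_def)
  show ?thesis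
  proof (rule sum_block_cancel[OF ijl(2-4)])
    have "\<phi> (\<beta> (eps i) gen) l \<in> Zs (\<sigma> l)" using \<beta>_block(1)[OF ijl(1) gen(1)] block_coord ijl(3) by blast
    then show "(\<Sum>j\<in>I. d j * coef i j l) \<in> Zs (\<sigma> l)"
      unfolding \<beta>_expand_right[OF eps(1)[OF ijl(1)] gen(1)] by (simp add: gen(2) coef_def)
    show "coef i j' l = 0" if "j' \<in> I" "\<sigma> j' \<noteq> \<sigma> l" for j'
      using that ijl coef_zero[of i j' l] by (auto simp: triples_def)
  qed (use coef_Zs ijl in metis)
qed

lemma coef_div_left:
  assumes "(i, j, l) \<in> I3" shows "coef i j l / of_int (w i) \<in> Zs (\<sigma> l)"
proof -
  have ijl: "j \<in> I" "i \<in> I" "l \<in> I" "\<sigma> l = \<sigma> i" using assms by (auto simp: triples_def)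
  show ?thesis
  proof (rule sum_block_cancel[OF ijl(2-4)])
    have "\<phi> (\<beta> gen (eps j)) l \<in> Zs (\<sigma> l)" using \<beta>_block(2)[OF ijl(1) gen(1)] block_coord ijl(3) by blast
    then show "(\<Sum>i\<in>I. d i * coef i j l) \<in> Zs (\<sigma> l)"
      unfolding \<beta>_expand_left[OF gen(1) eps(1)[OF ijl(1)]] by (simp add: gen(2) coef_def)
    show "coef i' j l = 0" if "i' \<in> I" "\<sigma> i' \<noteq> \<sigma> l" for i'
      using that ijl coef_zero[of i' j l] by (auto simp: triples_def)
  qed (use coef_Zs ijl in metis)
qed

text \<open>Each weight divides the coefficient separately. By \<open>w_one\<close>, two different
  coordinates of a block cannot both have a weight other than 1, so dividing by the product can
  leave a denominator only for \<open>i = j\<close>.\<close>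

definition ncoef :: "'i \<times> 'i \<times> 'i \<Rightarrow> rat" where
  "ncoef = (\<lambda>(i, j, l). if (i, j, l) \<in> I3 then coef i j l / (of_int (w i) * of_int (w j)) else 0)"

lemma ncoef_integral:
  assumes "(i, j, l) \<in> I3" "w i = 1 \<or> w j = 1" shows "ncoef (i, j, l) \<in> Zs (\<sigma> l)"
  using assms coef_div_left[OF assms(1)] coef_div_right[OF assms(1)] by (auto simp: ncoef_def)

text \<open>The integer \<open>t\<close> is the multiple of \<open>d\<close> in the product of
  \<open>gen\<close> with itself, a single element for all blocks; this is why one extra vector
  \<open>d3\<close> suffices. Modulo integral terms, only the pair \<open>(z, z)\<close> contributes
  to the coordinate at \<open>l\<close>.\<close>

lemma ncoef_diagonal:
  obtains t :: int where "\<And>i l. i \<in> I \<Longrightarrow> l \<in> I \<Longrightarrow> \<sigma> i = \<sigma> l \<Longrightarrow> w i \<noteq> 1 \<Longrightarrow>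
    ncoef (i, i, l) - of_int t * d3 (i, i, l) \<in> Zs (\<sigma> l)"
proof -
  have "\<phi> (\<beta> gen gen) \<in> carrier (lattice_group I \<sigma> d)" using \<beta>_closed gen \<phi>_img by blast
  then obtain t where t: "(\<lambda>l. \<phi> (\<beta> gen gen) l - of_int t * d l) \<in> lat I \<sigma>" by (auto simp: carrier_lattice_group_iff)
  have "ncoef (z, z, l) - of_int t * d3 (z, z, l) \<in> Zs (\<sigma> l)"
    if z: "z \<in> I" and l: "l \<in> I" "\<sigma> z = \<sigma> l" and wz: "w z \<noteq> 1" for z l
  proof -
    have zzl: "(z, z, l) \<in> I3" using z l by (auto simp: triples_def)
    \<comment> \<open>As \<open>w z\<close> is not 1, all other coordinates of the block have weight
      1, and a pair other than \<open>(z, z)\<close> inside the block contains one of them.\<close>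
    have other: "d i * d j * coef i j l \<in> Zs (\<sigma> l)" if ij: "(i, j) \<in> I \<times> I - {(z, z)}" for i j
    proof (cases "(i, j, l) \<in> I3")
      case True
      then have "w i = 1 \<or> w j = 1" using ij w_one[of i z] w_one[of j z] z wz l by (auto simp: triples_def)
      then have "ncoef (i, j, l) \<in> Zs (\<sigma> l)" using ncoef_integral True by blast
      moreover have "d i * d j * coef i j l = of_int (s i * s j) * ncoef (i, j, l)"
        using True ij by (auto simp: ncoef_def d_eq)
      ultimately show ?thesis using Zs_mult[OF Zs_of_int] by metis
    next
      case False
      then show ?thesis using coef_zero ij by simp
    qed
    define \<nu> where "\<nu> = coef z z l / of_int (w z)"
    have \<nu>: "\<nu> \<in> Zs (\<sigma> l)" unfolding \<nu>_def by (rule coef_div_left[OF zzl])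
    have "\<phi> (\<beta> gen gen) l = (\<Sum>(i, j)\<in>I \<times> I. d i * d j * coef i j l)"
      unfolding \<beta>_expand[OF gen(1) gen(1)] gen(2) by (simp add: sum.cartesian_product)
    also have "\<dots> = d z * d z * coef z z l + (\<Sum>(i, j)\<in>I \<times> I - {(z, z)}. d i * d j * coef i j l)"
      using sum.remove[of "I \<times> I" "(z, z)" "\<lambda>(i, j). d i * d j * coef i j l"] finI z by simp
    finally have "(d z * d z * coef z z l - of_int t * d l) + (\<Sum>(i, j)\<in>I \<times> I - {(z, z)}. d i * d j * coef i j l)
        \<in> Zs (\<sigma> l)"
      using latD(1)[OF t l(1)] by (simp add: algebra_simps)
    moreover have "(\<Sum>(i, j)\<in>I \<times> I - {(z, z)}. d i * d j * coef i j l) \<in> Zs (\<sigma> l)"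
      using other by (intro Zs_sum) auto
    ultimately have "((d z * d z * coef z z l - of_int t * d l) + (\<Sum>(i, j)\<in>I \<times> I - {(z, z)}. d i * d j * coef i j l))
        - (\<Sum>(i, j)\<in>I \<times> I - {(z, z)}. d i * d j * coef i j l) \<in> Zs (\<sigma> l)" by (rule Zs_diff)
    moreover have "d z * d z * coef z z l = of_int (s z) * (of_int (s z) * \<nu>) / of_int (w z)"
      by (simp add: d_eq[OF z] \<nu>_def)
    ultimately have main: "of_int (s z) * (of_int (s z) * \<nu>) / of_int (w z) - of_int t * d l \<in> Zs (\<sigma> l)" by simp
    have nc: "ncoef (z, z, l) = \<nu> / of_int (w z)" using zzl by (simp add: ncoef_def \<nu>_def)
    note cancel = Zs_coprime_cancel[OF coprime_sw[OF z], of _ "\<sigma> l"]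
    show ?thesis
    proof (cases "l = z")
      case True
      \<comment> \<open>Now \<open>main\<close> says that \<open>s z * x / w z\<close> is integral,
        hence so is \<open>x / w z\<close>. Multiplying by \<open>c z\<close> and using
        \<open>c z * s z = 1 + k z * w z\<close> isolates
        \<open>(\<nu> - t * c z) / w z\<close>.\<close>
      define x where "x = of_int (s z) * \<nu> - of_int t"
      have x: "x \<in> Zs (\<sigma> l)" unfolding x_def using \<nu> by (intro Zs_diff Zs_mult) auto
      have "of_int (s z) * x / of_int (w z) \<in> Zs (\<sigma> l)"
        using main True d_eq[OF z] by (simp add: x_def algebra_simps diff_divide_distrib)
      then have "x / of_int (w z) \<in> Zs (\<sigma> l)" using cancel x w_pos[OF z] by simp
      then have "of_int (c z) * (x / of_int (w z)) - of_int (k z) * \<nu> \<in> Zs (\<sigma> l)"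
        using \<nu> by (intro Zs_diff Zs_mult) auto
      moreover have "of_int (c z) * (x / of_int (w z)) - of_int (k z) * \<nu> =
          \<nu> / of_int (w z) - of_int t * (of_int (c z) / of_int (w z))"
      proof -
        have "(of_int (c z) * of_int (s z) :: rat) = 1 + of_int (k z) * of_int (w z)"
          using arg_cong[OF cs[OF z], of "of_int :: int \<Rightarrow> rat"] by simp
        then have "of_int (c z) * x = \<nu> + of_int (k z) * of_int (w z) * \<nu> - of_int (c z) * of_int t"
          unfolding x_def by (simp add: algebra_simps)
        then show ?thesis using w_pos[OF z] by (simp add: field_simps)
      qed
      ultimately show ?thesis using True z nc by (simp add: diag_def)
    next
      case False
      \<comment> \<open>Here \<open>t * d l\<close> is an integer, so it drops out of
        \<open>main\<close>, and \<open>s z\<close> can be cancelled twice.\<close>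
      then have "w l = 1" using w_one[OF z l(1)] l wz by auto
      then have "of_int t * d l = of_int (t * s l)" using d_eq[OF l(1)] by simp
      then have "(of_int (s z) * (of_int (s z) * \<nu>) / of_int (w z) - of_int t * d l) + of_int t * d l \<in> Zs (\<sigma> l)"
        using main by (intro Zs_add) auto
      then have "of_int (s z) * (of_int (s z) * \<nu>) / of_int (w z) \<in> Zs (\<sigma> l)" by simp
      then have "of_int (s z) * \<nu> / of_int (w z) \<in> Zs (\<sigma> l)"
        using cancel[of "of_int (s z) * \<nu>"] Zs_mult[OF Zs_of_int \<nu>] w_pos[OF z] by simp
      then have "\<nu> / of_int (w z) \<in> Zs (\<sigma> l)" using cancel[of \<nu>] \<nu> w_pos[OF z] by simp
      then show ?thesis using False by (simp add: nc diag_def)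
    qed
  qed
  then show ?thesis using that by blast
qed

text \<open>If one of the weights \<open>w i\<close>, \<open>w j\<close> is 1, both the entry and
  \<open>t * d3\<close> are integral there. Otherwise \<open>i = j\<close> by \<open>w_one\<close>,
  which is the case of \<open>ncoef_diagonal\<close>.\<close>

lemma ncoef_in: "ncoef \<in> carrier (lattice_group I3 \<sigma>3 d3)"
proof -
  obtain t :: int where t: "\<And>i l. i \<in> I \<Longrightarrow> l \<in> I \<Longrightarrow> \<sigma> i = \<sigma> l \<Longrightarrow> w i \<noteq> 1 \<Longrightarrow>
    ncoef (i, i, l) - of_int t * d3 (i, i, l) \<in> Zs (\<sigma> l)" using ncoef_diagonal by blast
  have "(\<lambda>z. ncoef z - of_int t * d3 z) \<in> lat I3 \<sigma>3"
  proof (rule latI)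
    fix z assume z: "z \<in> I3"
    obtain i j l where ijl: "z = (i, j, l)" by (metis prod_cases3)
    have m: "i \<in> I" "j \<in> I" "l \<in> I" "\<sigma> i = \<sigma> l" "\<sigma> j = \<sigma> l" using z by (auto simp: ijl triples_def)
    show "ncoef z - of_int t * d3 z \<in> Zs (\<sigma> (fst z))"
    proof (cases "w i = 1 \<or> w j = 1")
      case True
      have "of_int t * d3 z \<in> Zs (\<sigma> l)" using True by (auto simp: ijl diag_def intro!: Zs_mult)
      then show ?thesis using ncoef_integral[of i j l] z True m(4) by (auto simp: ijl)
    next
      case False
      then have "i = j" using w_one[of i j] m by auto
      then show ?thesis using t[of i l] m False by (simp add: ijl)
    qed
  next
    fix z assume "z \<notin> I3"
    then show "ncoef z - of_int t * d3 z = 0"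
      by (auto simp: ncoef_def diag_def triples_def split: prod.splits)
  qed
  then show ?thesis by (auto simp: carrier_lattice_group_iff)
qed

end

end

section \<open>Multiplications with prescribed coordinates\<close>

context mult_coord
begin

text \<open>Defined on all rational vectors, so that bilinearity needs no membership; integrality is
  checked separately on the lattice and on \<open>d\<close>.\<close>

definition bil :: "('i \<times> 'i \<times> 'i \<Rightarrow> rat) \<Rightarrow> ('i \<Rightarrow> rat) \<Rightarrow> ('i \<Rightarrow> rat) \<Rightarrow> 'i \<Rightarrow> rat" where
  "bil b f g = (\<lambda>l. \<Sum>i\<in>I. \<Sum>j\<in>I. f i * g j * (of_int (w i) * of_int (w j) * b (i, j, l)))"

lemma bil_add: "bil b (f + f') g = bil b f g + bil b f' g" "bil b f (g + g') = bil b f g + bil b f g'"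
  by (auto simp: bil_def fun_eq_iff distrib_left distrib_right sum.distrib)

lemma bil_mult:
  "bil b (\<lambda>i. of_int n * f i) g = (\<lambda>l. of_int n * bil b f g l)"
  "bil b f (\<lambda>i. of_int n * g i) = (\<lambda>l. of_int n * bil b f g l)"
  by (auto simp: bil_def fun_eq_iff sum_distrib_left mult_ac intro!: sum.cong)

context
  fixes b assumes b: "b \<in> carrier (lattice_group I3 \<sigma>3 d3)"
begin

lemma b_supp: "z \<notin> I3 \<Longrightarrow> b z = 0"
proof -
  assume z: "z \<notin> I3"
  obtain t where t: "(\<lambda>z. b z - of_int t * d3 z) \<in> lat I3 \<sigma>3" using b by (auto simp: carrier_lattice_group_iff)
  have "d3 z = 0" using z by (auto simp: diag_def triples_def split: prod.splits)
  then show "b z = 0" using latD(2)[OF t z] by simp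
qed

text \<open>Only diagonal entries of \<open>b\<close> can have a denominator, and there both weights
  coincide. One of them clears it, which leaves the other one free to absorb a denominator of
  \<open>d\<close>.\<close>

lemma b_scaled: 
  assumes "i \<in> I" "j \<in> I" "l \<in> I"
  shows "of_int (w i) * b (i, j, l) \<in> Zs (\<sigma> l)" "of_int (w j) * b (i, j, l) \<in> Zs (\<sigma> l)"
proof -
  have "of_int (w m) * b (i, j, l) \<in> Zs (\<sigma> l)" if m: "m = i \<or> m = j" for m
  proof (cases "(i, j, l) \<in> I3")
    case True
    obtain t where t: "(\<lambda>z. b z - of_int t * d3 z) \<in> lat I3 \<sigma>3" using b by (auto simp: carrier_lattice_group_iff)
    have r: "b (i, j, l) - of_int t * d3 (i, j, l) \<in> Zs (\<sigma> l)"
      using latD(1)[OF t True] True by (simp add: triples_def)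
    have "of_int (w m) * d3 (i, j, l) \<in> Zs (\<sigma> l)"
      using m w_pos[OF assms(1)] by (auto simp: diag_def)
    then have "of_int (w m) * (b (i, j, l) - of_int t * d3 (i, j, l)) + of_int t * (of_int (w m) * d3 (i, j, l)) \<in> Zs (\<sigma> l)"
      by (rule Zs_add[OF Zs_mult[OF Zs_of_int r] Zs_mult[OF Zs_of_int]])
    then show ?thesis by (simp add: algebra_simps)
  qed (simp add: b_supp)
  then show "of_int (w i) * b (i, j, l) \<in> Zs (\<sigma> l)" "of_int (w j) * b (i, j, l) \<in> Zs (\<sigma> l)" by auto
qed

lemma bil_supp: "l \<notin> I \<Longrightarrow> bil b f g l = 0"
  unfolding bil_def by (intro sum.neutral ballI) (simp add: b_supp triples_def)

lemma bil_lat_latI: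
  assumes "\<And>i j l. (i, j, l) \<in> I3 \<Longrightarrow> f i * g j * (of_int (w i) * of_int (w j) * b (i, j, l)) \<in> Zs (\<sigma> l)"
  shows "bil b f g \<in> carrier (lattice_group I \<sigma> d)"
proof -
  have "bil b f g \<in> lat I \<sigma>"
  proof (rule latI)
    fix l assume l: "l \<in> I"
    have "f i * g j * (of_int (w i) * of_int (w j) * b (i, j, l)) \<in> Zs (\<sigma> l)" for i j
      using assms[of i j l] b_supp[of "(i, j, l)"] by (cases "(i, j, l) \<in> I3") auto
    then show "bil b f g l \<in> Zs (\<sigma> l)" unfolding bil_def by (intro Zs_sum)
  qed (rule bil_supp)
  then show ?thesis using lat_subset_lattice_group by blast
qed

lemma bil_lat_lat:
  assumes "f \<in> lat I \<sigma>" "g \<in> lat I \<sigma>" shows "bil b f g \<in> carrier (lattice_group I \<sigma> d)"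
proof (rule bil_lat_latI)
  fix i j l assume z: "(i, j, l) \<in> I3"
  then have m: "i \<in> I" "j \<in> I" "l \<in> I" "\<sigma> i = \<sigma> l" "\<sigma> j = \<sigma> l" by (auto simp: triples_def)
  have fg: "f i \<in> Zs (\<sigma> l)" "g j \<in> Zs (\<sigma> l)" using latD(1)[OF assms(1) m(1)] latD(1)[OF assms(2) m(2)] m by auto
  have "f i * g j * (of_int (w i) * (of_int (w j) * b (i, j, l))) \<in> Zs (\<sigma> l)"
    by (rule Zs_mult[OF Zs_mult[OF fg] Zs_mult[OF Zs_of_int b_scaled(2)[OF m(1-3)]]])
  then show "f i * g j * (of_int (w i) * of_int (w j) * b (i, j, l)) \<in> Zs (\<sigma> l)" by (simp only: mult.assoc)
qed

text \<open>The denominator of the coordinate of \<open>d\<close> cancels against its own weight,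
  and the remaining weight clears the entry of \<open>b\<close>.\<close>

lemma bil_lat_d:
  assumes "f \<in> lat I \<sigma>" shows "bil b f d \<in> carrier (lattice_group I \<sigma> d)" "bil b d f \<in> carrier (lattice_group I \<sigma> d)"
proof -
  show "bil b f d \<in> carrier (lattice_group I \<sigma> d)"
  proof (rule bil_lat_latI)
    fix i j l assume z: "(i, j, l) \<in> I3"
    then have m: "i \<in> I" "j \<in> I" "l \<in> I" "\<sigma> i = \<sigma> l" by (auto simp: triples_def)
    have "f i \<in> Zs (\<sigma> l)" using latD(1)[OF assms m(1)] m by auto
    then have "f i * (of_int (s j) * (of_int (w i) * b (i, j, l))) \<in> Zs (\<sigma> l)"
      by (rule Zs_mult[OF _ Zs_mult[OF Zs_of_int b_scaled(1)[OF m(1-3)]]])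
    then show "f i * d j * (of_int (w i) * of_int (w j) * b (i, j, l)) \<in> Zs (\<sigma> l)"
      using w_pos[OF m(2)] by (simp add: d_eq[OF m(2)] mult_ac)
  qed
  show "bil b d f \<in> carrier (lattice_group I \<sigma> d)"
  proof (rule bil_lat_latI)
    fix i j l assume z: "(i, j, l) \<in> I3"
    then have m: "i \<in> I" "j \<in> I" "l \<in> I" "\<sigma> j = \<sigma> l" by (auto simp: triples_def)
    have "f j \<in> Zs (\<sigma> l)" using latD(1)[OF assms m(2)] m by auto
    then have "f j * (of_int (s i) * (of_int (w j) * b (i, j, l))) \<in> Zs (\<sigma> l)"
      by (rule Zs_mult[OF _ Zs_mult[OF Zs_of_int b_scaled(2)[OF m(1-3)]]])
    then show "d i * f j * (of_int (w i) * of_int (w j) * b (i, j, l)) \<in> Zs (\<sigma> l)"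
      using w_pos[OF m(1)] by (simp add: d_eq[OF m(1)] mult_ac)
  qed
qed

text \<open>Both weights are used up by the denominators of \<open>d\<close>, so
  \<open>t * s l * s l * c l / w l\<close> remains as the only term that need not be integral. By
  \<open>c l * s l = 1 + k l * w l\<close> it is \<open>t * d l\<close> plus an integer, and
  \<open>t\<close> does not depend on \<open>l\<close>.\<close>

lemma bil_d_d: "bil b d d \<in> carrier (lattice_group I \<sigma> d)"
proof -
  obtain t where t: "(\<lambda>z. b z - of_int t * d3 z) \<in> lat I3 \<sigma>3" using b by (auto simp: carrier_lattice_group_iff)
  define r where "r z = b z - of_int t * d3 z" for z
  have "(\<lambda>l. bil b d d l - of_int t * d l) \<in> lat I \<sigma>"
  proof (rule latI)
    fix l assume l: "l \<in> I"
    have r: "r (i, j, l) \<in> Zs (\<sigma> l)" if "i \<in> I" "j \<in> I" for i j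
      using latD(1)[OF t, of "(i, j, l)"] latD(2)[OF t, of "(i, j, l)"]
      by (cases "(i, j, l) \<in> I3") (auto simp: r_def triples_def)
    have "bil b d d l = (\<Sum>i\<in>I. \<Sum>j\<in>I. of_int (s i) * of_int (s j) * b (i, j, l))"
      unfolding bil_def
    proof (intro sum.cong refl)
      fix i j assume "i \<in> I" "j \<in> I"
      then show "d i * d j * (of_int (w i) * of_int (w j) * b (i, j, l)) = of_int (s i) * of_int (s j) * b (i, j, l)"
        using w_pos[of i] w_pos[of j] by (simp add: d_eq)
    qed
    \<comment> \<open>The diagonal contribution is written with nested conditionals so that the
      double sum collapses to its term at \<open>(l, l)\<close>.\<close>
    also have "\<dots> = (\<Sum>i\<in>I. \<Sum>j\<in>I. of_int (s i) * of_int (s j) * r (i, j, l) +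
        (if j = l then if i = l then of_int t * (of_int (s l) * of_int (s l) * e l) else 0 else 0))"
      by (intro sum.cong refl) (auto simp: r_def diag_def algebra_simps)
    also have "\<dots> = (\<Sum>i\<in>I. \<Sum>j\<in>I. of_int (s i) * of_int (s j) * r (i, j, l)) +
        of_int t * (of_int (s l) * of_int (s l) * e l)"
      using finI l by (simp add: sum.distrib)
    finally have B: "bil b d d l = (\<Sum>i\<in>I. \<Sum>j\<in>I. of_int (s i) * of_int (s j) * r (i, j, l)) +
        of_int t * (of_int (s l) * of_int (s l) * e l)" .
    have "of_int (s l) * (of_int (s l) * e l) = d l + of_int (s l * k l)"
    proof -
      have "(of_int (c l) * of_int (s l) :: rat) = 1 + of_int (k l) * of_int (w l)"
        using arg_cong[OF cs[OF l], of "of_int :: int \<Rightarrow> rat"] by simp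
      moreover have "of_int (s l) * (of_int (s l) * e l) = of_int (s l) * (of_int (c l) * of_int (s l)) / of_int (w l)"
        by simp
      ultimately show ?thesis using w_pos[OF l] by (simp add: d_eq[OF l] field_simps)
    qed
    then have "bil b d d l - of_int t * d l = (\<Sum>i\<in>I. \<Sum>j\<in>I. of_int (s i) * of_int (s j) * r (i, j, l)) +
        of_int (t * (s l * k l))"
      unfolding B by (simp add: mult.assoc algebra_simps)
    also have "\<dots> \<in> Zs (\<sigma> l)" by (rule Zs_add[OF _ Zs_of_int]) (use r in \<open>auto intro!: Zs_sum Zs_mult\<close>)
    finally show "bil b d d l - of_int t * d l \<in> Zs (\<sigma> l)" .
  qed (simp add: bil_supp d_supp)
  then show ?thesis by (auto simp: carrier_lattice_group_iff)
qed

lemma bil_lattice_group: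
  assumes f: "f \<in> carrier (lattice_group I \<sigma> d)" and g: "g \<in> carrier (lattice_group I \<sigma> d)"
  shows "bil b f g \<in> carrier (lattice_group I \<sigma> d)"
proof (rule lattice_group_map[OF bil_add(2) bil_mult(2) _ _ g])
  show "bil b f g \<in> carrier (lattice_group I \<sigma> d)" if "g \<in> lat I \<sigma>" for g
    by (rule lattice_group_map[where \<psi> = "\<lambda>f. bil b f g", OF bil_add(1) bil_mult(1) _ _ f])
      (use that bil_lat_lat bil_lat_d in auto)
  show "bil b f d \<in> carrier (lattice_group I \<sigma> d)"
    by (rule lattice_group_map[where \<psi> = "\<lambda>f. bil b f d", OF bil_add(1) bil_mult(1) _ _ f])
      (use bil_lat_d bil_d_d in auto)
qed

text \<open>In coordinates \<open>bil b\<close> maps the group into itself, so it lifts to the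
  tensor product. At unit vectors it returns \<open>w i * w j * b (i, j, l)\<close>, and
  \<open>ncoef\<close> removes the weights.\<close>

lemma ncoef_surj: "\<exists>\<mu>. \<mu> \<in> hom T G \<and> \<mu> \<in> extensional (carrier T) \<and> ncoef \<mu> = b"
proof -
  define E where "E x y = el (bil b (\<phi> x) (\<phi> y))" for x y
  have lattice_group: "bil b (\<phi> x) (\<phi> y) \<in> carrier (lattice_group I \<sigma> d)" if "x \<in> carrier G" "y \<in> carrier G" for x y
    using that \<phi>_img by (intro bil_lattice_group) auto
  have cl: "E x y \<in> carrier G" "\<phi> (E x y) = bil b (\<phi> x) (\<phi> y)" if "x \<in> carrier G" "y \<in> carrier G" for x y
    using \<phi>_el[OF lattice_group[OF that]] el_carrier[OF lattice_group[OF that]] by (auto simp: E_def)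
  have "\<exists>h\<in>hom T G. \<forall>x\<in>carrier G. \<forall>y\<in>carrier G. h (tens x y) = E x y"
  proof (rule tens_lift)
    show "E (x \<otimes> x') y = E x y \<otimes> E x' y" if "x \<in> carrier G" "x' \<in> carrier G" "y \<in> carrier G" for x x' y
      using that cl by (intro \<phi>_eqD) (simp_all add: \<phi>_mult bil_add)
    show "E x (y \<otimes> y') = E x y \<otimes> E x y'" if "x \<in> carrier G" "y \<in> carrier G" "y' \<in> carrier G" for x y y'
      using that cl by (intro \<phi>_eqD) (simp_all add: \<phi>_mult bil_add)
  qed (use cl comm_group_axioms in auto)
  then obtain h where h: "h \<in> hom T G" "\<And>x y. x \<in> carrier G \<Longrightarrow> y \<in> carrier G \<Longrightarrow> h (tens x y) = E x y"
    by blast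
  define \<mu> where "\<mu> = restrict h (carrier T)"
  have \<mu>: "\<mu> \<in> hom T G"
    using h(1) T.m_closed by (auto simp: \<mu>_def hom_def)
  have "ncoef \<mu> z = b z" for z
  proof -
    obtain i j l where z: "z = (i, j, l)" by (metis prod_cases3)
    show ?thesis
    proof (cases "z \<in> I3")
      case True
      then have m: "i \<in> I" "j \<in> I" "l \<in> I" by (auto simp: z triples_def)
      have "coef \<mu> i j l = bil b (single i 1) (single j 1) l"
        using h(2) cl m eps tens_closed by (simp add: coef_def[OF \<mu>] \<beta>_def[OF \<mu>]) (simp add: \<mu>_def)
      also have "\<dots> = (\<Sum>i'\<in>I. if i' = i then of_int (w i) * of_int (w j) * b (i, j, l) else 0)"
        unfolding bil_def
      proof (intro sum.cong refl)
        fix i'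
        have "(\<Sum>j'\<in>I. single i 1 i' * single j 1 j' * (of_int (w i') * of_int (w j') * b (i', j', l))) =
          (\<Sum>j'\<in>I. if j' = j then (if i' = i then of_int (w i) * of_int (w j) * b (i, j, l) else 0) else 0)"
          by (intro sum.cong refl) (auto simp: single_def)
        then show "(\<Sum>j'\<in>I. single i 1 i' * single j 1 j' * (of_int (w i') * of_int (w j') * b (i', j', l))) =
          (if i' = i then of_int (w i) * of_int (w j) * b (i, j, l) else 0)"
          using finI m by simp
      qed
      also have "\<dots> = of_int (w i) * of_int (w j) * b (i, j, l)" using finI m by simp
      finally show ?thesis using True w_pos[OF m(1)] w_pos[OF m(2)] by (simp add: ncoef_def[OF \<mu>] z)
    next
      case False
      then show ?thesis using b_supp by (simp add: ncoef_def[OF \<mu>] z)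
    qed
  qed
  with \<mu> show ?thesis by (intro exI[of _ \<mu>]) (auto simp: \<mu>_def fun_eq_iff)
qed

end

lemma carrier_Mult: "carrier (Mult_group G) = hom T G \<inter> extensional (carrier T)"
  by (simp add: Mult_group_def hom_group_def)

lemma mult_Mult: "\<mu> \<otimes>\<^bsub>Mult_group G\<^esub> \<nu> = (\<lambda>u\<in>carrier T. \<mu> u \<otimes> \<nu> u)"
  by (simp add: Mult_group_def hom_group_def)

lemma Mult_closed:
  assumes "\<mu> \<in> carrier (Mult_group G)" "\<nu> \<in> carrier (Mult_group G)"
  shows "\<mu> \<otimes>\<^bsub>Mult_group G\<^esub> \<nu> \<in> carrier (Mult_group G)"
proof -
  have h: "\<mu> \<in> hom T G" "\<nu> \<in> hom T G" using assms by (auto simp: carrier_Mult)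
  have "(\<lambda>u\<in>carrier T. \<mu> u \<otimes> \<nu> u) \<in> hom T G"
    by (rule homI) (use h T.m_closed hom_in_carrier[OF h(1)] hom_in_carrier[OF h(2)] in
      \<open>auto simp: hom_mult[OF h(1)] hom_mult[OF h(2)] m_ac\<close>)
  then show ?thesis by (simp add: carrier_Mult mult_Mult)
qed

text \<open>Injective because the coefficients determine all values on elementary tensors and these
  generate; \<open>ncoef_in\<close> and \<open>ncoef_surj\<close> give the image.\<close>

lemma Mult_iso: "ncoef \<in> iso (Mult_group G) (lattice_group I3 \<sigma>3 d3)"
proof -
  have "ncoef \<in> hom (Mult_group G) (lattice_group I3 \<sigma>3 d3)"
  proof (rule homI)
    fix \<mu> assume "\<mu> \<in> carrier (Mult_group G)"
    then show "ncoef \<mu> \<in> carrier (lattice_group I3 \<sigma>3 d3)" using ncoef_in by (simp add: carrier_Mult)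
  next
    fix \<mu> \<nu> assume "\<mu> \<in> carrier (Mult_group G)" "\<nu> \<in> carrier (Mult_group G)"
    then have h: "\<mu> \<in> hom T G" "\<nu> \<in> hom T G"
      and p: "(\<lambda>u\<in>carrier T. \<mu> u \<otimes> \<nu> u) \<in> hom T G"
      using Mult_closed[of \<mu> \<nu>] by (auto simp: carrier_Mult mult_Mult)
    have "coef (\<lambda>u\<in>carrier T. \<mu> u \<otimes> \<nu> u) i j l = coef \<mu> i j l + coef \<nu> i j l" if "i \<in> I" "j \<in> I" for i j l
      using that eps tens_closed hom_in_carrier[OF h(1)] hom_in_carrier[OF h(2)]
      by (simp add: coef_def[OF p] coef_def[OF h(1)] coef_def[OF h(2)]
          \<beta>_def[OF p] \<beta>_def[OF h(1)] \<beta>_def[OF h(2)] \<phi>_mult)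
    then show "ncoef (\<mu> \<otimes>\<^bsub>Mult_group G\<^esub> \<nu>) = ncoef \<mu> \<otimes>\<^bsub>lattice_group I3 \<sigma>3 d3\<^esub> ncoef \<nu>"
      by (auto simp: mult_Mult ncoef_def[OF p] ncoef_def[OF h(1)] ncoef_def[OF h(2)] fun_eq_iff
          add_divide_distrib triples_def)
  qed
  moreover have "inj_on ncoef (carrier (Mult_group G))"
  proof (rule inj_onI)
    fix \<mu> \<nu> assume m: "\<mu> \<in> carrier (Mult_group G)" "\<nu> \<in> carrier (Mult_group G)" and eq: "ncoef \<mu> = ncoef \<nu>"
    then have h: "\<mu> \<in> hom T G" "\<nu> \<in> hom T G" by (auto simp: carrier_Mult)
    have c: "coef \<mu> i j l = coef \<nu> i j l" if ij: "i \<in> I" "j \<in> I" for i j l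
    proof (cases "(i, j, l) \<in> I3")
      case True
      then show ?thesis
        using fun_cong[OF eq, of "(i, j, l)"] w_pos[OF ij(1)] w_pos[OF ij(2)] by (simp add: ncoef_def[OF h(1)] ncoef_def[OF h(2)])
    next
      case False
      then show ?thesis using coef_zero[OF h(1) ij] coef_zero[OF h(2) ij] by simp
    qed
    have "\<mu> (tens x y) = \<nu> (tens x y)" if xy: "x \<in> carrier G" "y \<in> carrier G" for x y
    proof -
      have "\<phi> (\<beta> \<mu> x y) l = \<phi> (\<beta> \<nu> x y) l" for l
        unfolding \<beta>_expand[OF h(1) xy] \<beta>_expand[OF h(2) xy] by (intro sum.cong refl) (simp add: c)
      then have "\<beta> \<mu> x y = \<beta> \<nu> x y"
        using \<beta>_closed[OF h(1) xy] \<beta>_closed[OF h(2) xy] by (intro \<phi>_eqD) auto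
      then show ?thesis by (simp add: \<beta>_def[OF h(1)] \<beta>_def[OF h(2)])
    qed
    then have "\<mu> u = \<nu> u" if "u \<in> carrier T" for u
      by (rule tens_hom_ext[OF is_group h _ that])
    then show "\<mu> = \<nu>" using m by (intro extensionalityI[of _ "carrier T"]) (auto simp: carrier_Mult)
  qed
  moreover have "ncoef ` carrier (Mult_group G) = carrier (lattice_group I3 \<sigma>3 d3)"
    using ncoef_in ncoef_surj by (auto simp: carrier_Mult image_iff)
  ultimately show ?thesis by (simp add: iso_def bij_betw_def)
qed

end

section \<open>Realization\<close>

lemma mult_coord_exists:
  assumes p: "pure_coord G I \<sigma> d \<phi>" and sp: "sparse I \<sigma> d"
  shows "\<exists>s w c k. mult_coord G I \<sigma> d \<phi> s w c k"
proof -
  define s w where "s i = fst (quotient_of (d i))" and "w i = snd (quotient_of (d i))" for i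
  have q: "quotient_of (d i) = (s i, w i)" for i by (simp add: s_def w_def)
  have "\<exists>c k. c * s i = 1 + k * w i" for i
  proof -
    obtain u v where "u * s i + v * w i = 1"
      using bezout_int[of "s i" "w i"] quotient_of_coprime[OF q[of i]] by (auto simp: coprime_iff_gcd_eq_1)
    then show ?thesis by (intro exI[of _ u] exI[of _ "- v"]) (simp add: algebra_simps)
  qed
  then obtain c k where ck: "\<And>i. c i * s i = 1 + k i * w i" by metis
  \<comment> \<open>The reduced fraction of 0 has denominator 1, so a vanishing coordinate of a
    sparse \<open>d\<close> has weight 1.\<close>
  have one: "w i = 1" if "d i = 0" for i using that by (simp add: w_def)
  have "mult_coord G I \<sigma> d \<phi> s w c k"
  proof (intro mult_coord.intro p mult_coord_axioms.intro)
    show "w i = 1 \<or> w j = 1" if "i \<in> I" "j \<in> I" "i \<noteq> j" "\<sigma> i = \<sigma> j" for i j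
      using sp that one unfolding sparse_def by blast
  qed (use q quotient_of_denom_pos quotient_of_div ck in auto)
  then show ?thesis by blast
qed

section \<open>Reindexing and transport to another type\<close>

lemma lattice_group_reindex:
  assumes \<pi>: "bij_betw \<pi> J I" and \<rho>: "\<And>j. j \<in> J \<Longrightarrow> \<sigma> (\<pi> j) = \<rho> j"
    and d': "\<And>j. j \<in> J \<Longrightarrow> d' j = d (\<pi> j)" "\<And>j. j \<notin> J \<Longrightarrow> d' j = 0" and d: "\<And>i. i \<notin> I \<Longrightarrow> d i = 0"
  shows "(\<lambda>f i. if i \<in> I then f (inv_into J \<pi> i) else (0::rat)) \<in> iso (lattice_group J \<rho> d') (lattice_group I \<sigma> d)"
proof -
  let ?\<pi>' = "inv_into J \<pi>"
  let ?\<psi> = "\<lambda>f i. if i \<in> I then f (?\<pi>' i) else (0::rat)"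
  let ?\<psi>' = "\<lambda>f j. if j \<in> J then f (\<pi> j) else (0::rat)"
  have \<pi>': "?\<pi>' i \<in> J" "\<pi> (?\<pi>' i) = i" if "i \<in> I" for i
    using bij_betw_inv_into_right[OF \<pi> that] bij_betwE[OF bij_betw_inv_into[OF \<pi>]] that by auto
  have \<pi>J: "\<pi> j \<in> I" "?\<pi>' (\<pi> j) = j" if "j \<in> J" for j
    using bij_betw_inv_into_left[OF \<pi> that] bij_betwE[OF \<pi>] that by auto
  have supp: "f j = 0" if f: "f \<in> carrier (lattice_group J \<rho> d')" and j: "j \<notin> J" for f j
  proof -
    obtain t where t: "(\<lambda>j. f j - of_int t * d' j) \<in> lat J \<rho>" using f by (auto simp: carrier_lattice_group_iff)
    show ?thesis using latD(2)[OF t j] d'(2)[OF j] by simp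
  qed
  have supp': "f i = 0" if f: "f \<in> carrier (lattice_group I \<sigma> d)" and i: "i \<notin> I" for f i
  proof -
    obtain t where t: "(\<lambda>i. f i - of_int t * d i) \<in> lat I \<sigma>" using f by (auto simp: carrier_lattice_group_iff)
    show ?thesis using latD(2)[OF t i] d[OF i] by simp
  qed
  have m1: "?\<psi> f \<in> carrier (lattice_group I \<sigma> d)" if f: "f \<in> carrier (lattice_group J \<rho> d')" for f
  proof (rule lattice_group_map[where \<psi> = ?\<psi>, OF _ _ _ _ f])
    show "?\<psi> h \<in> carrier (lattice_group I \<sigma> d)" if h: "h \<in> lat J \<rho>" for h
    proof -
      have "?\<psi> h \<in> lat I \<sigma>"
      proof (rule latI)
        fix i assume i: "i \<in> I"
        have "h (?\<pi>' i) \<in> Zs (\<sigma> (\<pi> (?\<pi>' i)))" unfolding \<rho>[OF \<pi>'(1)[OF i]] by (rule latD(1)[OF h \<pi>'(1)[OF i]])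
        then show "?\<psi> h i \<in> Zs (\<sigma> i)" using i \<pi>'(2)[OF i] by simp
      qed simp
      then show ?thesis using lat_subset_lattice_group by blast
    qed
    have "?\<psi> d' = d" using d' d \<pi>' by (auto simp: fun_eq_iff)
    then show "?\<psi> d' \<in> carrier (lattice_group I \<sigma> d)" using d_in_lattice_group by metis
  qed (auto simp: fun_eq_iff)
  have m2: "?\<psi>' f \<in> carrier (lattice_group J \<rho> d')" if f: "f \<in> carrier (lattice_group I \<sigma> d)" for f
  proof (rule lattice_group_map[where \<psi> = ?\<psi>', OF _ _ _ _ f])
    show "?\<psi>' h \<in> carrier (lattice_group J \<rho> d')" if h: "h \<in> lat I \<sigma>" for h
    proof -
      have "?\<psi>' h \<in> lat J \<rho>"
        by (rule latI) (use \<pi>J \<rho> latD(1)[OF h] in fastforce)+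
      then show ?thesis using lat_subset_lattice_group by blast
    qed
    have "?\<psi>' d = d'" using d' by (auto simp: fun_eq_iff)
    then show "?\<psi>' d \<in> carrier (lattice_group J \<rho> d')" using d_in_lattice_group by metis
  qed (auto simp: fun_eq_iff)
  have "bij_betw ?\<psi> (carrier (lattice_group J \<rho> d')) (carrier (lattice_group I \<sigma> d))"
  proof (rule bij_betw_byWitness[of _ ?\<psi>'])
    show "\<forall>f\<in>carrier (lattice_group J \<rho> d'). ?\<psi>' (?\<psi> f) = f" using supp \<pi>J by (auto simp: fun_eq_iff)
    show "\<forall>f\<in>carrier (lattice_group I \<sigma> d). ?\<psi> (?\<psi>' f) = f" using supp' \<pi>' by (auto simp: fun_eq_iff)
  qed (use m1 m2 in auto)
  then show ?thesis using m1 by (auto simp: iso_def hom_def fun_eq_iff)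
qed

text \<open>Asks only for closure of the multiplication, so that \<open>Mult_iso\<close> can be
  inverted without establishing the group laws of \<open>Mult_group\<close>.\<close>

lemma iso_sym_closed:
  assumes h: "h \<in> iso G H" and closed: "\<And>x y. x \<in> carrier G \<Longrightarrow> y \<in> carrier G \<Longrightarrow> x \<otimes>\<^bsub>G\<^esub> y \<in> carrier G"
  shows "inv_into (carrier G) h \<in> iso H G"
proof -
  let ?g = "inv_into (carrier G) h"
  have bij: "bij_betw h (carrier G) (carrier H)" using h by (simp add: iso_def)
  have g: "?g x \<in> carrier G" "h (?g x) = x" if "x \<in> carrier H" for x
    using bij_betw_inv_into_right[OF bij that] bij_betwE[OF bij_betw_inv_into[OF bij]] that by auto
  have "?g (x \<otimes>\<^bsub>H\<^esub> y) = ?g x \<otimes>\<^bsub>G\<^esub> ?g y" if xy: "x \<in> carrier H" "y \<in> carrier H" for x y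
  proof -
    have "h (?g x \<otimes>\<^bsub>G\<^esub> ?g y) = x \<otimes>\<^bsub>H\<^esub> y"
      using h g[OF xy(1)] g[OF xy(2)] by (simp add: iso_def hom_def)
    then show ?thesis
      using bij_betw_inv_into_left[OF bij closed[OF g(1)[OF xy(1)] g(1)[OF xy(2)]]] by simp
  qed
  then show ?thesis using bij_betw_inv_into[OF bij] g(1) by (auto simp: iso_def hom_def)
qed

text \<open>An element is determined by its finitely many rational coordinates at
  \<open>I\<close>.\<close>

lemma countable_lattice_group:
  assumes "finite I" "\<And>i. i \<notin> I \<Longrightarrow> d i = 0" shows "countable (carrier (lattice_group I \<sigma> d))"
proof -
  obtain xs where xs: "set xs = I" using finite_list[OF assms(1)] by blast
  have supp: "f i = 0" if f: "f \<in> carrier (lattice_group I \<sigma> d)" and i: "i \<notin> I" for f i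
  proof -
    obtain t where t: "(\<lambda>i. f i - of_int t * d i) \<in> lat I \<sigma>" using f by (auto simp: carrier_lattice_group_iff)
    show ?thesis using latD(2)[OF t i] assms(2)[OF i] by simp
  qed
  have "inj_on (\<lambda>f. map f xs) (carrier (lattice_group I \<sigma> d))"
  proof (rule inj_onI, rule ext)
    fix f g i assume fg: "f \<in> carrier (lattice_group I \<sigma> d)" "g \<in> carrier (lattice_group I \<sigma> d)" "map f xs = map g xs"
    show "f i = g i" using fg(3) xs supp[OF fg(1), of i] supp[OF fg(2), of i] by (cases "i \<in> I") auto
  qed
  then show ?thesis by (rule countable_image_inj_on[OF countableI_type])
qed

text \<open>The carrier embeds into the infinite type by way of the natural numbers, and the
  structure is carried along.\<close>

lemma (in comm_group) transport_countable:
  assumes inf: "infinite (UNIV :: 'g set)" and cnt: "countable (carrier G)"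
  shows "\<exists>(H :: 'g monoid) h. comm_group H \<and> h \<in> iso H G"
proof -
  obtain u :: "nat \<Rightarrow> 'g" where u: "inj u" using infinite_countable_subset[OF inf] by blast
  obtain v :: "'a \<Rightarrow> nat" where v: "inj_on v (carrier G)" using cnt unfolding countable_def by blast
  define f where "f x = u (v x)" for x
  have f: "inj_on f (carrier G)" using u v by (auto simp: f_def inj_on_def)
  define h where "h = inv_into (carrier G) f"
  have hf: "h (f x) = x" if "x \<in> carrier G" for x using f that by (simp add: h_def)
  define H :: "'g monoid" where "H = \<lparr>carrier = f ` carrier G, monoid.mult = (\<lambda>x y. f (h x \<otimes> h y)), one = f \<one>\<rparr>"
  have "comm_group H"
  proof (rule comm_groupI)
    fix x assume "x \<in> carrier H"
    then obtain y where y: "y \<in> carrier G" "x = f y" by (auto simp: H_def)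
    show "\<exists>z\<in>carrier H. z \<otimes>\<^bsub>H\<^esub> x = \<one>\<^bsub>H\<^esub>"
      using y by (intro bexI[of _ "f (inv y)"]) (auto simp: H_def hf)
  qed (auto simp: H_def hf m_ac)
  moreover have "h \<in> iso H G"
  proof -
    have "bij_betw h (carrier H) (carrier G)"
      by (rule bij_betw_byWitness[of _ f]) (auto simp: H_def hf)
    then show ?thesis by (auto simp: iso_def hom_def H_def hf)
  qed
  ultimately show ?thesis by blast
qed

text \<open>Matching a block of triples with a block of \<open>M\<close> by size is not enough: the
  triple with the denominator has to go to the coordinate with the denominator.\<close>

lemma bij_betw_pointed:
  assumes fin: "finite A" "finite B" "card A = card B" and ab: "a \<in> A" "b \<in> B"
  shows "\<exists>f. bij_betw f A B \<and> f a = b"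
proof -
  have "card (A - {a}) = card (B - {b})" using assms by simp
  then obtain g where g: "bij_betw g (A - {a}) (B - {b})"
    using finite_same_card_bij[of "A - {a}" "B - {b}"] fin by auto
  have "bij_betw (g(a := b)) (insert a (A - {a})) (insert b (B - {b}))"
    using g by (auto simp: bij_betw_def inj_on_def)
  then show ?thesis using ab by (intro exI[of _ "g(a := b)"]) (simp add: insert_absorb)
qed

lemma bij_betw_fibers:
  assumes "\<And>S. S \<in> \<S> \<Longrightarrow> bij_betw (f S) {x \<in> A. p x = S} {y \<in> B. q y = S}"
    and "p ` A \<subseteq> \<S>" "q ` B \<subseteq> \<S>"
  shows "bij_betw (\<lambda>x. f (p x) x) A B" "x \<in> A \<Longrightarrow> q (f (p x) x) = p x"
proof -
  have bij: "bij_betw (f (p x)) {z \<in> A. p z = p x} {y \<in> B. q y = p x}" if "x \<in> A" for x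
    using assms(1)[of "p x"] assms(2) that by blast
  have f: "f (p x) x \<in> B" "q (f (p x) x) = p x" if "x \<in> A" for x
    using bij_betw_apply[OF bij[OF that], of x] that by simp_all
  then show "x \<in> A \<Longrightarrow> q (f (p x) x) = p x" by simp
  show "bij_betw (\<lambda>x. f (p x) x) A B"
    unfolding bij_betw_def
  proof (intro conjI inj_onI equalityI subsetI)
    fix x y assume xy: "x \<in> A" "y \<in> A" "f (p x) x = f (p y) y"
    have e: "p y = p x" using f(2)[OF xy(1)] f(2)[OF xy(2)] xy(3) by simp
    show "x = y"
      by (rule inj_onD[OF bij_betw_imp_inj_on[OF bij[OF xy(1)]]]) (use xy e in simp_all)
  next
    fix y assume y: "y \<in> B"
    then have "bij_betw (f (q y)) {z \<in> A. p z = q y} {z \<in> B. q z = q y}"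
      using assms(1)[of "q y"] assms(3) by blast
    then have "f (q y) ` {z \<in> A. p z = q y} = {z \<in> B. q z = q y}" by (rule bij_betw_imp_surj_on)
    moreover have "y \<in> {z \<in> B. q z = q y}" using y by simp
    ultimately have "y \<in> f (q y) ` {z \<in> A. p z = q y}" by simp
    then obtain x where x: "x \<in> A" "p x = q y" "y = f (q y) x" by blast
    show "y \<in> (\<lambda>x. f (p x) x) ` A" by (rule image_eqI[of _ _ x]) (use x in simp_all)
  next
    fix y assume "y \<in> (\<lambda>x. f (p x) x) ` A"
    then show "y \<in> B" using f(1) by blast
  qed
qed

text \<open>Inverting twice modulo \<open>w\<close> leads back: a group with values
  \<open>c / w\<close> has multiplications with values \<open>s / w\<close>, which are those of
  \<open>M\<close>. Its block for \<open>S\<close> gets as many coordinates as the cube root of the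
  size of the block in \<open>M\<close>.\<close>

lemma realization:
  fixes M :: "('a, 'm) monoid_scheme"
  assumes M: "mult_coord M I \<sigma> d \<phi> s w c k"
    and sp: "sparse I \<sigma> d"
    and cubes: "\<And>S. S \<in> \<sigma> ` I \<Longrightarrow> \<exists>n>0. card {i \<in> I. \<sigma> i = S} = n ^ 3"
    and inf: "infinite (UNIV :: 'g set)"
  shows "\<exists>G :: 'g monoid. class_A0 G \<and> M \<cong> Mult_group G"
proof -
  interpret M: mult_coord M I \<sigma> d \<phi> s w c k by fact
  obtain n where n: "\<And>S. S \<in> \<sigma> ` I \<Longrightarrow> n S > 0 \<and> card {i \<in> I. \<sigma> i = S} = n S ^ 3"
    using cubes by metis
  \<comment> \<open>\<open>z S\<close> will be the coordinate of the block that may carry a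
    denominator; if \<open>d\<close> vanishes on the block, any coordinate serves.\<close>
  have "\<exists>z\<in>I. \<sigma> z = S \<and> (\<forall>i\<in>I. \<sigma> i = S \<longrightarrow> i \<noteq> z \<longrightarrow> d i = 0)" if S: "S \<in> \<sigma> ` I" for S
  proof (cases "\<exists>z\<in>I. \<sigma> z = S \<and> d z \<noteq> 0")
    case True
    then show ?thesis using sp unfolding sparse_def by metis
  next
    case False
    then show ?thesis using S by auto
  qed
  then obtain z where z: "\<And>S. S \<in> \<sigma> ` I \<Longrightarrow> z S \<in> I \<and> \<sigma> (z S) = S \<and> (\<forall>i\<in>I. \<sigma> i = S \<longrightarrow> i \<noteq> z S \<longrightarrow> d i = 0)"
    by metis
  \<comment> \<open>\<open>(S, m)\<close> is the \<open>m\<close>-th coordinate of the block \<open>S\<close>; the only denominator sits at \<open>m = 0\<close>.\<close>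
  define J where "J = Sigma (\<sigma> ` I) (\<lambda>S. {..<n S})"
  define \<rho> :: "nat set \<times> nat \<Rightarrow> nat set" where "\<rho> = fst"
  define pick where "pick f a j = (if snd j = (0::nat) then f (z (fst j)) else (a::int))" for f a j
  define d' :: "nat set \<times> nat \<Rightarrow> rat" where
    "d' j = (if j \<in> J then of_int (pick c 0 j) / of_int (pick w 1 j) else 0)" for j
  have finJ: "finite J" using M.finI by (auto simp: J_def)
  have zJ: "z (\<rho> j) \<in> I" "\<sigma> (z (\<rho> j)) = \<rho> j" "\<rho> j \<in> \<sigma> ` I" if "j \<in> J" for j
    using that z by (auto simp: J_def \<rho>_def)
  have J0: "(S, 0) \<in> J" "\<rho> (S, 0) = S" if "S \<in> \<sigma> ` I" for S
    using that n[OF that] by (auto simp: J_def \<rho>_def)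
  \<comment> \<open>As for \<open>pure_triples\<close>, purity of \<open>d\<close> passes through
    \<open>Zs_frac_swap\<close>; the coordinate \<open>(S, 0)\<close> now stands for
    \<open>z S\<close>.\<close>
  have pure: "pure_data J \<rho> d'"
    unfolding pure_data_def
  proof (intro ballI allI impI)
    fix S and t :: int and j
    assume S: "S \<in> \<rho> ` J" and j: "j \<in> J"
      and *: "\<forall>j\<in>J. \<rho> j \<noteq> S \<longrightarrow> of_int t * d' j \<in> Zs (\<rho> j)"
    have "of_int t * d i \<in> Zs (\<sigma> i)" if i: "i \<in> I" "\<sigma> i \<noteq> S" for i
    proof (cases "i = z (\<sigma> i)")
      case True
      have "of_int t * d' (\<sigma> i, 0) \<in> Zs (\<sigma> i)"
        using bspec[OF *, of "(\<sigma> i, 0)"] J0[of "\<sigma> i"] i by simp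
      then have "of_int t * (of_int (c i) / of_int (w i)) \<in> Zs (\<sigma> i)"
        using J0[of "\<sigma> i"] i True by (simp add: d'_def pick_def)
      then show ?thesis
        unfolding M.d_eq[OF i(1)]
        by (rule Zs_frac_swap[OF M.w_pos[OF i(1)], rotated, where k = "k i"])
          (use M.cs[OF i(1)] in \<open>simp add: mult.commute\<close>)
    next
      case False
      then show ?thesis using z[of "\<sigma> i"] i by simp
    qed
    moreover have "S \<in> \<sigma> ` I" using S zJ by auto
    ultimately have d: "of_int t * d i \<in> Zs (\<sigma> i)" if "i \<in> I" for i
      using M.pure that unfolding pure_data_def by blast
    show "of_int t * d' j \<in> Zs (\<rho> j)"
    proof (cases "snd j = 0")
      case True
      note i = zJ(1)[OF j]
      have "of_int t * (of_int (c (z (\<rho> j))) / of_int (w (z (\<rho> j)))) \<in> Zs (\<rho> j)"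
        using d[OF i] unfolding M.d_eq[OF i] zJ(2)[OF j] by (rule Zs_frac_swap[OF M.w_pos[OF i] M.cs[OF i]])
      then show ?thesis using True j by (simp add: d'_def pick_def \<rho>_def)
    qed (simp add: d'_def pick_def)
  qed
  interpret N: comm_group "lattice_group J \<rho> d'" by (rule comm_group_lattice_group)
  have "countable (carrier (lattice_group J \<rho> d'))" by (rule countable_lattice_group[OF finJ]) (simp add: d'_def)
  then obtain H :: "'g monoid" and h where H: "comm_group H" "h \<in> iso H (lattice_group J \<rho> d')"
    using N.transport_countable[OF inf] by blast
  have primesJ: "Factorial_Ring.prime p" if "j \<in> J" "p \<in> \<rho> j" for j p
    using M.primes[of "z (\<rho> j)" p] zJ[OF that(1)] that(2) by simp
  have antichainJ: "\<rho> i = \<rho> j" if "i \<in> J" "j \<in> J" "\<rho> i \<subseteq> \<rho> j" for i j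
    using M.antichain[of "z (\<rho> i)" "z (\<rho> j)"] zJ[OF that(1)] zJ[OF that(2)] that(3) by simp
  \<comment> \<open>Off the coordinates \<open>(S, 0)\<close> the default values 0, 0, 1 and -1 for
    \<open>s\<close>, \<open>c\<close>, \<open>w\<close> and \<open>k\<close> satisfy this too,
    since \<open>0 * 0 = 1 + (-1) * 1\<close>.\<close>
  have pcs: "pick s 0 j * pick c 0 j = 1 + pick k (-1) j * pick w 1 j" if "j \<in> J" for j
    using M.cs[OF zJ(1)[OF that]] by (simp add: pick_def \<rho>_def mult.commute)
  \<comment> \<open>The numerators \<open>c\<close> and their inverses \<open>s\<close> are passed
    in exchanged positions, so the extra vector \<open>H.d3\<close> of the multiplications has the
    values \<open>s / w\<close> of \<open>d\<close>.\<close>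
  interpret H: mult_coord H J \<rho> d' h "pick c 0" "pick w 1" "pick s 0" "pick k (-1)"
  proof (intro mult_coord.intro pure_coord.intro coord.intro H(1) coord_axioms.intro
      pure_coord_axioms.intro mult_coord_axioms.intro)
    show "pick w 1 j > 0" if "j \<in> J" for j
      using M.w_pos[OF zJ(1)[OF that]] by (simp add: pick_def \<rho>_def)
    show "pick w 1 i = 1 \<or> pick w 1 j = 1" if "i \<in> J" "j \<in> J" "i \<noteq> j" "\<rho> i = \<rho> j" for i j
      using that by (auto simp: pick_def \<rho>_def prod_eq_iff)
  qed (use finJ primesJ antichainJ pure pcs H(2) in \<open>auto simp: d'_def\<close>)
  \<comment> \<open>Both sides have \<open>n S ^ 3\<close> elements, and the triple carrying the
    denominator is matched with \<open>z S\<close>.\<close>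
  have ex: "\<exists>f. bij_betw f {x \<in> triples J \<rho>. \<rho> (fst x) = S} {i \<in> I. \<sigma> i = S} \<and> f ((S, 0), (S, 0), (S, 0)) = z S"
    if S: "S \<in> \<sigma> ` I" for S
  proof (rule bij_betw_pointed)
    have "{j \<in> J. \<rho> j = S} = {S} \<times> {..<n S}"
    proof (intro equalityI subsetI)
      show "j \<in> {S} \<times> {..<n S}" if "j \<in> {j \<in> J. \<rho> j = S}" for j
        using that by (cases j) (simp add: J_def \<rho>_def)
      show "j \<in> {j \<in> J. \<rho> j = S}" if "j \<in> {S} \<times> {..<n S}" for j
        using that S by (cases j) (simp add: J_def \<rho>_def)
    qed
    then have "card {j \<in> J. \<rho> j = S} = n S" by (simp add: card_cartesian_product_singleton)
    then show "card {x \<in> triples J \<rho>. \<rho> (fst x) = S} = card {i \<in> I. \<sigma> i = S}"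
      using n[OF S] by (simp add: card_triples_block[OF finJ])
    show "((S, 0), (S, 0), (S, 0)) \<in> {x \<in> triples J \<rho>. \<rho> (fst x) = S}"
      using J0[OF S] by (simp add: triples_def)
    show "z S \<in> {i \<in> I. \<sigma> i = S}" using z[OF S] by simp
  qed (use finite_triples[OF finJ, of \<rho>] M.finI in auto)
  define f where "f S = (SOME f. bij_betw f {x \<in> triples J \<rho>. \<rho> (fst x) = S} {i \<in> I. \<sigma> i = S} \<and>
    f ((S, 0), (S, 0), (S, 0)) = z S)" for S
  have f: "bij_betw (f S) {x \<in> triples J \<rho>. \<rho> (fst x) = S} {i \<in> I. \<sigma> i = S}"
    "f S ((S, 0), (S, 0), (S, 0)) = z S" if "S \<in> \<sigma> ` I" for S
    unfolding f_def
    by (rule conjunct1[OF someI_ex[OF ex[OF that]]], rule conjunct2[OF someI_ex[OF ex[OF that]]])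
  define \<pi> where "\<pi> x = f (\<rho> (fst x)) x" for x
  have sub: "(\<lambda>x. \<rho> (fst x)) ` triples J \<rho> \<subseteq> \<sigma> ` I"
    unfolding image_triples using zJ(3) by auto
  have \<pi>: "bij_betw \<pi> (triples J \<rho>) I"
    unfolding \<pi>_def by (rule bij_betw_fibers(1)[OF f(1) sub]) auto
  have \<pi>_block: "\<sigma> (\<pi> x) = \<rho> (fst x)" if "x \<in> triples J \<rho>" for x
    unfolding \<pi>_def by (rule bij_betw_fibers(2)[OF f(1) sub _ that]) auto
  \<comment> \<open>At the distinguished triple both sides are \<open>s / w\<close> of the
    coordinate \<open>z S\<close>; everywhere else in the block both are 0.\<close>
  have diag_\<pi>: "H.d3 x = d (\<pi> x)" if x: "x \<in> triples J \<rho>" for x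
  proof -
    define S where "S = \<rho> (fst x)"
    have S: "S \<in> \<sigma> ` I" using sub x by (auto simp: S_def)
    let ?x0 = "((S, 0::nat), (S, 0::nat), (S, 0::nat))"
    have x0: "?x0 \<in> triples J \<rho>" "\<pi> ?x0 = z S"
      using J0[OF S] f(2)[OF S] by (auto simp: triples_def \<pi>_def)
    show ?thesis
    proof (cases "x = ?x0")
      case True
      then show ?thesis
        using x0 J0(1)[OF S] M.d_eq[of "z S"] z[OF S] by (simp add: diag_def pick_def)
    next
      case False
      have "\<pi> x \<noteq> z S"
        using False x x0 \<pi> by (metis bij_betw_inv_into_left)
      moreover have "\<pi> x \<in> I" using \<pi> x by (auto dest: bij_betwE)
      ultimately have "d (\<pi> x) = 0" using z[OF S] \<pi>_block[OF x] by (simp add: S_def)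
      moreover have "H.d3 x = 0"
        using False by (auto simp: diag_def pick_def S_def \<rho>_def split: prod.splits)
      ultimately show ?thesis by simp
    qed
  qed
  have "(\<lambda>f i. if i \<in> I then f (inv_into (triples J \<rho>) \<pi> i) else (0::rat)) \<in>
    iso (lattice_group (triples J \<rho>) (\<lambda>x. \<rho> (fst x)) H.d3) (lattice_group I \<sigma> d)"
  proof (rule lattice_group_reindex[OF \<pi>])
    show "H.d3 x = 0" if "x \<notin> triples J \<rho>" for x
      using that by (auto simp: diag_def triples_def split: prod.splits)
  qed (simp_all add: \<pi>_block diag_\<pi> M.d_supp)
  then have "Mult_group H \<cong> lattice_group I \<sigma> d"
    using iso_set_trans[OF H.Mult_iso] is_isoI by blast
  then obtain g where "g \<in> iso (Mult_group H) (lattice_group I \<sigma> d)" by (auto simp: is_iso_def)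
  then have "inv_into (carrier (Mult_group H)) g \<in> iso (lattice_group I \<sigma> d) (Mult_group H)"
    by (rule iso_sym_closed) (rule H.Mult_closed)
  then have "M \<cong> Mult_group H"
    using iso_set_trans[OF M.\<phi>_iso] is_isoI by blast
  then show ?thesis using H.class_A0 by blast
qed

text \<open>\<open>G\<close> ranges over the groups on an arbitrary infinite type \<open>'g\<close>;
  the realizing group is countable and so has a copy there. The cube condition is imposed for every
  decomposition of the regulator, which for a member of the class amounts to imposing it for one,
  because by \<open>Reg_part_eq\<close> the summands are the blocks.\<close>

theorem theorem4p2:
  fixes M :: "('a, 'm) monoid_scheme"
  assumes "comm_group M"
    and "infinite (UNIV :: 'g set)"
  shows "(\<exists>G :: 'g monoid. class_A0 G \<and> M \<cong> Mult_group G) \<longleftrightarrow>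
         class_A0 M \<and>
         (\<forall>\<D>. rank1_decomposition M (Reg M) \<D> \<longrightarrow>
            (\<forall>\<tau>\<in>critical_types M \<D>.
               \<exists>k::nat. k > 0 \<and> group_rank (M\<lparr>carrier := Reg_part M \<D> \<tau>\<rparr>) = enat (k ^ 3)))"
    (is "?lhs \<longleftrightarrow> class_A0 M \<and> ?cubes")
proof
  assume ?lhs
  then obtain G :: "'g monoid" and h where G: "class_A0 G" "h \<in> iso M (Mult_group G)"
    by (auto simp: is_iso_def)
  obtain I :: "'g set set" and \<sigma> d \<phi> where norm: "pure_coord G I \<sigma> d \<phi>" "sparse I \<sigma> d"
    using class_A0_normal_form[OF G(1)] by blast
  obtain s w c k where "mult_coord G I \<sigma> d \<phi> s w c k" using mult_coord_exists[OF norm] by blast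
  then interpret G: mult_coord G I \<sigma> d \<phi> s w c k .
  have iso: "G.ncoef \<circ> h \<in> iso M (lattice_group G.I3 G.\<sigma>3 G.d3)"
    using iso_set_trans[OF G(2) G.Mult_iso] by (simp add: o_def)
  \<comment> \<open>Through the isomorphism \<open>M\<close> itself receives pure coordinates
    indexed by triples, from which its regulator and the ranks of its blocks can be read
    off.\<close>
  interpret M: pure_coord M G.I3 G.\<sigma>3 G.d3 "G.ncoef \<circ> h"
  proof (intro pure_coord.intro coord.intro assms(1) coord_axioms.intro pure_coord_axioms.intro
      finite_triples G.finI G.pure_triples iso)
    show "Factorial_Ring.prime p" if "z \<in> G.I3" "p \<in> \<sigma> (fst z)" for z p
      using that G.primes by (auto simp: triples_def)
    show "\<sigma> (fst z) = \<sigma> (fst z')" if "z \<in> G.I3" "z' \<in> G.I3" "\<sigma> (fst z) \<subseteq> \<sigma> (fst z')" for z z'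
      using that G.antichain[of "fst z" "fst z'"] by (cases z; cases z') (simp add: triples_def)
    show "G.d3 z = 0" if "z \<notin> G.I3" for z
      using that by (auto simp: diag_def triples_def split: prod.splits)
  qed
  have ?cubes
  proof (intro allI impI ballI)
    fix \<D> \<tau> assume \<D>: "rank1_decomposition M (Reg M) \<D>" and \<tau>: "\<tau> \<in> critical_types M \<D>"
    obtain S where S: "S \<in> G.\<sigma>3 ` G.I3"
      "group_rank (M\<lparr>carrier := Reg_part M \<D> \<tau>\<rparr>) = enat (card {z \<in> G.I3. \<sigma> (fst z) = S})"
      using M.rank_critical[OF \<D> \<tau>] by blast
    have "card {i \<in> I. \<sigma> i = S} > 0"
      using S(1) G.finI unfolding image_triples by (auto simp: card_gt_0_iff)
    then show "\<exists>k::nat. k > 0 \<and> group_rank (M\<lparr>carrier := Reg_part M \<D> \<tau>\<rparr>) = enat (k ^ 3)"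
      using S(2) card_triples_block[OF G.finI, of \<sigma> S] by auto
  qed
  then show "class_A0 M \<and> ?cubes" using M.class_A0 by blast
next
  assume rhs: "class_A0 M \<and> ?cubes"
  obtain I :: "'a set set" and \<sigma> d \<phi> where norm: "pure_coord M I \<sigma> d \<phi>" "sparse I \<sigma> d"
    using class_A0_normal_form rhs by blast
  obtain s w c k where M: "mult_coord M I \<sigma> d \<phi> s w c k" using mult_coord_exists[OF norm] by blast
  interpret M: pure_coord M I \<sigma> d \<phi> by fact
  have dec: "rank1_decomposition M (Reg M) (M.part ` I)" using M.dec_L M.Reg_eq_L by simp
  show ?lhs
  proof (rule realization[OF M norm(2) _ assms(2)])
    fix S assume S: "S \<in> \<sigma> ` I"
    obtain n :: nat where "n > 0" "group_rank (M\<lparr>carrier := Reg_part M (M.part ` I) (itype S)\<rparr>) = enat (n ^ 3)"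
      using rhs dec M.critical_rank(1)[OF dec S] by blast
    then show "\<exists>n>0. card {i \<in> I. \<sigma> i = S} = n ^ 3"
      using M.critical_rank(2)[OF dec S] by auto
  qed
qed

end
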